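(* Let $\lambda\in\mathbb C$ and let $v\in\mathscr H$ with $v'\in\mathscr H$, assume that the Riemann surface $\mathcal R$ of the multipliers is 3-sheeted, and let $\tau_j=\tau_j(\lambda)$, $j=1,2,3$, be the multipliers of $\psi(\lambda)$. Then we have $$\tau_3(\lambda)=e^{-i\left(\lambda-\frac{\mathfrak b_3+o(1)}{2\lambda}\right)},\qquad \tau_m(\lambda)=e^{i\left(\lambda-\frac{\mathfrak b_m+o(1)}{2\lambda}\right)},\quad m=1,2,$$ $$\Delta_j(\lambda)=\cos\Big(\lambda-\frac{\mathfrak b_j+o(1)}{2\lambda}\Big),\qquad j=1,2,3,$$ where $|\lambda-\pi n|\ge\delta$ for all $n\in\mathbb Z$ and for each $\delta\in(0,\tfrac12)$, and $$\mathfrak D(\lambda)=\frac{1}{(4\lambda)^2}\,(\mathfrak b_o+o(1))\,\sin^2(\lambda-k_{32})\,\sin^2(\lambda-k_{31}),\qquad\text{where}\quad k_{3m}=\frac{\mathfrak b_3+\mathfrak b_m+o(1)}{4\lambda},\quad m=1,2,$$ as $|\lambda|\to\infty$, uniformly on bounded subsets of $(\arg\lambda,v)\in[0,2\pi]\times\mathscr H$.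
   Context: Let $\mathbb T=\mathbb R/\mathbb Z$ and let $\mathscr H=L^2(\mathbb T)\oplus L^2(\mathbb T)$ (complex Hilbert space) with $\|v\|^2=\int_0^1(|v_1|^2+|v_2|^2)dx$ for $v=(v_1,v_2)^\top$. Put $J=\mathrm{diag}(1,-1,-1)$ and $V=\begin{pmatrix}0&v^*\\ v&0\end{pmatrix}$ ($3\times3$ matrix). For $\lambda\in\mathbb C$ let $y(x,\lambda)$ be the $3\times 3$ matrix solution of $iJy'+Vy=\lambda y$, $y(0,\lambda)=\mathbf 1_3$, and let $\psi(\lambda)=y(1,\lambda)$ be the monodromy matrix. Its eigenvalues $\tau_1(\lambda),\tau_2(\lambda),\tau_3(\lambda)$ are called the multipliers; they are the branches of an analytic function on a 3-sheeted or 2-sheeted Riemann surface $\mathcal R$. The surface $\mathcal R$ is 2-sheeted if and only if $v=ue$ for some $u\in L^2(\mathbb T)$ and a constant vector $e\in\mathbb C^2$, $|e|=1$; otherwise it is 3-sheeted. The multipliers are labelled so that, as $|\lambda|\to\infty$ with $|\lambda-\pi n|\ge\delta$ for all $n\in\mathbb Z$ (for some small $\delta\in(0,\frac12)$), $\tau_j(\lambda)=\tau_j^o(\lambda)(1+o(1))$, where $\tau_1^o=\tau_2^o=e^{i\lambda}$, $\tau_3^o=e^{-i\lambda}$. The Lyapunov function has branches $\Delta_j=\frac12(\tau_j+\tau_j^{-1})$, and the (modified) discriminant is $$\mathfrak D(\lambda)=-\frac{e^{-2i\lambda}}{64}(\tau_1-\tau_2)^2(\tau_1-\tau_3)^2(\tau_2-\tau_3)^2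 .$$ The constants are $$\mathfrak b_3=\|v\|^2,\quad \mathfrak b_2=\tfrac12(\|v\|^2+\sqrt{\mathfrak b_o}),\quad \mathfrak b_1=\tfrac12(\|v\|^2-\sqrt{\mathfrak b_o}),\quad \mathfrak b_o=(\|v_1\|^2-\|v_2\|^2)^2+4\Big|\int_0^1v_1\overline{v_2}\,dx\Big|^2,$$ where $\|v_j\|^2=\int_0^1|v_j|^2dx$; $\mathfrak b_1,\mathfrak b_2,\mathfrak b_3$ are the eigenvalues of $\int_0^1V(x)^2dx$.
   Formalization: Uniformity is for sets of v with both ‖v‖ and ‖v'‖ bounded; with only ‖v‖ bounded it fails, e.g. for v₁=a·e^{2πinx}, small v₂ not proportional to v₁, at λ=πn+δ as n→∞. *)

theory Defs
  imports "HOL-Analysis.Analysis"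
begin

text \<open>
  Elements of \<open>L\<^sup>2(\<real>/\<int>) \<oplus> L\<^sup>2(\<real>/\<int>)\<close> are represented by Borel measurable 1-periodic functions
  \<open>v :: real \<Rightarrow> complex ^ 2\<close>. Within this class, every
  notion below is invariant under changing \<open>v\<close> on a null set. The spectral parameter is \<open>\<zeta>\<close>.
\<close>

definition L2_torus :: "(real \<Rightarrow> complex ^ 2) set" where
  "L2_torus = {v. v \<in> borel_measurable borel \<and> (\<forall>x. v (x + 1) = v x) \<and>
     set_integrable lborel {0..1} (\<lambda>x. (norm (v x))\<^sup>2)}"

definition L2_norm :: "(real \<Rightarrow> complex ^ 2) \<Rightarrow> real" where
  "L2_norm v = sqrt (LINT x:{0..1}|lborel. (norm (v x))\<^sup>2)"

text \<open>
  \<open>v' = w\<close> on the circle, for square integrable \<open>v\<close> and \<open>w\<close>: up to a null set, \<open>v\<close> is an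
  absolutely continuous primitive of \<open>w\<close> on the whole line. Periodicity of \<open>v\<close> then forces
  \<open>w\<close> to have mean zero.
\<close>

definition has_L2_deriv :: "(real \<Rightarrow> complex ^ 2) \<Rightarrow> (real \<Rightarrow> complex ^ 2) \<Rightarrow> bool" where
  "has_L2_deriv v w \<longleftrightarrow> v \<in> L2_torus \<and> w \<in> L2_torus \<and>
     (\<exists>c. AE x in lborel. v x = c + (LBINT t=0..x. w t))"

definition J_mat :: "complex ^ 3 ^ 3" where
  "J_mat = vector [vector [1, 0, 0], vector [0, -1, 0], vector [0, 0, -1]]"

definition V_mat :: "complex ^ 2 \<Rightarrow> complex ^ 3 ^ 3" where
  "V_mat a = vector [vector [0, cnj (a $ 1), cnj (a $ 2)],
                     vector [a $ 1, 0, 0],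
                     vector [a $ 2, 0, 0]]"

text \<open>
  Solutions of \<open>i J y' + V y = \<zeta> y\<close>, \<open>y(0) = 1\<close>, in the Caratheodory sense: \<open>y\<close> is absolutely
  continuous and the equation holds almost everywhere. Only \<open>[0, 1]\<close> matters for the monodromy
  matrix. Multiplication by the scalar \<open>z\<close> is written as multiplication by \<open>mat z\<close>.
\<close>

definition is_fundamental_solution ::
  "(real \<Rightarrow> complex ^ 2) \<Rightarrow> complex \<Rightarrow> (real \<Rightarrow> complex ^ 3 ^ 3) \<Rightarrow> bool" where
  "is_fundamental_solution v \<zeta> y \<longleftrightarrow>
     (\<exists>y'. set_integrable lborel {0..1} y' \<and>
        (\<forall>x\<in>{0..1}. y x = mat 1 + (LINT t:{0..x}|lborel. y' t)) \<and>
        (AE x\<in>{0..1} in lborel. mat \<i> ** J_mat ** y' x + V_mat (v x) ** y x = mat \<zeta> ** y x))"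

definition monodromy :: "(real \<Rightarrow> complex ^ 2) \<Rightarrow> complex \<Rightarrow> complex ^ 3 ^ 3" where
  "monodromy v \<zeta> = (THE M. \<exists>y. is_fundamental_solution v \<zeta> y \<and> M = y 1)"

definition multipliers :: "(real \<Rightarrow> complex ^ 2) \<Rightarrow> complex \<Rightarrow> complex set" where
  "multipliers v \<zeta> = {z. det (mat z - monodromy v \<zeta>) = 0}"

text \<open>
  The part of the Riemann surface of the multipliers lying over the set of \<open>\<zeta>\<close> at which they are
  pairwise distinct. The discriminant of the characteristic polynomial is entire in \<open>\<zeta>\<close>, so, unless
  it vanishes identically, only a discrete set of \<open>\<zeta>\<close> is left out (the branch points and the
  accidental crossings), and what remains is an unbranched threefold covering. The three multipliers
  are branches of one analytic function on a 3-sheeted surface precisely when this covering is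
  connected. Otherwise it splits into several surfaces with fewer sheets.
\<close>

definition multiplier_surface :: "(real \<Rightarrow> complex ^ 2) \<Rightarrow> (complex \<times> complex) set" where
  "multiplier_surface v = {(\<zeta>, z). z \<in> multipliers v \<zeta> \<and> card (multipliers v \<zeta>) = 3}"

definition three_sheeted :: "(real \<Rightarrow> complex ^ 2) \<Rightarrow> bool" where
  "three_sheeted v \<longleftrightarrow> multiplier_surface v \<noteq> {} \<and> connected (multiplier_surface v)"

definition admissible :: "(real \<Rightarrow> complex ^ 2) set" where
  "admissible = {v. (\<exists>w. has_L2_deriv v w) \<and> three_sheeted v}"

text \<open>Boundedness in the natural norm of \<open>{v. v, v' \<in> L\<^sup>2}\<close>; boundedness of \<open>v\<close> alone in \<open>L\<^sup>2\<close>
  would not give uniform asymptotics (consider \<open>v\<^sub>1(x) = a exp(2\<pi>inx)\<close> at \<open>\<zeta>\<close> close to \<open>\<pi>n\<close>).\<close>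

definition H1_bounded :: "(real \<Rightarrow> complex ^ 2) set \<Rightarrow> bool" where
  "H1_bounded B \<longleftrightarrow> (\<exists>R. \<forall>v\<in>B. \<exists>w. has_L2_deriv v w \<and> L2_norm v \<le> R \<and> L2_norm w \<le> R)"

text \<open>The filter \<open>\<bar>\<zeta>\<bar> \<rightarrow> \<infinity>\<close>, \<open>\<bar>\<zeta> - \<pi>n\<bar> \<ge> \<delta>\<close> for all integers \<open>n\<close>, uniformly in \<open>arg \<zeta>\<close>.\<close>

definition away_at_infinity :: "real \<Rightarrow> complex filter" where
  "away_at_infinity \<delta> =
     inf at_infinity (principal {\<zeta>. \<forall>n::int. \<delta> \<le> cmod (\<zeta> - of_real (pi * of_int n))})"

definition free_multiplier :: "nat \<Rightarrow> complex \<Rightarrow> complex" where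
  "free_multiplier j \<zeta> = (if j = 3 then exp (- \<i> * \<zeta>) else exp (\<i> * \<zeta>))"

text \<open>
  \<open>t j \<zeta>\<close> (\<open>j = 1, 2, 3\<close>) lists the eigenvalues of the monodromy matrix with algebraic multiplicity,
  labelled by their asymptotics. This convention does not tell 1 from 2.
\<close>

definition is_multiplier_labelling ::
  "(real \<Rightarrow> complex ^ 2) \<Rightarrow> (nat \<Rightarrow> complex \<Rightarrow> complex) \<Rightarrow> bool" where
  "is_multiplier_labelling v t \<longleftrightarrow>
     (\<forall>\<zeta> z. det (mat z - monodromy v \<zeta>) = (\<Prod>j\<in>{1,2,3}. z - t j \<zeta>)) \<and>
     (\<forall>\<delta>\<in>{0<..<1/2}. \<forall>j\<in>{1,2,3}.
        ((\<lambda>\<zeta>. t j \<zeta> / free_multiplier j \<zeta>) \<longlongrightarrow> 1) (away_at_infinity \<delta>))"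

definition lyapunov :: "complex \<Rightarrow> complex" where
  "lyapunov z = (z + inverse z) / 2"

definition discriminant :: "(nat \<Rightarrow> complex \<Rightarrow> complex) \<Rightarrow> complex \<Rightarrow> complex" where
  "discriminant t \<zeta> = - (exp (- 2 * \<i> * \<zeta>) / 64) *
     (t 1 \<zeta> - t 2 \<zeta>)\<^sup>2 * (t 1 \<zeta> - t 3 \<zeta>)\<^sup>2 * (t 2 \<zeta> - t 3 \<zeta>)\<^sup>2"

definition b_o :: "(real \<Rightarrow> complex ^ 2) \<Rightarrow> real" where
  "b_o v =
     ((LINT x:{0..1}|lborel. (cmod (v x $ 1))\<^sup>2) - (LINT x:{0..1}|lborel. (cmod (v x $ 2))\<^sup>2))\<^sup>2 +
     4 * (cmod (LINT x:{0..1}|lborel. v x $ 1 * cnj (v x $ 2)))\<^sup>2"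

definition b_const :: "(real \<Rightarrow> complex ^ 2) \<Rightarrow> nat \<Rightarrow> real" where
  "b_const v j =
     (if j = 1 then ((L2_norm v)\<^sup>2 - sqrt (b_o v)) / 2
      else if j = 2 then ((L2_norm v)\<^sup>2 + sqrt (b_o v)) / 2
      else (L2_norm v)\<^sup>2)"

end

theory Submission
  imports Defs "HOL-Computational_Algebra.Fundamental_Theorem_Algebra"
begin

text \<open>
  Write \<open>y = (y\<^sub>1, z)\<close> with \<open>z\<close> in \<open>\<complex>\<^sup>2\<close>. The matrix Riccati equation \<open>S' = 2i\<zeta>S - iv - iS(v\<^sup>*S)\<close> has a
  1-periodic solution \<open>S = v/(2\<zeta>) + \<dots>\<close> of size \<open>O(1/\<zeta>)\<close>, because the periodic Green operator of
  \<open>d/dx - 2i\<zeta>\<close> is bounded uniformly in \<open>\<zeta>\<close> at distance \<open>\<delta>\<close> from \<open>\<pi>\<int>\<close>, and one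
  integration by parts gains the factor \<open>1/\<zeta>\<close>. The substitution \<open>z = S y\<^sub>1 + u\<close> is periodic
  and makes the system block triangular, so the multipliers are exactly
  \<open>exp(-i\<zeta> + i\<integral>v\<^sup>*S)\<close> and \<open>exp(i\<zeta>)\<close> times the eigenvalues of \<open>U(1)\<close>, where \<open>U' = -iSv\<^sup>*U\<close>,
  \<open>U(0) = 1\<close>. Integrating the Riccati equation against \<open>v\<^sup>*\<close> gives
  \<open>\<integral>Sv\<^sup>* = (2\<zeta>)\<^sup>-\<^sup>1\<integral>vv\<^sup>* + O(\<zeta>\<^sup>-\<^sup>2)\<close>, and \<open>b\<^sub>1, b\<^sub>2\<close> are the eigenvalues of the Gram matrix
  \<open>\<integral>vv\<^sup>*\<close>. The exponentially large and small multipliers are never compared, so the estimates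
  are uniform in \<open>arg \<zeta>\<close>.
\<close>

section \<open>Contraction and integration by parts\<close>

text \<open>Off the real axis a norm comparison of the monodromy matrix with its free value is
  useless: an error on the dominant exponential swamps the recessive one. Hence the exact
  decoupling. A periodic \<open>S\<close> makes the change of variables the same matrix at 0 and at
  1, so the eigenvalues are read off the diagonal blocks, and the coupling between the blocks never
  has to be estimated. The second obstacle is that the two multipliers close to
  \<open>exp (\<i> * \<zeta>)\<close> separate only at order \<open>1 / \<zeta>\<close>, and no
  lower bound on \<open>b_o\<close> is available. Eigenvalues of the rescaled block therefore follow
  its entries only at a square root rate, which is still enough for o(1). The discriminant sees only
  the squared gap, so nothing is ever divided by \<open>b_1 - b_2\<close>. For the same reason the
  leading asymptotics cannot tell the labels 1 and 2 apart; one labelling has to be constructed that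
  serves every \<open>\<delta>\<close> and every bounded set. The potential enters the bounds only
  through one constant \<open>m\<close>, the distance to the excluded points only through
  \<open>C = 1 / \<delta>\<close>.\<close>

text \<open>Precomposing with \<open>clamp 0 1\<close> turns functions on the interval into bounded
  continuous functions on the line, a complete space in which Banach's theorem applies to the closed
  ball of radius \<open>\<rho>\<close>. The hypotheses are restricted to that ball because the
  Riccati map is quadratic and contracts only near 0.\<close>

lemma contraction_on_unit_interval:
  fixes \<Phi> :: "(real \<Rightarrow> 'a::banach) \<Rightarrow> real \<Rightarrow> 'a"
  assumes "0 \<le> \<rho>"
    and cont: "\<And>f. continuous_on {0..1} f \<Longrightarrow> \<forall>x\<in>{0..1}. norm (f x) \<le> \<rho> \<Longrightarrow>
      continuous_on {0..1} (\<Phi> f)"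
    and bound: "\<And>f x. continuous_on {0..1} f \<Longrightarrow> \<forall>x\<in>{0..1}. norm (f x) \<le> \<rho> \<Longrightarrow>
      x \<in> {0..1} \<Longrightarrow> norm (\<Phi> f x) \<le> \<rho>"
    and lip: "\<And>f g e x. continuous_on {0..1} f \<Longrightarrow> \<forall>x\<in>{0..1}. norm (f x) \<le> \<rho> \<Longrightarrow>
      continuous_on {0..1} g \<Longrightarrow> \<forall>x\<in>{0..1}. norm (g x) \<le> \<rho> \<Longrightarrow>
      \<forall>x\<in>{0..1}. norm (f x - g x) \<le> e \<Longrightarrow> x \<in> {0..1} \<Longrightarrow> norm (\<Phi> f x - \<Phi> g x) \<le> e / 2"
  obtains f where "continuous_on {0..1} f" "\<And>x. x \<in> {0..1} \<Longrightarrow> norm (f x) \<le> \<rho>"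
    "\<And>x. x \<in> {0..1} \<Longrightarrow> \<Phi> f x = f x"
proof -
  define s :: "(real \<Rightarrow>\<^sub>C 'a) set" where "s = cball 0 \<rho>"
  have s_iff: "f \<in> s \<longleftrightarrow> (\<forall>x. norm (apply_bcontfun f x) \<le> \<rho>)" for f
    unfolding s_def using norm_bounded[of f] norm_bound[of f \<rho>]
    by (auto simp: dist_norm intro: order_trans)
  have s_in: "\<forall>x\<in>{0..1}. norm (apply_bcontfun f x) \<le> \<rho>" if "f \<in> s" for f
    using that s_iff by auto
  have cl: "clamp 0 1 x \<in> {0..1::real}" for x :: real
    using clamp_in_interval[of 0 1 x] by (auto simp: cbox_interval)
  define \<Psi> :: "(real \<Rightarrow>\<^sub>C 'a) \<Rightarrow> (real \<Rightarrow>\<^sub>C 'a)"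
    where "\<Psi> f = Bcontfun (\<lambda>x. \<Phi> (apply_bcontfun f) (clamp 0 1 x))" for f
  have app: "apply_bcontfun (\<Psi> f) x = \<Phi> (apply_bcontfun f) (clamp 0 1 x)" if "f \<in> s" for f x
  proof -
    have "continuous_on UNIV (\<lambda>x. \<Phi> (apply_bcontfun f) (clamp 0 1 x))"
      by (rule clamp_continuous_on) (use cont[OF _ s_in[OF that]] in \<open>auto simp: cbox_interval\<close>)
    moreover have "norm (\<Phi> (apply_bcontfun f) (clamp 0 1 x)) \<le> \<rho>" for x
      using bound[OF _ s_in[OF that] cl] by auto
    ultimately show ?thesis
      unfolding \<Psi>_def by (subst Bcontfun_inverse) (auto intro: bcontfun_normI)
  qed
  have "\<exists>!f\<in>s. \<Psi> f = f"
  proof (rule Banach_fix[where c = "1/2"])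
    show "complete s" by (auto simp: s_def complete_eq_closed)
    show "s \<noteq> {}" using assms(1) by (auto simp: s_def)
    show "\<Psi> ` s \<subseteq> s"
      using bound[OF _ s_in cl] by (auto simp: s_iff[of "\<Psi> _"] app)
    show "dist (\<Psi> f) (\<Psi> g) \<le> 1 / 2 * dist f g" if "f \<in> s" "g \<in> s" for f g
    proof (rule dist_bound)
      fix x
      have "norm (\<Phi> (apply_bcontfun f) (clamp 0 1 x) - \<Phi> (apply_bcontfun g) (clamp 0 1 x)) \<le> dist f g / 2"
        by (rule lip[OF _ s_in[OF that(1)] _ s_in[OF that(2)] _ cl])
          (auto simp: dist_norm[symmetric] dist_bounded)
      then show "dist (apply_bcontfun (\<Psi> f) x) (apply_bcontfun (\<Psi> g) x) \<le> 1 / 2 * dist f g"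
        using that by (simp add: app dist_norm)
    qed
  qed auto
  then obtain f where f: "f \<in> s" "\<Psi> f = f" by auto
  show ?thesis
  proof
    show "\<Phi> (apply_bcontfun f) x = apply_bcontfun f x" if "x \<in> {0..1}" for x
      using app[OF f(1), of x] f(2) that by (simp add: cbox_interval)
  qed (use f s_iff in auto)
qed

lemma continuous_mult_absolutely_integrable:
  fixes f w :: "real \<Rightarrow> complex"
  assumes "continuous_on {a..b} f" "w absolutely_integrable_on {a..b}"
  shows "(\<lambda>x. f x * w x) absolutely_integrable_on {a..b}"
  by (rule absolutely_integrable_bounded_measurable_product[where h = "(*)"])
    (use assms in \<open>auto simp: bilinear_times compact_imp_bounded compact_continuous_image
       intro!: continuous_imp_measurable_on_sets_lebesgue\<close>)

text \<open>Since \<open>w\<close> is merely integrable, \<open>v\<close> need not be differentiable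
  everywhere. The defect \<open>H\<close> of the formula nevertheless has increments at most
  \<open>2 * L * (y - x) * (A y - A x)\<close>, where \<open>A\<close> is a primitive of
  \<open>norm w\<close>. As \<open>A\<close> is continuous, this is o(y - x), so \<open>H\<close>
  has derivative zero at every point and is constant.\<close>

lemma integration_by_parts_indefinite_integral:
  fixes \<phi> \<phi>' w v :: "real \<Rightarrow> complex"
  assumes ab: "a \<le> b"
    and der: "\<And>x. x \<in> {a..b} \<Longrightarrow> (\<phi> has_vector_derivative \<phi>' x) (at x within {a..b})"
    and cont: "continuous_on {a..b} \<phi>'"
    and w: "w absolutely_integrable_on {a..b}"
    and v: "\<And>x y. a \<le> x \<Longrightarrow> x \<le> y \<Longrightarrow> y \<le> b \<Longrightarrow> v y - v x = integral {x..y} w"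
  shows "integral {a..b} (\<lambda>t. \<phi>' t * v t) = \<phi> b * v b - \<phi> a * v a - integral {a..b} (\<lambda>t. \<phi> t * w t)"
proof -
  have w_int: "w integrable_on {x..y}" "(\<lambda>t. norm (w t)) integrable_on {x..y}"
    if "a \<le> x" "y \<le> b" for x y
    using absolutely_integrable_on_subinterval[OF w, of x y] that
    by (auto simp: absolutely_integrable_on_def)
  have cont_\<phi>: "continuous_on {a..b} \<phi>"
    by (rule continuous_on_vector_derivative) (use der in auto)
  have v_eq: "v x = v a + integral {a..x} w" if "x \<in> {a..b}" for x
    using v[of a x] that by (simp add: algebra_simps)
  have cont_v: "continuous_on {a..b} v"
    by (subst continuous_on_cong[OF refl v_eq])
      (auto intro!: continuous_intros indefinite_integral_continuous_1 w_int)
  obtain L where L: "L > 0" "\<And>t. t \<in> {a..b} \<Longrightarrow> norm (\<phi>' t) \<le> L"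
    using compact_continuous_image[OF cont compact_Icc, THEN compact_imp_bounded]
    by (auto simp: bounded_pos)
  define A where "A x = integral {a..x} (\<lambda>t. norm (w t))" for x
  have A_diff: "A y - A x = integral {x..y} (\<lambda>t. norm (w t))" if "a \<le> x" "x \<le> y" "y \<le> b" for x y
    using Henstock_Kurzweil_Integration.integral_combine[of a x y "\<lambda>t. norm (w t)"] that w_int
    by (simp add: A_def)
  have cont_A: "continuous_on {a..b} A"
    unfolding A_def by (intro indefinite_integral_continuous_1 w_int) auto
  have \<phi>w: "(\<lambda>t. \<phi> t * w t) integrable_on {x..y}" if "a \<le> x" "y \<le> b" for x y
    using continuous_mult_absolutely_integrable[OF cont_\<phi> w] that
    by (meson absolutely_integrable_on_def absolutely_integrable_on_subinterval atLeastatMost_subset_iff)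
  have \<phi>v: "(\<lambda>t. \<phi>' t * v t) integrable_on {x..y}" if "a \<le> x" "y \<le> b" for x y
    by (intro integrable_continuous_interval continuous_intros continuous_on_subset[OF cont]
        continuous_on_subset[OF cont_v]) (use that in auto)
  define H where "H x = integral {a..x} (\<lambda>t. \<phi>' t * v t) + integral {a..x} (\<lambda>t. \<phi> t * w t) - \<phi> x * v x" for x
  have step: "norm (H y - H x) \<le> (y - x) * (2 * L * (A y - A x))" if xy: "a \<le> x" "x \<le> y" "y \<le> b" for x y
  proof -
    have A_mono: "integral {x..t} (\<lambda>t. norm (w t)) \<le> A y - A x" if "x \<le> t" "t \<le> y" for t
      using A_diff[of x t] A_diff[of t y] xy that integral_nonneg[OF w_int(2), of t y] by auto
    have ftc: "integral {s..t} \<phi>' = \<phi> t - \<phi> s" if "x \<le> s" "s \<le> t" "t \<le> y" for s t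
      by (intro integral_unique fundamental_theorem_of_calculus)
        (use that xy in \<open>auto intro!: has_vector_derivative_within_subset[OF der]\<close>)
    have c: "continuous_on {x..y} \<phi>'" "continuous_on {x..y} v" "continuous_on {x..y} \<phi>"
      using cont cont_v cont_\<phi> xy by (auto intro: continuous_on_subset)
    have 1: "integral {x..y} (\<lambda>t. \<phi>' t * (v t - v x)) = integral {x..y} (\<lambda>t. \<phi>' t * v t) - (\<phi> y - \<phi> x) * v x"
    proof -
      have "integral {x..y} (\<lambda>t. \<phi>' t * v t - \<phi>' t * v x) =
        integral {x..y} (\<lambda>t. \<phi>' t * v t) - integral {x..y} (\<lambda>t. \<phi>' t * v x)"
        by (intro Henstock_Kurzweil_Integration.integral_diff integrable_continuous_interval continuous_intros c)
      then show ?thesis using ftc[of x y] xy by (simp add: algebra_simps)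
    qed
    have 2: "integral {x..y} (\<lambda>t. (\<phi> t - \<phi> y) * w t) = integral {x..y} (\<lambda>t. \<phi> t * w t) - \<phi> y * (v y - v x)"
    proof -
      have "integral {x..y} (\<lambda>t. \<phi> t * w t - \<phi> y * w t) =
        integral {x..y} (\<lambda>t. \<phi> t * w t) - integral {x..y} (\<lambda>t. \<phi> y * w t)"
        by (intro Henstock_Kurzweil_Integration.integral_diff \<phi>w integrable_on_mult_right w_int) (use xy in auto)
      then show ?thesis using v[of x y] xy by (simp add: algebra_simps)
    qed
    \<comment> \<open>Freezing \<open>v\<close> at the left end and \<open>\<phi>\<close> at the
      right end makes the two corrections add up to exactly the increment of
      \<open>\<phi> * v\<close>. Each remaining integrand contains one small factor.\<close>
    have "H y - H x = integral {x..y} (\<lambda>t. \<phi>' t * (v t - v x)) + integral {x..y} (\<lambda>t. (\<phi> t - \<phi> y) * w t)"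
      unfolding 1 2 H_def
      using Henstock_Kurzweil_Integration.integral_combine[OF xy(1,2) \<phi>v]
        Henstock_Kurzweil_Integration.integral_combine[OF xy(1,2) \<phi>w] xy
      by (simp add: algebra_simps)
    moreover have "norm (integral {x..y} (\<lambda>t. \<phi>' t * (v t - v x))) \<le> L * (A y - A x) * (y - x)"
    proof (rule integral_bound)
      fix t assume t: "t \<in> {x..y}"
      have "norm (v t - v x) \<le> integral {x..t} (\<lambda>t. norm (w t))"
        using v[of x t] t xy by (auto intro!: Henstock_Kurzweil_Integration.integral_norm_bound_integral w_int)
      then have "norm (v t - v x) \<le> A y - A x"
        using A_mono[of t] t by auto
      moreover have "norm (\<phi>' t) \<le> L" using L(2)[of t] xy t by auto
      ultimately show "norm (\<phi>' t * (v t - v x)) \<le> L * (A y - A x)"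
        using L(1) by (simp add: norm_mult mult_mono)
    qed (use xy in \<open>auto intro!: continuous_intros c\<close>)
    moreover have "norm (integral {x..y} (\<lambda>t. (\<phi> t - \<phi> y) * w t)) \<le> integral {x..y} (\<lambda>t. L * (y - x) * norm (w t))"
    proof (rule Henstock_Kurzweil_Integration.integral_norm_bound_integral)
      show "(\<lambda>t. (\<phi> t - \<phi> y) * w t) integrable_on {x..y}"
        using Henstock_Kurzweil_Integration.integrable_diff[OF \<phi>w[of x y] integrable_on_mult_right[OF w_int(1)[of x y], of "\<phi> y"]] xy
        by (simp add: algebra_simps)
      show "(\<lambda>t. L * (y - x) * norm (w t)) integrable_on {x..y}"
        by (intro integrable_on_mult_right w_int) (use xy in auto)
      fix t assume t: "t \<in> {x..y}"
      have "norm (\<phi> y - \<phi> t) \<le> L * (y - t)"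
        using ftc[of t y] t xy L(2)
        by (auto intro!: integral_bound continuous_on_subset[OF c(1)] simp flip: ftc)
      also have "\<dots> \<le> L * (y - x)" using t L(1) by (auto intro!: mult_left_mono)
      finally show "norm ((\<phi> t - \<phi> y) * w t) \<le> L * (y - x) * norm (w t)"
        by (simp add: norm_mult norm_minus_commute mult_right_mono)
    qed
    moreover have "integral {x..y} (\<lambda>t. L * (y - x) * norm (w t)) = L * (y - x) * (A y - A x)"
      using A_diff[OF xy] by simp
    ultimately show ?thesis
      using norm_triangle_ineq[of "integral {x..y} (\<lambda>t. \<phi>' t * (v t - v x))" "integral {x..y} (\<lambda>t. (\<phi> t - \<phi> y) * w t)"]
      by (simp add: algebra_simps)
  qed
  have step': "norm (H y - H x) \<le> norm (y - x) * (2 * L * norm (A y - A x))" if "x \<in> {a..b}" "y \<in> {a..b}" for x y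
  proof (cases "x \<le> y")
    case True
    have "(y - x) * (2 * L * (A y - A x)) \<le> norm (y - x) * (2 * L * norm (A y - A x))"
      using True L by (auto intro!: mult_left_mono)
    then show ?thesis using step[of x y] True that by (metis atLeastAtMost_iff order_trans)
  next
    case False
    have "(x - y) * (2 * L * (A x - A y)) \<le> norm (y - x) * (2 * L * norm (A y - A x))"
      using False L by (auto intro!: mult_left_mono)
    moreover have "norm (H x - H y) \<le> (x - y) * (2 * L * (A x - A y))"
      by (rule step) (use False that in auto)
    ultimately show ?thesis by (simp add: norm_minus_commute)
  qed
  have "(H has_derivative (\<lambda>h. 0)) (at x within {a..b})" if x: "x \<in> {a..b}" for x
    unfolding has_derivative_within_alt2
  proof (intro conjI allI impI)
    fix e :: real assume "e > 0"
    then have "\<forall>\<^sub>F y in at x within {a..b}. dist (A y) (A x) < e / (2 * L)"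
      using cont_A x L by (auto simp: continuous_on tendsto_iff)
    moreover have "\<forall>\<^sub>F y in at x within {a..b}. y \<in> {a..b}"
      by (auto simp: eventually_at_filter)
    ultimately show "\<forall>\<^sub>F y in at x within {a..b}. norm (H y - H x - 0) \<le> e * norm (y - x)"
    proof eventually_elim
      case (elim y)
      have "norm (y - x) * (2 * L * norm (A y - A x)) \<le> norm (y - x) * e"
        using elim L by (intro mult_left_mono) (auto simp: dist_norm field_simps)
      then show ?case using step'[OF x elim(2)] by (auto simp: mult.commute)
    qed
  qed auto
  from has_derivative_zero_constant[OF _ this] obtain c where "\<forall>x\<in>{a..b}. H x = c"
    by auto
  then have "H a = H b" using ab by auto
  then show ?thesis by (simp add: H_def algebra_simps)
qed

section \<open>The periodic Green operator\<close>

lemma has_vector_derivative_cexp: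
  fixes f :: "real \<Rightarrow> complex"
  assumes "(f has_vector_derivative f') (at x within S)"
  shows "((\<lambda>x. exp (f x)) has_vector_derivative f' * exp (f x)) (at x within S)"
  using field_vector_diff_chain_within[OF assms, of exp "exp (f x)"]
  by (simp add: o_def DERIV_exp[THEN DERIV_subset])

lemma has_vector_derivative_cexp_linear:
  "((\<lambda>t. exp (k * complex_of_real t)) has_vector_derivative k * exp (k * complex_of_real x)) (at x within S)"
proof (rule has_vector_derivative_cexp)
  show "((\<lambda>t. k * complex_of_real t) has_vector_derivative k) (at x within S)"
    using has_vector_derivative_mult_right[OF has_vector_derivative_of_real[OF DERIV_ident]]
    by simp
qed

text \<open>If \<open>q = exp (2 * \<i> * z)\<close> were within \<open>\<delta>\<close> of 1, its
  principal logarithm would have modulus below \<open>2 * \<delta>\<close>; as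
  \<open>2 * \<i> * z\<close> differs from it by a multiple of \<open>2 * pi * \<i>\<close>, the
  point \<open>z\<close> would be closer than \<open>\<delta>\<close> to some \<open>pi * n\<close>.
  The bound on the logarithm is where \<open>\<delta> < 1/2\<close> enters.\<close>

lemma norm_one_minus_exp_ge:
  assumes \<delta>: "0 < \<delta>" "\<delta> < 1/2"
    and away: "\<And>n::int. \<delta> \<le> cmod (z - of_real (pi * of_int n))"
  shows "\<delta> \<le> cmod (1 - exp (2 * \<i> * z))"
proof (rule ccontr)
  define q where "q = exp (2 * \<i> * z)"
  assume "\<not> \<delta> \<le> cmod (1 - exp (2 * \<i> * z))"
  then have small: "cmod (q - 1) < \<delta>" by (simp add: q_def norm_minus_commute)
  have Ln: "cmod (Ln q) \<le> 2 * cmod (q - 1)"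
    using norm_Ln_le[of "q - 1"] small \<delta> by simp
  have "q \<noteq> 0" by (simp add: q_def)
  then have "exp (2 * \<i> * z) = exp (Ln q)" by (simp add: q_def)
  then obtain n :: int where "2 * \<i> * z = Ln q + (of_int (2 * n) * pi) * \<i>"
    by (auto simp: exp_eq)
  then have "2 * \<i> * (z - of_real (pi * of_int n)) = Ln q"
    by (simp add: algebra_simps)
  then have "2 * cmod (z - of_real (pi * of_int n)) = cmod (Ln q)"
    by (metis norm_mult norm_ii mult.right_neutral norm_numeral)
  then show False using away[of n] Ln small by linarith
qed

text \<open>Which of 1 and the exponential dominates depends on the half plane. The preceding bound
  at \<open>z\<close> controls the first and the bound at \<open>- z\<close>, multiplied by
  \<open>exp (2 * \<i> * z)\<close>, the second, so the constant does not see the argument of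
  \<open>z\<close>.\<close>

lemma one_minus_exp_lower_bound:
  assumes \<delta>: "0 < \<delta>" "\<delta> < 1/2"
    and away: "\<And>n::int. \<delta> \<le> cmod (z - of_real (pi * of_int n))"
  shows "max 1 (cmod (exp (2 * \<i> * z))) \<le> 1 / \<delta> * cmod (1 - exp (2 * \<i> * z))"
proof -
  have 1: "\<delta> \<le> cmod (1 - exp (2 * \<i> * z))"
    by (rule norm_one_minus_exp_ge[OF assms])
  have "\<delta> \<le> cmod (- z - of_real (pi * of_int n))" for n :: int
  proof -
    have "- z - of_real (pi * of_int n) = - (z - of_real (pi * of_int (- n)))" by simp
    then show ?thesis using away[of "- n"] by (simp only: norm_minus_cancel)
  qed
  then have 2: "\<delta> \<le> cmod (1 - exp (2 * \<i> * (- z)))"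
    by (rule norm_one_minus_exp_ge[OF \<delta>])
  have "exp (2 * \<i> * z) * (1 - exp (2 * \<i> * (- z))) = exp (2 * \<i> * z) - 1"
    by (simp add: algebra_simps flip: exp_add)
  then have "cmod (exp (2 * \<i> * z)) * cmod (1 - exp (2 * \<i> * (- z))) = cmod (1 - exp (2 * \<i> * z))"
    by (metis norm_mult norm_minus_commute)
  moreover have "cmod (exp (2 * \<i> * z)) * \<delta> \<le> cmod (exp (2 * \<i> * z)) * cmod (1 - exp (2 * \<i> * (- z)))"
    using 2 by (intro mult_left_mono) auto
  ultimately show ?thesis using 1 \<delta> by (simp add: field_simps)
qed

text \<open>The resolvent of \<open>d/dx - 2i\<zeta>\<close> with periodic boundary conditions on \<open>[0, 1]\<close>.\<close>

definition green :: "complex \<Rightarrow> (real \<Rightarrow> complex) \<Rightarrow> real \<Rightarrow> complex" where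
  "green \<zeta> f x =
     (integral {0..x} (\<lambda>t. exp (2 * \<i> * \<zeta> * of_real (x - t)) * f t) +
      integral {x..1} (\<lambda>t. exp (2 * \<i> * \<zeta> * of_real (1 + x - t)) * f t)) / (1 - exp (2 * \<i> * \<zeta>))"

text \<open>Here \<open>x\<close> occurs only in an exponential factor and in a primitive, so this
  form can be differentiated. It is unsuitable for estimates because its factors can be
  exponentially large separately; the bounds use the defining form.\<close>

lemma green_alt:
  assumes "continuous_on {0..1} f" "x \<in> {0..1}"
  shows "green \<zeta> f x = exp (2 * \<i> * \<zeta> * of_real x) / (1 - exp (2 * \<i> * \<zeta>)) *
    ((1 - exp (2 * \<i> * \<zeta>)) * integral {0..x} (\<lambda>t. exp (- 2 * \<i> * \<zeta> * of_real t) * f t) +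
     exp (2 * \<i> * \<zeta>) * integral {0..1} (\<lambda>t. exp (- 2 * \<i> * \<zeta> * of_real t) * f t))"
proof -
  let ?h = "\<lambda>t. exp (- 2 * \<i> * \<zeta> * of_real t) * f t"
  have "integral {0..x} (\<lambda>t. exp (2 * \<i> * \<zeta> * of_real (x - t)) * f t) =
      exp (2 * \<i> * \<zeta> * of_real x) * integral {0..x} ?h"
    by (subst integral_mult_right[symmetric]) (simp add: algebra_simps flip: exp_add)
  moreover have "integral {x..1} (\<lambda>t. exp (2 * \<i> * \<zeta> * of_real (1 + x - t)) * f t) =
      exp (2 * \<i> * \<zeta> * of_real x) * exp (2 * \<i> * \<zeta>) * integral {x..1} ?h"
    by (subst integral_mult_right[symmetric]) (simp add: algebra_simps flip: exp_add)
  moreover have "integral {x..1} ?h = integral {0..1} ?h - integral {0..x} ?h"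
  proof -
    have "integral {0..x} ?h + integral {x..1} ?h = integral {0..1} ?h"
      by (rule Henstock_Kurzweil_Integration.integral_combine)
        (use assms in \<open>auto intro!: integrable_continuous_interval continuous_intros\<close>)
    then show ?thesis unfolding eq_diff_eq by (subst add.commute)
  qed
  moreover have "(E * a + E * e * (b - a)) / (1 - e) = E / (1 - e) * ((1 - e) * a + e * b)" for E a b e :: complex
    by (simp add: algebra_simps add_divide_distrib diff_divide_distrib)
  ultimately show ?thesis
    unfolding green_def by (simp only:)
qed

lemma green_has_vector_derivative:
  assumes f: "continuous_on {0..1} f" and x: "x \<in> {0..1}" and nz: "exp (2 * \<i> * \<zeta>) \<noteq> 1"
  shows "(green \<zeta> f has_vector_derivative 2 * \<i> * \<zeta> * green \<zeta> f x + f x) (at x within {0..1})"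
proof -
  let ?h = "\<lambda>t. exp (- 2 * \<i> * \<zeta> * of_real t) * f t"
  have h: "continuous_on {0..1} ?h" by (intro continuous_intros f)
  define e where "e = exp (2 * \<i> * \<zeta>)"
  define I where "I = integral {0..1} ?h"
  have "((\<lambda>x. exp (2 * \<i> * \<zeta> * of_real x) / (1 - e) * ((1 - e) * integral {0..x} ?h + e * I))
    has_vector_derivative
      (exp (2 * \<i> * \<zeta> * of_real x) / (1 - e) * ((1 - e) * ?h x + 0) +
      2 * \<i> * \<zeta> * exp (2 * \<i> * \<zeta> * of_real x) / (1 - e) * ((1 - e) * integral {0..x} ?h + e * I)))
    (at x within {0..1})"
    by (intro has_vector_derivative_mult has_vector_derivative_add has_vector_derivative_const
        has_vector_derivative_mult_right has_vector_derivative_divide has_vector_derivative_cexp_linear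
        integral_has_vector_derivative h x)
  moreover have "exp (2 * \<i> * \<zeta> * of_real x) / (1 - e) * ((1 - e) * ?h x + 0) = f x"
    using nz by (simp add: e_def field_simps flip: exp_add)
  moreover have "2 * \<i> * \<zeta> * exp (2 * \<i> * \<zeta> * of_real x) / (1 - e) * ((1 - e) * integral {0..x} ?h + e * I) =
      2 * \<i> * \<zeta> * green \<zeta> f x"
    unfolding green_alt[OF f x] e_def I_def by simp
  ultimately have "((\<lambda>x. exp (2 * \<i> * \<zeta> * of_real x) / (1 - e) * ((1 - e) * integral {0..x} ?h + e * I))
    has_vector_derivative 2 * \<i> * \<zeta> * green \<zeta> f x + f x) (at x within {0..1})"
    by (simp only: add.commute)
  then show ?thesis
    by (rule has_vector_derivative_transform[OF x, rotated]) (simp only: green_alt[OF f] e_def I_def)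
qed

lemma green_periodic:
  assumes "continuous_on {0..1} f" "exp (2 * \<i> * \<zeta>) \<noteq> 1"
  shows "green \<zeta> f 1 = green \<zeta> f 0"
  using assms by (simp add: green_alt field_simps)

lemma continuous_on_green:
  assumes "continuous_on {0..1} f" "exp (2 * \<i> * \<zeta>) \<noteq> 1"
  shows "continuous_on {0..1} (green \<zeta> f)"
  by (rule continuous_on_vector_derivative) (use green_has_vector_derivative assms in auto)

lemma green_diff:
  assumes "continuous_on {0..1} f" "continuous_on {0..1} g" "x \<in> {0..1}"
  shows "green \<zeta> (\<lambda>t. f t - g t) x = green \<zeta> f x - green \<zeta> g x"
proof -
  have "continuous_on {0..1} (\<lambda>t. f t - g t)" by (intro continuous_intros assms)
  moreover have diff: "integral {0..x} (\<lambda>t. exp (- 2 * \<i> * \<zeta> * of_real t) * (f t - g t)) =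
    integral {0..x} (\<lambda>t. exp (- 2 * \<i> * \<zeta> * of_real t) * f t) -
    integral {0..x} (\<lambda>t. exp (- 2 * \<i> * \<zeta> * of_real t) * g t)" if "x \<le> 1" for x
    unfolding right_diff_distrib
    by (intro Henstock_Kurzweil_Integration.integral_diff integrable_continuous_interval continuous_intros
        continuous_on_subset[OF assms(1)] continuous_on_subset[OF assms(2)]) (use that in auto)
  ultimately show ?thesis
    unfolding green_alt[OF assms(1,3)] green_alt[OF assms(2,3)]
    using assms(3) by (subst green_alt) (simp_all only: diff atLeastAtMost_iff order_refl, simp add: algebra_simps)
qed

lemma green_cmult: "green \<zeta> (\<lambda>t. c * f t) x = c * green \<zeta> f x"
  unfolding green_def by (simp add: mult.left_commute[of _ c] algebra_simps add_divide_distrib)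

text \<open>The modulus is monotone in \<open>s\<close>, increasing or decreasing according to the
  sign of \<open>Im \<zeta>\<close>, so its values at the ends 0 and 1 dominate in both half
  planes.\<close>

lemma norm_exp_le_max:
  assumes "0 \<le> s" "s \<le> 1"
  shows "cmod (exp (2 * \<i> * \<zeta> * of_real s)) \<le> max 1 (cmod (exp (2 * \<i> * \<zeta>)))"
proof (cases "Im \<zeta> \<ge> 0")
  case True
  then show ?thesis using assms by (simp add: le_max_iff_disj)
next
  case False
  then have "Im \<zeta> * 1 \<le> Im \<zeta> * s" using assms by (intro mult_left_mono_neg) auto
  then show ?thesis by (simp add: le_max_iff_disj)
qed

lemma norm_green_le:
  assumes f: "continuous_on {0..1} f" and M: "\<And>t. t \<in> {0..1} \<Longrightarrow> cmod (f t) \<le> M"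
    and C: "max 1 (cmod (exp (2 * \<i> * \<zeta>))) \<le> C * cmod (1 - exp (2 * \<i> * \<zeta>))" and x: "x \<in> {0..1}"
  shows "cmod (green \<zeta> f x) \<le> C * M"
proof -
  define Q where "Q = max 1 (cmod (exp (2 * \<i> * \<zeta>)))"
  have "Q \<ge> 1" by (simp add: Q_def)
  have "M \<ge> 0" by (rule order_trans[OF norm_ge_zero M[of 0]]) simp
  have nz: "cmod (1 - exp (2 * \<i> * \<zeta>)) > 0" using C by (auto simp: max_def split: if_splits)
  have "cmod (integral {0..x} (\<lambda>t. exp (2 * \<i> * \<zeta> * of_real (x - t)) * f t)) \<le> Q * M * (x - 0)"
    by (rule integral_bound)
      (use x M \<open>M \<ge> 0\<close> \<open>Q \<ge> 1\<close> in \<open>auto intro!: continuous_intros continuous_on_subset[OF f] mult_mono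
        norm_exp_le_max simp: norm_mult Q_def simp del: norm_exp_eq_Re of_real_diff\<close>)
  moreover have "cmod (integral {x..1} (\<lambda>t. exp (2 * \<i> * \<zeta> * of_real (1 + x - t)) * f t)) \<le> Q * M * (1 - x)"
    by (rule integral_bound)
      (use x M \<open>M \<ge> 0\<close> \<open>Q \<ge> 1\<close> in \<open>auto intro!: continuous_intros continuous_on_subset[OF f] mult_mono
        norm_exp_le_max simp: norm_mult Q_def simp del: norm_exp_eq_Re of_real_diff of_real_add\<close>)
  ultimately have "cmod (integral {0..x} (\<lambda>t. exp (2 * \<i> * \<zeta> * of_real (x - t)) * f t) +
      integral {x..1} (\<lambda>t. exp (2 * \<i> * \<zeta> * of_real (1 + x - t)) * f t)) \<le> Q * M"
    by (intro order_trans[OF norm_triangle_ineq]) (simp add: algebra_simps)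
  also have "\<dots> \<le> (C * cmod (1 - exp (2 * \<i> * \<zeta>))) * M"
    using C \<open>M \<ge> 0\<close> unfolding Q_def by (intro mult_right_mono) auto
  finally show ?thesis
    unfolding green_def norm_divide using nz by (simp add: field_simps)
qed

text \<open>\<open>v\<close> is an honest absolutely continuous function with integrable derivative
  \<open>w\<close>. One constant controls both the supremum of \<open>v\<close> and the integral of
  \<open>cmod w\<close>: the two quantities that a single integration by parts produces.\<close>

definition ac_bounded :: "real \<Rightarrow> (real \<Rightarrow> complex) \<Rightarrow> (real \<Rightarrow> complex) \<Rightarrow> bool" where
  "ac_bounded m v w \<longleftrightarrow> w absolutely_integrable_on {0..1} \<and>
     (\<forall>x y. 0 \<le> x \<longrightarrow> x \<le> y \<longrightarrow> y \<le> 1 \<longrightarrow> v y - v x = integral {x..y} w) \<and>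
     (\<forall>x\<in>{0..1}. cmod (v x) \<le> m) \<and> integral {0..1} (\<lambda>t. cmod (w t)) \<le> m"

lemma ac_bounded_continuous:
  assumes "ac_bounded m v w"
  shows "continuous_on {0..1} v"
proof -
  have eq: "v x = v 0 + integral {0..x} w" if "x \<in> {0..1}" for x
  proof -
    have "v x - v 0 = integral {0..x} w" using assms that unfolding ac_bounded_def by auto
    then show ?thesis by (simp add: algebra_simps)
  qed
  have "continuous_on {0..1} (\<lambda>x. v 0 + integral {0..x} w)"
    using assms unfolding ac_bounded_def absolutely_integrable_on_def
    by (intro continuous_intros indefinite_integral_continuous_1) auto
  then show ?thesis by (subst continuous_on_cong[OF refl eq])
qed

text \<open>One integration by parts against the exponential gains \<open>1 / cmod k\<close>; the
  two boundary values account for \<open>2 * m\<close>. The shift \<open>d\<close> lets the estimate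
  serve both pieces of the Green kernel, with \<open>d = x\<close> and
  \<open>d = 1 + x\<close>.\<close>

lemma norm_oscillatory_integral_le:
  assumes v: "ac_bounded m v w" and ab: "0 \<le> a" "a \<le> b" "b \<le> 1" and k: "k \<noteq> 0"
    and Q: "\<And>t. t \<in> {a..b} \<Longrightarrow> cmod (exp (k * of_real (d - t))) \<le> Q"
  shows "cmod (integral {a..b} (\<lambda>t. exp (k * of_real (d - t)) * v t)) \<le>
    Q / cmod k * (2 * m + integral {a..b} (\<lambda>t. cmod (w t)))"
proof -
  let ?\<phi> = "\<lambda>t. exp (k * of_real (d - t)) / (- k)"
  have der: "(?\<phi> has_vector_derivative exp (k * of_real (d - x))) (at x within {a..b})" for x
  proof -
    have "((\<lambda>t. exp (k * of_real d) / (- k) * exp (- k * of_real t)) has_vector_derivative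
      exp (k * of_real d) / (- k) * (- k * exp (- k * of_real x))) (at x within {a..b})"
      by (intro has_vector_derivative_mult_right has_vector_derivative_cexp_linear)
    then show ?thesis using k by (simp add: algebra_simps exp_diff exp_minus field_simps)
  qed
  have wi: "w absolutely_integrable_on {a..b}"
    using v ab unfolding ac_bounded_def
    by (auto intro: absolutely_integrable_on_subinterval)
  have w: "(\<lambda>t. cmod (w t)) integrable_on {a..b}"
    using wi unfolding absolutely_integrable_on_def by auto
  have cont: "continuous_on {a..b} ?\<phi>" using k by (intro continuous_intros) auto
  have "Q \<ge> 0" by (rule order_trans[OF norm_ge_zero Q[of a]]) (use ab in auto)
  have m: "cmod (v a) \<le> m" "cmod (v b) \<le> m"
    using v ab unfolding ac_bounded_def by auto
  have \<phi>: "cmod (?\<phi> t) \<le> Q / cmod k" if "t \<in> {a..b}" for t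
    unfolding norm_divide norm_minus_cancel using Q[OF that] by (intro divide_right_mono) auto
  have eq: "integral {a..b} (\<lambda>t. exp (k * of_real (d - t)) * v t) =
    ?\<phi> b * v b - ?\<phi> a * v a - integral {a..b} (\<lambda>t. ?\<phi> t * w t)"
    by (rule integration_by_parts_indefinite_integral[OF ab(2) der _ wi])
      (use v ab in \<open>auto intro!: continuous_intros simp: ac_bounded_def\<close>)
  have "cmod (integral {a..b} (\<lambda>t. ?\<phi> t * w t)) \<le> integral {a..b} (\<lambda>t. Q / cmod k * cmod (w t))"
  proof (rule Henstock_Kurzweil_Integration.integral_norm_bound_integral)
    show "(\<lambda>t. ?\<phi> t * w t) integrable_on {a..b}"
      using continuous_mult_absolutely_integrable[OF cont wi] unfolding absolutely_integrable_on_def by auto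
    show "(\<lambda>t. Q / cmod k * cmod (w t)) integrable_on {a..b}"
      by (intro integrable_on_mult_right w)
    show "cmod (?\<phi> t * w t) \<le> Q / cmod k * cmod (w t)" if "t \<in> {a..b}" for t
      unfolding norm_mult by (intro mult_right_mono \<phi> that) auto
  qed
  moreover have "cmod (?\<phi> b * v b) \<le> Q / cmod k * m" "cmod (?\<phi> a * v a) \<le> Q / cmod k * m"
    unfolding norm_mult using ab m \<open>Q \<ge> 0\<close>
    by (intro mult_mono \<phi>; simp)+
  ultimately have "cmod (integral {a..b} (\<lambda>t. exp (k * of_real (d - t)) * v t)) \<le>
     Q / cmod k * m + Q / cmod k * m + Q / cmod k * integral {a..b} (\<lambda>t. cmod (w t))"
    using norm_triangle_ineq4[of "?\<phi> b * v b - ?\<phi> a * v a" "integral {a..b} (\<lambda>t. ?\<phi> t * w t)"]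
      norm_triangle_ineq4[of "?\<phi> b * v b" "?\<phi> a * v a"]
    unfolding eq integral_mult_right by linarith
  then show ?thesis by (simp add: algebra_simps)
qed

text \<open>The factor 5 is 2 + 2 + 1: two boundary values on each of the two subintervals, and the
  integral of \<open>cmod w\<close>, which the subintervals share.\<close>

lemma norm_green_ac_bounded_le:
  assumes v: "ac_bounded m v w" and \<zeta>: "\<zeta> \<noteq> 0"
    and C: "max 1 (cmod (exp (2 * \<i> * \<zeta>))) \<le> C * cmod (1 - exp (2 * \<i> * \<zeta>))" and x: "x \<in> {0..1}"
  shows "cmod (green \<zeta> v x) \<le> 5 * C * m / (2 * cmod \<zeta>)"
proof -
  define Q where "Q = max 1 (cmod (exp (2 * \<i> * \<zeta>)))"
  have "Q \<ge> 1" by (simp add: Q_def)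
  have nz: "cmod (1 - exp (2 * \<i> * \<zeta>)) > 0" using C by (auto simp: max_def split: if_splits)
  have m: "0 \<le> m" "integral {0..1} (\<lambda>t. cmod (w t)) \<le> m" and
    w: "(\<lambda>t. cmod (w t)) integrable_on {0..1}"
    using v norm_ge_zero[of "v 0"] unfolding ac_bounded_def absolutely_integrable_on_def
    by (auto simp del: norm_ge_zero intro: order_trans)
  have "cmod (integral {0..x} (\<lambda>t. exp (2 * \<i> * \<zeta> * of_real (x - t)) * v t)) \<le>
      Q / cmod (2 * \<i> * \<zeta>) * (2 * m + integral {0..x} (\<lambda>t. cmod (w t)))"
    by (rule norm_oscillatory_integral_le[OF v])
      (use x \<zeta> in \<open>auto intro!: norm_exp_le_max simp: Q_def simp del: norm_exp_eq_Re of_real_diff\<close>)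
  moreover have "cmod (integral {x..1} (\<lambda>t. exp (2 * \<i> * \<zeta> * of_real (1 + x - t)) * v t)) \<le>
      Q / cmod (2 * \<i> * \<zeta>) * (2 * m + integral {x..1} (\<lambda>t. cmod (w t)))"
    by (rule norm_oscillatory_integral_le[OF v])
      (use x \<zeta> in \<open>auto intro!: norm_exp_le_max simp: Q_def simp del: norm_exp_eq_Re of_real_diff of_real_add\<close>)
  moreover have "integral {0..x} (\<lambda>t. cmod (w t)) + integral {x..1} (\<lambda>t. cmod (w t)) \<le> m"
    using Henstock_Kurzweil_Integration.integral_combine[of 0 x 1, OF _ _ w] x m by auto
  then have "Q / cmod (2 * \<i> * \<zeta>) * (2 * m + integral {0..x} (\<lambda>t. cmod (w t))) +
    Q / cmod (2 * \<i> * \<zeta>) * (2 * m + integral {x..1} (\<lambda>t. cmod (w t))) \<le> Q / cmod (2 * \<i> * \<zeta>) * (5 * m)"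
    using \<open>Q \<ge> 1\<close> unfolding distrib_left[symmetric] by (intro mult_left_mono) auto
  ultimately have "cmod (integral {0..x} (\<lambda>t. exp (2 * \<i> * \<zeta> * of_real (x - t)) * v t) +
      integral {x..1} (\<lambda>t. exp (2 * \<i> * \<zeta> * of_real (1 + x - t)) * v t)) \<le> Q / cmod (2 * \<i> * \<zeta>) * (5 * m)"
    by (intro order_trans[OF norm_triangle_ineq]) linarith
  also have "\<dots> \<le> (C * cmod (1 - exp (2 * \<i> * \<zeta>))) / cmod (2 * \<i> * \<zeta>) * (5 * m)"
    using C m unfolding Q_def by (intro mult_right_mono divide_right_mono) auto
  finally have "cmod (green \<zeta> v x) \<le>
      (C * cmod (1 - exp (2 * \<i> * \<zeta>))) / cmod (2 * \<i> * \<zeta>) * (5 * m) / cmod (1 - exp (2 * \<i> * \<zeta>))"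
    unfolding green_def norm_divide by (rule divide_right_mono) simp
  also have "\<dots> = 5 * C * m / (2 * cmod \<zeta>)"
  proof -
    have "(C * d) / k * (5 * m) / d = 5 * C * m / k" if "d > 0" for d k :: real
      using that by simp
    moreover have "cmod (2 * \<i> * \<zeta>) = 2 * cmod \<zeta>" by (simp add: norm_mult)
    ultimately show ?thesis using nz by (simp only:)
  qed
  finally show ?thesis .
qed

section \<open>The periodic Riccati equation\<close>

lemma norm_pairing_le:
  assumes "cmod v1 \<le> m" "cmod v2 \<le> m" "cmod a \<le> r" "cmod b \<le> r"
  shows "cmod (cnj v1 * a + cnj v2 * b) \<le> 2 * m * r"
proof -
  have "0 \<le> m" by (rule order_trans[OF norm_ge_zero assms(1)])
  then have "cmod (cnj v1 * a) \<le> m * r" "cmod (cnj v2 * b) \<le> m * r"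
    using assms by (auto simp: norm_mult intro!: mult_mono)
  then show ?thesis by (intro order_trans[OF norm_triangle_ineq]) simp
qed

text \<open>A periodic solution is a fixed point of \<open>green\<close> applied to the right-hand
  side without its linear term. The radius \<open>10 * C * m / cmod \<zeta>\<close> is four times
  the bound on the Green operator applied to a component of the potential, and the threshold on
  \<open>\<zeta>\<close> is equivalent to \<open>16 * C * m * \<rho> \<le> 1\<close>, which makes
  the quadratic term a small perturbation.\<close>

lemma periodic_riccati_solution:
  assumes v1: "ac_bounded m v1 w1" and v2: "ac_bounded m v2 w2" and m: "1 \<le> m"
    and C: "max 1 (cmod (exp (2 * \<i> * \<zeta>))) \<le> C * cmod (1 - exp (2 * \<i> * \<zeta>))" "1 \<le> C"
    and \<zeta>: "160 * C\<^sup>2 * m\<^sup>2 \<le> cmod \<zeta>"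
  obtains S1 S2 where
    "\<And>x. x \<in> {0..1} \<Longrightarrow> (S1 has_vector_derivative
      2 * \<i> * \<zeta> * S1 x - \<i> * v1 x - \<i> * S1 x * (cnj (v1 x) * S1 x + cnj (v2 x) * S2 x)) (at x within {0..1})"
    "\<And>x. x \<in> {0..1} \<Longrightarrow> (S2 has_vector_derivative
      2 * \<i> * \<zeta> * S2 x - \<i> * v2 x - \<i> * S2 x * (cnj (v1 x) * S1 x + cnj (v2 x) * S2 x)) (at x within {0..1})"
    "S1 1 = S1 0" "S2 1 = S2 0"
    "\<And>x. x \<in> {0..1} \<Longrightarrow> cmod (S1 x) \<le> 10 * C * m / cmod \<zeta>"
    "\<And>x. x \<in> {0..1} \<Longrightarrow> cmod (S2 x) \<le> 10 * C * m / cmod \<zeta>"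
proof -
  define \<rho> where "\<rho> = 10 * C * m / cmod \<zeta>"
  have Cm: "0 < C\<^sup>2 * m\<^sup>2" using C m by simp
  then have \<zeta>0: "0 < cmod \<zeta>" using \<zeta> by linarith
  have \<rho>: "0 \<le> \<rho>" "16 * C * m * \<rho> \<le> 1"
    using C m \<zeta> \<zeta>0 by (auto simp: \<rho>_def field_simps power2_eq_square)
  have nz: "exp (2 * \<i> * \<zeta>) \<noteq> 1" using C by auto
  have cv: "continuous_on {0..1} v1" "continuous_on {0..1} v2"
    using ac_bounded_continuous v1 v2 by auto
  have mv: "cmod (v1 x) \<le> m" "cmod (v2 x) \<le> m" if "x \<in> {0..1}" for x
    using v1 v2 that by (auto simp: ac_bounded_def)
  define p where "p f x = cnj (v1 x) * fst (f x) + cnj (v2 x) * snd (f x)" for f :: "real \<Rightarrow> complex \<times> complex" and x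
  define F where "F v s f x = - \<i> * v x - \<i> * s (f x) * p f x"
    for v and s :: "complex \<times> complex \<Rightarrow> complex" and f :: "real \<Rightarrow> complex \<times> complex" and x :: real
  define \<Phi> where "\<Phi> f x = (green \<zeta> (F v1 fst f) x, green \<zeta> (F v2 snd f) x)" for f x
  have cF: "continuous_on {0..1} (F v s f)"
    if "continuous_on {0..1} f" "continuous_on {0..1} v" "s = fst \<or> s = snd" for f v s
    using that(3) unfolding F_def p_def by (elim disjE) (auto intro!: continuous_intros that cv)
  have pb: "cmod (p f x) \<le> 2 * m * r" if "norm (f x) \<le> r" "x \<in> {0..1}" for f x r
    unfolding p_def using that mv norm_fst_le[of "fst (f x)" "snd (f x)"] norm_snd_le[of "snd (f x)" "fst (f x)"]
    by (intro norm_pairing_le) auto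
  have sb: "cmod (s y) \<le> norm y" if "s = fst \<or> s = snd" for s and y :: "complex \<times> complex"
    using that norm_fst_le[of "fst y" "snd y"] norm_snd_le[of "snd y" "fst y"] by auto
  \<comment> \<open>The potential contributes \<open>\<rho> / 4\<close> thanks to the gain of
    \<open>1 / \<zeta>\<close>, the quadratic term at most \<open>\<rho> / 8\<close> with no gain.
    Half the radius per component suffices because the norm of a pair is at most the sum of the
    norms.\<close>
  have bnd: "cmod (green \<zeta> (F v s f) x) \<le> \<rho> / 2"
    if f: "continuous_on {0..1} f" "\<forall>x\<in>{0..1}. norm (f x) \<le> \<rho>" and v: "ac_bounded m v w"
      and s: "s = fst \<or> s = snd" and x: "x \<in> {0..1}" for f v w s x
  proof -
    have cs: "continuous_on {0..1} (\<lambda>t. s (f t) * p f t)" "continuous_on {0..1} v"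
      using s f ac_bounded_continuous[OF v] unfolding p_def by (auto intro!: continuous_intros cv)
    have "F v s f = (\<lambda>t. - \<i> * (v t - (- (s (f t) * p f t))))" by (auto simp: F_def algebra_simps)
    then have "green \<zeta> (F v s f) x = - \<i> * (green \<zeta> v x - green \<zeta> (\<lambda>t. - (s (f t) * p f t)) x)"
      by (simp only: green_cmult) (subst green_diff, use cs x in \<open>auto intro!: continuous_intros\<close>)
    then have "cmod (green \<zeta> (F v s f) x) \<le> cmod (green \<zeta> v x) + cmod (green \<zeta> (\<lambda>t. - (s (f t) * p f t)) x)"
      by (simp add: norm_mult norm_triangle_ineq4)
    moreover have "cmod (green \<zeta> v x) \<le> 5 * C * m / (2 * cmod \<zeta>)"
      by (rule norm_green_ac_bounded_le[OF v _ C(1) x]) (use \<zeta>0 in auto)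
    moreover have "cmod (green \<zeta> (\<lambda>t. - (s (f t) * p f t)) x) \<le> C * (\<rho> * (2 * m * \<rho>))"
    proof (rule norm_green_le[OF _ _ C(1) x])
      show "cmod (- (s (f t) * p f t)) \<le> \<rho> * (2 * m * \<rho>)" if t: "t \<in> {0..1}" for t
      proof -
        have "norm (f t) \<le> \<rho>" using f t by auto
        then show ?thesis unfolding norm_minus_cancel norm_mult
          by (intro mult_mono pb[OF _ t] order_trans[OF sb[OF s]]) (use \<rho> in auto)
      qed
    qed (intro continuous_intros cs)
    moreover have "C * (\<rho> * (2 * m * \<rho>)) \<le> \<rho> / 8"
      using mult_right_mono[OF \<rho>(2) \<rho>(1)] by (simp add: algebra_simps)
    moreover have "5 * C * m / (2 * cmod \<zeta>) = \<rho> / 4" by (simp add: \<rho>_def)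
    ultimately show ?thesis using \<rho>(1) by linarith
  qed
  \<comment> \<open>The potential cancels in the difference, and the difference of the two products
    telescopes into two terms, each at most \<open>2 * m * \<rho> * e\<close>.\<close>
  have lip: "cmod (green \<zeta> (F v s f) x - green \<zeta> (F v s g) x) \<le> e / 4"
    if f: "continuous_on {0..1} f" "\<forall>x\<in>{0..1}. norm (f x) \<le> \<rho>"
      and g: "continuous_on {0..1} g" "\<forall>x\<in>{0..1}. norm (g x) \<le> \<rho>"
      and e: "\<forall>x\<in>{0..1}. norm (f x - g x) \<le> e" and v: "continuous_on {0..1} v"
      and s: "s = fst \<or> s = snd" and x: "x \<in> {0..1}" for f g e v s x
  proof -
    have "e \<ge> 0" using e x norm_ge_zero order_trans by blast
    have "green \<zeta> (F v s f) x - green \<zeta> (F v s g) x = green \<zeta> (\<lambda>t. F v s f t - F v s g t) x"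
      by (rule green_diff[symmetric]) (use cF f g v s x in auto)
    also have "cmod \<dots> \<le> C * (4 * m * \<rho> * e)"
    proof (rule norm_green_le[OF _ _ C(1) x])
      show "continuous_on {0..1} (\<lambda>t. F v s f t - F v s g t)"
        by (intro continuous_intros cF f g v s)
      fix t :: real assume t: "t \<in> {0..1}"
      have ft: "norm (f t) \<le> \<rho>" and gt: "norm (g t) \<le> \<rho>" and et: "norm (f t - g t) \<le> e"
        using f g e t by auto
      have se: "s (f t) - s (g t) = s (f t - g t)" "p f t - p g t = p (\<lambda>t. f t - g t) t"
        using s by (auto simp: p_def algebra_simps)
      have "F v s f t - F v s g t = - \<i> * (s (f t - g t) * p f t + s (g t) * p (\<lambda>t. f t - g t) t)"
        unfolding se[symmetric] F_def by (simp add: algebra_simps)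
      then have "cmod (F v s f t - F v s g t) = cmod (s (f t - g t) * p f t + s (g t) * p (\<lambda>t. f t - g t) t)"
        by (simp add: norm_mult)
      also have "\<dots> \<le> e * (2 * m * \<rho>) + \<rho> * (2 * m * e)"
        by (intro order_trans[OF norm_triangle_ineq] add_mono)
          (unfold norm_mult, auto intro!: mult_mono pb order_trans[OF sb[OF s]] simp: ft gt et \<rho> \<open>e \<ge> 0\<close> t[simplified])
      finally show "cmod (F v s f t - F v s g t) \<le> 4 * m * \<rho> * e" by (simp add: algebra_simps)
    qed
    also have "\<dots> \<le> e / 4"
      using mult_right_mono[OF \<rho>(2) \<open>e \<ge> 0\<close>] by (simp add: algebra_simps)
    finally show ?thesis .
  qed
  obtain f where f: "continuous_on {0..1} f" "\<And>x. x \<in> {0..1} \<Longrightarrow> norm (f x) \<le> \<rho>"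
    "\<And>x. x \<in> {0..1} \<Longrightarrow> \<Phi> f x = f x"
  proof (rule contraction_on_unit_interval[OF \<rho>(1), of \<Phi>])
    fix f :: "real \<Rightarrow> complex \<times> complex" assume f: "continuous_on {0..1} f" "\<forall>x\<in>{0..1}. norm (f x) \<le> \<rho>"
    show "continuous_on {0..1} (\<Phi> f)"
      unfolding \<Phi>_def by (intro continuous_intros continuous_on_green cF f cv nz) auto
    show "norm (\<Phi> f x) \<le> \<rho>" if x: "x \<in> {0..1}" for x
      using bnd[OF f v1 _ x, of fst] bnd[OF f v2 _ x, of snd]
        norm_Pair_le[of "green \<zeta> (F v1 fst f) x" "green \<zeta> (F v2 snd f) x"]
      unfolding \<Phi>_def by auto
    fix g :: "real \<Rightarrow> complex \<times> complex" and e assume g: "continuous_on {0..1} g" "\<forall>x\<in>{0..1}. norm (g x) \<le> \<rho>"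
      and e: "\<forall>x\<in>{0..1}. norm (f x - g x) \<le> e"
    show "norm (\<Phi> f x - \<Phi> g x) \<le> e / 2" if x: "x \<in> {0..1}" for x
      using lip[OF f g e cv(1) _ x, of fst] lip[OF f g e cv(2) _ x, of snd]
        norm_Pair_le[of "green \<zeta> (F v1 fst f) x - green \<zeta> (F v1 fst g) x"
          "green \<zeta> (F v2 snd f) x - green \<zeta> (F v2 snd g) x"]
      unfolding \<Phi>_def by auto
  qed (rule that)
  have eqs: "fst (f x) = green \<zeta> (F v1 fst f) x" "snd (f x) = green \<zeta> (F v2 snd f) x" if "x \<in> {0..1}" for x
    using arg_cong[OF f(3)[OF that], of fst] arg_cong[OF f(3)[OF that], of snd] by (auto simp: \<Phi>_def)
  have c: "continuous_on {0..1} (F v1 fst f)" "continuous_on {0..1} (F v2 snd f)"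
    using cF f cv by auto
  show thesis
  proof (rule that[of "\<lambda>x. fst (f x)" "\<lambda>x. snd (f x)"])
    fix x :: real assume x: "x \<in> {0..1}"
    have "((\<lambda>x. fst (f x)) has_vector_derivative 2 * \<i> * \<zeta> * green \<zeta> (F v1 fst f) x + F v1 fst f x) (at x within {0..1})"
      by (rule has_vector_derivative_transform[OF x eqs(1) green_has_vector_derivative[OF c(1) x nz]])
    then show "((\<lambda>x. fst (f x)) has_vector_derivative 2 * \<i> * \<zeta> * fst (f x) - \<i> * v1 x -
      \<i> * fst (f x) * (cnj (v1 x) * fst (f x) + cnj (v2 x) * snd (f x))) (at x within {0..1})"
      by (simp add: eqs(1)[OF x, symmetric] F_def p_def algebra_simps)
    have "((\<lambda>x. snd (f x)) has_vector_derivative 2 * \<i> * \<zeta> * green \<zeta> (F v2 snd f) x + F v2 snd f x) (at x within {0..1})"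
      by (rule has_vector_derivative_transform[OF x eqs(2) green_has_vector_derivative[OF c(2) x nz]])
    then show "((\<lambda>x. snd (f x)) has_vector_derivative 2 * \<i> * \<zeta> * snd (f x) - \<i> * v2 x -
      \<i> * snd (f x) * (cnj (v1 x) * fst (f x) + cnj (v2 x) * snd (f x))) (at x within {0..1})"
      by (simp add: eqs(2)[OF x, symmetric] F_def p_def algebra_simps)
    show "cmod (fst (f x)) \<le> 10 * C * m / cmod \<zeta>" "cmod (snd (f x)) \<le> 10 * C * m / cmod \<zeta>"
      using f(2)[OF x] norm_fst_le[of "fst (f x)" "snd (f x)"] norm_snd_le[of "snd (f x)" "fst (f x)"] by (auto simp: \<rho>_def)
  qed (use eqs[of 0] eqs[of 1] green_periodic c nz in auto)
qed

text \<open>The coefficients are so small that Picard iteration contracts on the whole interval at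
  once: an argument of norm at most \<open>r\<close> has an integral of size at most
  \<open>r / 8\<close>. Radius 2 leaves room for initial data of total size 1, in particular for the
  two unit vectors.\<close>

lemma small_linear_system_solution:
  assumes c: "continuous_on {0..1} v1" "continuous_on {0..1} v2" "continuous_on {0..1} S1" "continuous_on {0..1} S2"
    and m: "\<And>x. x \<in> {0..1} \<Longrightarrow> cmod (v1 x) \<le> m" "\<And>x. x \<in> {0..1} \<Longrightarrow> cmod (v2 x) \<le> m"
    and \<rho>: "\<And>x. x \<in> {0..1} \<Longrightarrow> cmod (S1 x) \<le> \<rho>" "\<And>x. x \<in> {0..1} \<Longrightarrow> cmod (S2 x) \<le> \<rho>"
    and small: "16 * m * \<rho> \<le> 1" and init: "cmod c1 + cmod c2 \<le> 1"
  obtains u1 u2 where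
    "\<And>x. x \<in> {0..1} \<Longrightarrow> (u1 has_vector_derivative - \<i> * S1 x * (cnj (v1 x) * u1 x + cnj (v2 x) * u2 x)) (at x within {0..1})"
    "\<And>x. x \<in> {0..1} \<Longrightarrow> (u2 has_vector_derivative - \<i> * S2 x * (cnj (v1 x) * u1 x + cnj (v2 x) * u2 x)) (at x within {0..1})"
    "u1 0 = c1" "u2 0 = c2"
    "\<And>x. x \<in> {0..1} \<Longrightarrow> cmod (u1 x) \<le> 2" "\<And>x. x \<in> {0..1} \<Longrightarrow> cmod (u2 x) \<le> 2"
proof -
  have \<rho>0: "0 \<le> \<rho>" and m0: "0 \<le> m"
    using order_trans[OF norm_ge_zero \<rho>(1)[of 0]] order_trans[OF norm_ge_zero m(1)[of 0]] by auto
  define p where "p f x = cnj (v1 x) * fst (f x) + cnj (v2 x) * snd (f x)" for f :: "real \<Rightarrow> complex \<times> complex" and x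
  define F where "F k S f x = k + integral {0..x} (\<lambda>t. - \<i> * S t * p f t)"
    for k and S :: "real \<Rightarrow> complex" and f :: "real \<Rightarrow> complex \<times> complex" and x :: real
  define \<Phi> where "\<Phi> f x = (F c1 S1 f x, F c2 S2 f x)" for f x
  have ci: "continuous_on {0..1} (\<lambda>t. - \<i> * S t * p f t)" if "continuous_on {0..1} f" "continuous_on {0..1} S" for f S
    using that unfolding p_def by (auto intro!: continuous_intros c)
  have pb: "cmod (p f x) \<le> 2 * m * r" if "norm (f x) \<le> r" "x \<in> {0..1}" for f x r
    unfolding p_def using that m norm_fst_le[of "fst (f x)" "snd (f x)"] norm_snd_le[of "snd (f x)" "fst (f x)"]
    by (intro norm_pairing_le) auto
  have ib: "cmod (integral {0..x} (\<lambda>t. - \<i> * S t * p f t)) \<le> r / 8"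
    if f: "continuous_on {0..1} f" "\<forall>x\<in>{0..1}. norm (f x) \<le> r" and S: "continuous_on {0..1} S" "\<And>x. x \<in> {0..1} \<Longrightarrow> cmod (S x) \<le> \<rho>"
      and x: "x \<in> {0..1}" for f S x r
  proof -
    have "0 \<le> norm (f x)" "norm (f x) \<le> r" using f x by auto
    then have "r \<ge> 0" by linarith
    have "cmod (integral {0..x} (\<lambda>t. - \<i> * S t * p f t)) \<le> \<rho> * (2 * m * r) * (x - 0)"
    proof (rule integral_bound)
      show "continuous_on {0..x} (\<lambda>t. - \<i> * S t * p f t)"
        by (rule continuous_on_subset[OF ci[OF f(1) S(1)]]) (use x in auto)
      fix t assume "t \<in> {0..x}"
      then have t: "t \<in> {0..1}" using x by auto
      have "norm (f t) \<le> r" using f t by auto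
      then show "cmod (- \<i> * S t * p f t) \<le> \<rho> * (2 * m * r)"
        using S(2)[OF t] \<rho>0 pb[of f t, OF _ t] by (auto simp: norm_mult intro!: mult_mono)
    qed (use x in auto)
    also have "\<dots> \<le> \<rho> * (2 * m * r) * 1"
      using x \<rho>0 m0 \<open>r \<ge> 0\<close> by (intro mult_left_mono) auto
    also have "\<dots> \<le> r / 8"
      using mult_right_mono[OF small \<open>r \<ge> 0\<close>] by (simp add: algebra_simps)
    finally show ?thesis .
  qed
  have Fd: "F k S f x - F k S g x = integral {0..x} (\<lambda>t. - \<i> * S t * p (\<lambda>t. f t - g t) t)"
    if "continuous_on {0..1} f" "continuous_on {0..1} g" "continuous_on {0..1} S" "x \<in> {0..1}" for k S f g x
  proof -
    have "integral {0..x} (\<lambda>t. (- \<i> * S t * p f t) - (- \<i> * S t * p g t)) =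
      integral {0..x} (\<lambda>t. - \<i> * S t * p f t) - integral {0..x} (\<lambda>t. - \<i> * S t * p g t)"
      by (intro Henstock_Kurzweil_Integration.integral_diff integrable_continuous_interval
          continuous_on_subset[OF ci] that) (use that in auto)
    moreover have "(\<lambda>t. (- \<i> * S t * p f t) - (- \<i> * S t * p g t)) = (\<lambda>t. - \<i> * S t * p (\<lambda>t. f t - g t) t)"
      by (auto simp: p_def algebra_simps)
    ultimately show ?thesis by (simp add: F_def)
  qed
  obtain f where f: "continuous_on {0..1} f" "\<And>x. x \<in> {0..1} \<Longrightarrow> norm (f x) \<le> 2"
    "\<And>x. x \<in> {0..1} \<Longrightarrow> \<Phi> f x = f x"
  proof (rule contraction_on_unit_interval[where \<Phi> = \<Phi> and \<rho> = 2, OF zero_le_numeral])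
    fix f :: "real \<Rightarrow> complex \<times> complex" assume f: "continuous_on {0..1} f" "\<forall>x\<in>{0..1}. norm (f x) \<le> 2"
    show "continuous_on {0..1} (\<Phi> f)"
      unfolding \<Phi>_def F_def
      by (intro continuous_intros indefinite_integral_continuous_1 integrable_continuous_interval ci f c)
    show "norm (\<Phi> f x) \<le> 2" if x: "x \<in> {0..1}" for x
    proof -
      have "norm (\<Phi> f x) \<le> cmod (F c1 S1 f x) + cmod (F c2 S2 f x)"
        unfolding \<Phi>_def by (rule norm_Pair_le)
      also have "\<dots> \<le> (cmod c1 + 2/8) + (cmod c2 + 2/8)"
        unfolding F_def
        by (intro add_mono order_trans[OF norm_triangle_ineq] ib f c \<rho> x order_refl)
      finally show ?thesis using init by simp
    qed
    fix g :: "real \<Rightarrow> complex \<times> complex" and e assume g: "continuous_on {0..1} g" "\<forall>x\<in>{0..1}. norm (g x) \<le> 2"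
      and e: "\<forall>x\<in>{0..1}. norm (f x - g x) \<le> e"
    show "norm (\<Phi> f x - \<Phi> g x) \<le> e / 2" if x: "x \<in> {0..1}" for x
    proof -
      have "norm (\<Phi> f x - \<Phi> g x) \<le> cmod (F c1 S1 f x - F c1 S1 g x) + cmod (F c2 S2 f x - F c2 S2 g x)"
        unfolding \<Phi>_def using norm_Pair_le by simp
      also have "\<dots> \<le> e / 8 + e / 8"
        unfolding Fd[OF f(1) g(1) c(3) x] Fd[OF f(1) g(1) c(4) x]
        by (intro add_mono ib continuous_intros f g c \<rho> x e)
      also have "\<dots> \<le> e / 2"
        using order_trans[OF norm_ge_zero bspec[OF e x]] by simp
      finally show ?thesis .
    qed
  qed (rule that)
  have eqs: "fst (f x) = F c1 S1 f x" "snd (f x) = F c2 S2 f x" if "x \<in> {0..1}" for x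
    using arg_cong[OF f(3)[OF that], of fst] arg_cong[OF f(3)[OF that], of snd] by (auto simp: \<Phi>_def)
  have der: "(F k S f has_vector_derivative - \<i> * S x * p f x) (at x within {0..1})"
    if "continuous_on {0..1} S" "x \<in> {0..1}" for k S x
    unfolding F_def
    using has_vector_derivative_add[OF has_vector_derivative_const integral_has_vector_derivative[OF ci[OF f(1) that(1)] that(2)], of k]
    by simp
  show thesis
  proof (rule that[of "\<lambda>x. fst (f x)" "\<lambda>x. snd (f x)"])
    fix x :: real assume x: "x \<in> {0..1}"
    show "((\<lambda>x. fst (f x)) has_vector_derivative - \<i> * S1 x * (cnj (v1 x) * fst (f x) + cnj (v2 x) * snd (f x))) (at x within {0..1})"
      using has_vector_derivative_transform[OF x eqs(1) der[OF c(3) x]] by (simp add: p_def)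
    show "((\<lambda>x. snd (f x)) has_vector_derivative - \<i> * S2 x * (cnj (v1 x) * fst (f x) + cnj (v2 x) * snd (f x))) (at x within {0..1})"
      using has_vector_derivative_transform[OF x eqs(2) der[OF c(4) x]] by (simp add: p_def)
    show "cmod (fst (f x)) \<le> 2" "cmod (snd (f x)) \<le> 2"
      using f(2)[OF x] norm_fst_le[of "fst (f x)" "snd (f x)"] norm_snd_le[of "snd (f x)" "fst (f x)"] by auto
  qed (use eqs[of 0] in \<open>auto simp: F_def\<close>)
qed

section \<open>Block triangular form\<close>

lemma ac_bounded_cnj:
  assumes "ac_bounded m v w"
  shows "ac_bounded m (\<lambda>x. cnj (v x)) (\<lambda>x. cnj (w x))"
proof -
  have w: "w absolutely_integrable_on {0..1}" using assms by (simp add: ac_bounded_def)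
  have "(cnj \<circ> w) absolutely_integrable_on {0..1}"
    by (rule absolutely_integrable_linear[OF w bounded_linear_cnj])
  moreover have "cnj (v y) - cnj (v x) = integral {x..y} (\<lambda>t. cnj (w t))"
    if "0 \<le> x" "x \<le> y" "y \<le> 1" for x y
    using assms that by (simp add: ac_bounded_def integral_cnj flip: complex_cnj_diff)
  ultimately show ?thesis using assms by (simp add: ac_bounded_def o_def)
qed

text \<open>The Riccati equation is integrated against \<open>cnj v'\<close>, where
  \<open>v'\<close> is a second function with derivative \<open>w'\<close>, not the derivative of
  \<open>v\<close>. Moving the derivative off \<open>S\<close> leaves two boundary terms and one
  integral, each at most \<open>m * \<rho>\<close>; the quadratic term adds
  \<open>2 * m * \<rho>\<close>. Estimating the derivative of \<open>S\<close> through the equation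
  would only give O(1).\<close>

lemma riccati_mean_asymptotics:
  assumes v: "ac_bounded m v w" and v': "ac_bounded m v' w'" and cp: "continuous_on {0..1} p"
    and S: "\<And>x. x \<in> {0..1} \<Longrightarrow> (S has_vector_derivative
      2 * \<i> * \<zeta> * S x - \<i> * v x - \<i> * S x * p x) (at x within {0..1})"
    and \<rho>: "\<And>x. x \<in> {0..1} \<Longrightarrow> cmod (S x) \<le> \<rho>" "\<And>x. x \<in> {0..1} \<Longrightarrow> cmod (p x) \<le> 2 * m * \<rho>"
    and small: "m * \<rho> \<le> 1"
  shows "cmod (2 * \<zeta> * integral {0..1} (\<lambda>x. S x * cnj (v' x)) - integral {0..1} (\<lambda>x. v x * cnj (v' x))) \<le> 5 * m * \<rho>"
proof -
  define S' where "S' x = 2 * \<i> * \<zeta> * S x - \<i> * v x - \<i> * S x * p x" for x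
  have \<rho>0: "0 \<le> \<rho>" and m0: "0 \<le> m"
    using order_trans[OF norm_ge_zero \<rho>(1)[of 0]] v' norm_ge_zero[of "v' 0"]
    by (auto simp: ac_bounded_def simp del: norm_ge_zero intro: order_trans)
  have cS: "continuous_on {0..1} S"
    by (rule continuous_on_vector_derivative) (use S in auto)
  note cv = ac_bounded_continuous[OF v] ac_bounded_continuous[OF ac_bounded_cnj[OF v']]
  have v'm: "cmod (v' x) \<le> m" if "x \<in> {0..1}" for x
    using v' that by (auto simp: ac_bounded_def)
  have cS': "continuous_on {0..1} S'" unfolding S'_def by (intro continuous_intros cS cv cp)
  have w': "(\<lambda>x. cnj (w' x)) absolutely_integrable_on {0..1}" "(\<lambda>x. cmod (w' x)) integrable_on {0..1}"
    "integral {0..1} (\<lambda>x. cmod (w' x)) \<le> m"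
    using ac_bounded_cnj[OF v'] by (auto simp: ac_bounded_def absolutely_integrable_on_def)
  have parts: "integral {0..1} (\<lambda>x. S' x * cnj (v' x)) =
    S 1 * cnj (v' 1) - S 0 * cnj (v' 0) - integral {0..1} (\<lambda>x. S x * cnj (w' x))"
    by (rule integration_by_parts_indefinite_integral)
      (use S cS' ac_bounded_cnj[OF v'] in \<open>auto simp: S'_def ac_bounded_def\<close>)
  have "cmod (integral {0..1} (\<lambda>x. S x * cnj (w' x))) \<le> integral {0..1} (\<lambda>x. \<rho> * cmod (w' x))"
  proof (rule Henstock_Kurzweil_Integration.integral_norm_bound_integral)
    show "(\<lambda>x. S x * cnj (w' x)) integrable_on {0..1}"
      using continuous_mult_absolutely_integrable[OF cS w'(1)] by (simp add: absolutely_integrable_on_def)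
    show "(\<lambda>x. \<rho> * cmod (w' x)) integrable_on {0..1}" by (intro integrable_on_mult_right w')
  qed (use \<rho>(1) in \<open>auto simp: norm_mult intro!: mult_right_mono\<close>)
  also have "\<dots> \<le> \<rho> * m" using w' \<rho>0 by (simp add: mult_left_mono)
  finally have 1: "cmod (integral {0..1} (\<lambda>x. S x * cnj (w' x))) \<le> \<rho> * m" .
  have 2: "cmod (S 1 * cnj (v' 1)) \<le> \<rho> * m" "cmod (S 0 * cnj (v' 0)) \<le> \<rho> * m"
    using \<rho>(1)[of 1] \<rho>(1)[of 0] v'm[of 1] v'm[of 0] \<rho>0 m0 by (auto simp: norm_mult intro!: mult_mono)
  have 3: "cmod (integral {0..1} (\<lambda>x. S x * p x * cnj (v' x))) \<le> 2 * m * \<rho>"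
  proof -
    have "cmod (integral {0..1} (\<lambda>x. S x * p x * cnj (v' x))) \<le> \<rho> * (2 * m * \<rho>) * m * (1 - 0)"
      by (rule integral_bound)
        (use \<rho>0 m0 \<rho> v'm in \<open>auto intro!: continuous_intros cS cp cv mult_mono simp: norm_mult\<close>)
    also have "\<dots> = 2 * m * \<rho> * (m * \<rho>)" by simp
    also have "\<dots> \<le> 2 * m * \<rho> * 1" using \<rho>0 m0 small by (intro mult_left_mono) auto
    finally show ?thesis by simp
  qed
  have "integral {0..1} (\<lambda>x. S' x * cnj (v' x)) =
    integral {0..1} (\<lambda>x. 2 * \<i> * \<zeta> * (S x * cnj (v' x)) - \<i> * (v x * cnj (v' x)) - \<i> * (S x * p x * cnj (v' x)))"
    by (simp add: S'_def algebra_simps)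
  also have "\<dots> = integral {0..1} (\<lambda>x. 2 * \<i> * \<zeta> * (S x * cnj (v' x))) - integral {0..1} (\<lambda>x. \<i> * (v x * cnj (v' x))) -
     integral {0..1} (\<lambda>x. \<i> * (S x * p x * cnj (v' x)))"
    by (subst Henstock_Kurzweil_Integration.integral_diff
        | intro integrable_continuous_interval continuous_intros cS cv cp | simp)+
  finally have "integral {0..1} (\<lambda>x. S' x * cnj (v' x)) = 2 * \<i> * \<zeta> * integral {0..1} (\<lambda>x. S x * cnj (v' x)) -
      \<i> * integral {0..1} (\<lambda>x. v x * cnj (v' x)) - \<i> * integral {0..1} (\<lambda>x. S x * p x * cnj (v' x))"
    unfolding integral_mult_right .
  then have "2 * \<zeta> * integral {0..1} (\<lambda>x. S x * cnj (v' x)) - integral {0..1} (\<lambda>x. v x * cnj (v' x)) =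
     - \<i> * integral {0..1} (\<lambda>x. S' x * cnj (v' x)) + integral {0..1} (\<lambda>x. S x * p x * cnj (v' x))"
    by (simp only:) (simp add: algebra_simps)
  then have "cmod (2 * \<zeta> * integral {0..1} (\<lambda>x. S x * cnj (v' x)) - integral {0..1} (\<lambda>x. v x * cnj (v' x))) \<le>
    cmod (integral {0..1} (\<lambda>x. S' x * cnj (v' x))) + cmod (integral {0..1} (\<lambda>x. S x * p x * cnj (v' x)))"
    using norm_triangle_ineq[of "- \<i> * integral {0..1} (\<lambda>x. S' x * cnj (v' x))" "integral {0..1} (\<lambda>x. S x * p x * cnj (v' x))"]
    by (simp only: norm_mult norm_minus_cancel norm_ii mult_1)
  also have "cmod (integral {0..1} (\<lambda>x. S' x * cnj (v' x))) \<le> 3 * (\<rho> * m)"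
    unfolding parts using 1 2
      norm_triangle_ineq4[of "S 1 * cnj (v' 1) - S 0 * cnj (v' 0)" "integral {0..1} (\<lambda>x. S x * cnj (w' x))"]
      norm_triangle_ineq4[of "S 1 * cnj (v' 1)" "S 0 * cnj (v' 0)"] by linarith
  finally show ?thesis using 3 by (simp add: algebra_simps)
qed

text \<open>Two rounds of the integral equation: the bound 2 on the solution shows that it moves by
  at most \<open>4 * m * \<rho>\<close>, and inserting this into the equation with the initial
  values frozen leaves an error \<open>\<rho> * (2 * m * (4 * m * \<rho>))\<close>.\<close>

lemma linear_system_first_order:
  assumes c: "continuous_on {0..1} v1" "continuous_on {0..1} v2" "continuous_on {0..1} S1" "continuous_on {0..1} S2"
    and m: "\<And>x. x \<in> {0..1} \<Longrightarrow> cmod (v1 x) \<le> m" "\<And>x. x \<in> {0..1} \<Longrightarrow> cmod (v2 x) \<le> m"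
    and \<rho>: "\<And>x. x \<in> {0..1} \<Longrightarrow> cmod (S1 x) \<le> \<rho>" "\<And>x. x \<in> {0..1} \<Longrightarrow> cmod (S2 x) \<le> \<rho>"
    and u1: "\<And>x. x \<in> {0..1} \<Longrightarrow> (u1 has_vector_derivative - \<i> * S1 x * (cnj (v1 x) * u1 x + cnj (v2 x) * u2 x)) (at x within {0..1})"
    and u2: "\<And>x. x \<in> {0..1} \<Longrightarrow> (u2 has_vector_derivative - \<i> * S2 x * (cnj (v1 x) * u1 x + cnj (v2 x) * u2 x)) (at x within {0..1})"
    and ub: "\<And>x. x \<in> {0..1} \<Longrightarrow> cmod (u1 x) \<le> 2" "\<And>x. x \<in> {0..1} \<Longrightarrow> cmod (u2 x) \<le> 2"
  shows "cmod (u1 1 - u1 0 + \<i> * integral {0..1} (\<lambda>x. S1 x * (cnj (v1 x) * u1 0 + cnj (v2 x) * u2 0))) \<le> 8 * m\<^sup>2 * \<rho>\<^sup>2"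
    and "cmod (u2 1 - u2 0 + \<i> * integral {0..1} (\<lambda>x. S2 x * (cnj (v1 x) * u1 0 + cnj (v2 x) * u2 0))) \<le> 8 * m\<^sup>2 * \<rho>\<^sup>2"
proof -
  have \<rho>0: "0 \<le> \<rho>" and m0: "0 \<le> m"
    using order_trans[OF norm_ge_zero \<rho>(1)[of 0]] order_trans[OF norm_ge_zero m(1)[of 0]] by auto
  have cu: "continuous_on {0..1} u1" "continuous_on {0..1} u2"
    by (rule continuous_on_vector_derivative[OF u1] continuous_on_vector_derivative[OF u2]; assumption)+
  define q where "q a b x = cnj (v1 x) * a x + cnj (v2 x) * b x" for a b x
  have cq: "continuous_on {0..1} (q a b)" if "continuous_on {0..1} a" "continuous_on {0..1} b" for a b
    unfolding q_def by (intro continuous_intros that c)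
  have int: "u x - u 0 = - \<i> * integral {0..x} (\<lambda>t. S t * q u1 u2 t)"
    if "\<And>x. x \<in> {0..1} \<Longrightarrow> (u has_vector_derivative - \<i> * S x * (cnj (v1 x) * u1 x + cnj (v2 x) * u2 x)) (at x within {0..1})"
      and "x \<in> {0..1}" for u S x
  proof -
    have "((\<lambda>t. - \<i> * S t * q u1 u2 t) has_integral u x - u 0) {0..x}"
      unfolding q_def
      by (intro fundamental_theorem_of_calculus has_vector_derivative_within_subset[OF that(1)])
        (use that(2) in auto)
    from integral_unique[OF this] have "integral {0..x} (\<lambda>t. - \<i> * (S t * q u1 u2 t)) = u x - u 0"
      by (simp only: mult.assoc)
    then show ?thesis unfolding integral_mult_right ..
  qed
  have bnd: "cmod (- \<i> * integral {0..x} (\<lambda>t. S t * q a b t)) \<le> \<rho> * (2 * m * r)"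
    if "continuous_on {0..1} S" "\<And>x. x \<in> {0..1} \<Longrightarrow> cmod (S x) \<le> \<rho>"
      and ab: "continuous_on {0..1} a" "continuous_on {0..1} b"
      and r: "\<And>x. x \<in> {0..1} \<Longrightarrow> cmod (a x) \<le> r" "\<And>x. x \<in> {0..1} \<Longrightarrow> cmod (b x) \<le> r"
      and x: "x \<in> {0..1}" for S a b r x
  proof -
    have r0: "0 \<le> r" by (rule order_trans[OF norm_ge_zero r(1)[of 0]]) simp
    have "cmod (integral {0..x} (\<lambda>t. S t * q a b t)) \<le> \<rho> * (2 * m * r) * (x - 0)"
    proof (rule integral_bound)
      show "continuous_on {0..x} (\<lambda>t. S t * q a b t)"
        by (intro continuous_intros continuous_on_subset[OF that(1)] continuous_on_subset[OF cq[OF ab]]) (use x in auto)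
      fix t assume "t \<in> {0..x}"
      then have t: "t \<in> {0..1}" using x by auto
      show "cmod (S t * q a b t) \<le> \<rho> * (2 * m * r)"
        unfolding norm_mult q_def using m0 \<rho>0 r0
        by (intro mult_mono that(2) norm_pairing_le m r t) auto
    qed (use x in auto)
    also have "\<dots> \<le> \<rho> * (2 * m * r) * 1" using x \<rho>0 m0 r0 by (intro mult_left_mono) auto
    finally show ?thesis by (simp add: norm_mult)
  qed
  have d1: "cmod (u1 x - u1 0) \<le> 4 * m * \<rho>" if "x \<in> {0..1}" for x
  proof -
    have eq: "u1 x - u1 0 = - \<i> * integral {0..x} (\<lambda>t. S1 t * q u1 u2 t)"
      by (rule int[OF u1 that])
    have "cmod (u1 x - u1 0) \<le> \<rho> * (2 * m * 2)"
      unfolding eq by (rule bnd[OF c(3) \<rho>(1) cu ub that])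
    then show ?thesis by (simp add: mult_ac)
  qed
  have d2: "cmod (u2 x - u2 0) \<le> 4 * m * \<rho>" if "x \<in> {0..1}" for x
  proof -
    have eq: "u2 x - u2 0 = - \<i> * integral {0..x} (\<lambda>t. S2 t * q u1 u2 t)"
      by (rule int[OF u2 that])
    have "cmod (u2 x - u2 0) \<le> \<rho> * (2 * m * 2)"
      unfolding eq by (rule bnd[OF c(4) \<rho>(2) cu ub that])
    then show ?thesis by (simp add: mult_ac)
  qed
  have main: "cmod (u 1 - u 0 + \<i> * integral {0..1} (\<lambda>x. S x * (cnj (v1 x) * u1 0 + cnj (v2 x) * u2 0))) \<le> 8 * m\<^sup>2 * \<rho>\<^sup>2"
    if S: "continuous_on {0..1} S" "\<And>x. x \<in> {0..1} \<Longrightarrow> cmod (S x) \<le> \<rho>"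
      and u: "\<And>x. x \<in> {0..1} \<Longrightarrow> (u has_vector_derivative - \<i> * S x * (cnj (v1 x) * u1 x + cnj (v2 x) * u2 x)) (at x within {0..1})"
    for u S
  proof -
    have "integral {0..1} (\<lambda>t. S t * q u1 u2 t) - integral {0..1} (\<lambda>t. S t * q (\<lambda>_. u1 0) (\<lambda>_. u2 0) t) =
      integral {0..1} (\<lambda>t. S t * q u1 u2 t - S t * q (\<lambda>_. u1 0) (\<lambda>_. u2 0) t)"
      by (rule Henstock_Kurzweil_Integration.integral_diff[symmetric])
        (intro integrable_continuous_interval continuous_intros S cq cu)+
    also have "(\<lambda>t. S t * q u1 u2 t - S t * q (\<lambda>_. u1 0) (\<lambda>_. u2 0) t) = (\<lambda>t. S t * q (\<lambda>t. u1 t - u1 0) (\<lambda>t. u2 t - u2 0) t)"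
      by (auto simp: q_def algebra_simps)
    finally have "u 1 - u 0 + \<i> * integral {0..1} (\<lambda>x. S x * (cnj (v1 x) * u1 0 + cnj (v2 x) * u2 0)) =
      - \<i> * integral {0..1} (\<lambda>t. S t * q (\<lambda>t. u1 t - u1 0) (\<lambda>t. u2 t - u2 0) t)"
      using int[OF u, of 1] by (simp add: q_def[of "\<lambda>_. u1 0"] algebra_simps)
    also have "cmod \<dots> \<le> \<rho> * (2 * m * (4 * m * \<rho>))"
      by (rule bnd[OF S]) (auto intro!: continuous_intros cu d1 d2)
    finally show ?thesis by (simp add: power2_eq_square mult_ac)
  qed
  show "cmod (u1 1 - u1 0 + \<i> * integral {0..1} (\<lambda>x. S1 x * (cnj (v1 x) * u1 0 + cnj (v2 x) * u2 0))) \<le> 8 * m\<^sup>2 * \<rho>\<^sup>2"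
    by (rule main[OF c(3) \<rho>(1) u1])
  show "cmod (u2 1 - u2 0 + \<i> * integral {0..1} (\<lambda>x. S2 x * (cnj (v1 x) * u1 0 + cnj (v2 x) * u2 0))) \<le> 8 * m\<^sup>2 * \<rho>\<^sup>2"
    by (rule main[OF c(4) \<rho>(2) u2])
qed

text \<open>One column of the matrix equation, solved for the derivative. Derivatives are required
  at every point of the interval, which is reasonable because the coefficients will be the
  continuous representatives of the potential.\<close>

definition solves_system :: "(real \<Rightarrow> complex) \<Rightarrow> (real \<Rightarrow> complex) \<Rightarrow> complex \<Rightarrow>
    (real \<Rightarrow> complex) \<Rightarrow> (real \<Rightarrow> complex) \<Rightarrow> (real \<Rightarrow> complex) \<Rightarrow> bool" where
  "solves_system v1 v2 \<zeta> y1 y2 y3 \<longleftrightarrow> (\<forall>x\<in>{0..1}.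
     (y1 has_vector_derivative - \<i> * \<zeta> * y1 x + \<i> * (cnj (v1 x) * y2 x + cnj (v2 x) * y3 x)) (at x within {0..1}) \<and>
     (y2 has_vector_derivative \<i> * \<zeta> * y2 x - \<i> * v1 x * y1 x) (at x within {0..1}) \<and>
     (y3 has_vector_derivative \<i> * \<zeta> * y3 x - \<i> * v2 x * y1 x) (at x within {0..1}))"

text \<open>Substituting \<open>(y\<^sub>2, y\<^sub>3) = S y\<^sub>1 + z\<close> with a solution \<open>S\<close> of the Riccati equation makes the
  system block triangular: \<open>z\<close> solves a system of its own, and \<open>y\<^sub>1\<close> a scalar equation driven by \<open>z\<close>.\<close>

lemma block_triangular_solution:
  assumes c: "continuous_on {0..1} v1" "continuous_on {0..1} v2"
    and S1: "\<And>x. x \<in> {0..1} \<Longrightarrow> (S1 has_vector_derivative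
      2 * \<i> * \<zeta> * S1 x - \<i> * v1 x - \<i> * S1 x * (cnj (v1 x) * S1 x + cnj (v2 x) * S2 x)) (at x within {0..1})"
    and S2: "\<And>x. x \<in> {0..1} \<Longrightarrow> (S2 has_vector_derivative
      2 * \<i> * \<zeta> * S2 x - \<i> * v2 x - \<i> * S2 x * (cnj (v1 x) * S1 x + cnj (v2 x) * S2 x)) (at x within {0..1})"
    and per: "S1 1 = S1 0" "S2 1 = S2 0"
    and u11: "\<And>x. x \<in> {0..1} \<Longrightarrow> (u11 has_vector_derivative - \<i> * S1 x * (cnj (v1 x) * u11 x + cnj (v2 x) * u21 x)) (at x within {0..1})"
    and u21: "\<And>x. x \<in> {0..1} \<Longrightarrow> (u21 has_vector_derivative - \<i> * S2 x * (cnj (v1 x) * u11 x + cnj (v2 x) * u21 x)) (at x within {0..1})"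
    and u12: "\<And>x. x \<in> {0..1} \<Longrightarrow> (u12 has_vector_derivative - \<i> * S1 x * (cnj (v1 x) * u12 x + cnj (v2 x) * u22 x)) (at x within {0..1})"
    and u22: "\<And>x. x \<in> {0..1} \<Longrightarrow> (u22 has_vector_derivative - \<i> * S2 x * (cnj (v1 x) * u12 x + cnj (v2 x) * u22 x)) (at x within {0..1})"
    and init: "u11 0 = 1" "u21 0 = 0" "u12 0 = 0" "u22 0 = 1"
  defines "\<tau> \<equiv> exp (- \<i> * \<zeta> + \<i> * integral {0..1} (\<lambda>x. cnj (v1 x) * S1 x + cnj (v2 x) * S2 x))"
  obtains \<kappa>1 \<kappa>2 where
    "\<And>a b1 b2. \<exists>y1 y2 y3. solves_system v1 v2 \<zeta> y1 y2 y3 \<and> y1 0 = a \<and> y2 0 = b1 \<and> y3 0 = b2 \<and>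
       y1 1 = \<tau> * a + \<kappa>1 * (b1 - S1 0 * a) + \<kappa>2 * (b2 - S2 0 * a) \<and>
       y2 1 = S1 0 * y1 1 + exp (\<i> * \<zeta>) * ((b1 - S1 0 * a) * u11 1 + (b2 - S2 0 * a) * u12 1) \<and>
       y3 1 = S2 0 * y1 1 + exp (\<i> * \<zeta>) * ((b1 - S1 0 * a) * u21 1 + (b2 - S2 0 * a) * u22 1)"
proof -
  have cS: "continuous_on {0..1} S1" "continuous_on {0..1} S2"
    and cu: "continuous_on {0..1} u11" "continuous_on {0..1} u21" "continuous_on {0..1} u12" "continuous_on {0..1} u22"
    by (rule continuous_on_vector_derivative[OF S1] continuous_on_vector_derivative[OF S2]
        continuous_on_vector_derivative[OF u11] continuous_on_vector_derivative[OF u21]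
        continuous_on_vector_derivative[OF u12] continuous_on_vector_derivative[OF u22]; assumption)+
  define p where "p x = cnj (v1 x) * S1 x + cnj (v2 x) * S2 x" for x
  \<comment> \<open>The solution of the scalar equation that remains for the first component when
    \<open>z = 0\<close>; its value at 1 is the multiplier \<open>\<tau>\<close>.\<close>
  define d where "d x = exp (- \<i> * \<zeta> * of_real x + \<i> * integral {0..x} p)" for x
  have cp: "continuous_on {0..1} p" unfolding p_def by (intro continuous_intros c cS)
  have lin: "((\<lambda>x. k * complex_of_real x) has_vector_derivative k) (at x within S)" for k x S
    using has_vector_derivative_mult_right[OF has_vector_derivative_of_real[OF DERIV_ident]] by simp
  have d: "(d has_vector_derivative (- \<i> * \<zeta> + \<i> * p x) * d x) (at x within {0..1})" if "x \<in> {0..1}" for x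
    unfolding d_def
    by (intro has_vector_derivative_cexp has_vector_derivative_add has_vector_derivative_mult_right
        integral_has_vector_derivative cp that lin)
  have cd: "continuous_on {0..1} d"
    by (rule continuous_on_vector_derivative) (use d in auto)
  have dnz: "d x \<noteq> 0" for x by (simp add: d_def)
  \<comment> \<open>The integrand of variation of constants: the forcing of the first component by
    \<open>z\<close>, divided by the homogeneous solution \<open>d\<close>.\<close>
  define f where "f a b x = \<i> * (cnj (v1 x) * a x + cnj (v2 x) * b x) * exp (\<i> * \<zeta> * of_real x) / d x" for a b x
  have cf: "continuous_on {0..1} (f a b)" if "continuous_on {0..1} a" "continuous_on {0..1} b" for a b
    unfolding f_def using dnz by (intro continuous_intros c that cd) auto
  define I1 where "I1 x = integral {0..x} (f u11 u21)" for x
  define I2 where "I2 x = integral {0..x} (f u12 u22)" for x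
  have I: "(I1 has_vector_derivative f u11 u21 x) (at x within {0..1})"
    "(I2 has_vector_derivative f u12 u22 x) (at x within {0..1})" if "x \<in> {0..1}" for x
    unfolding I1_def I2_def by (intro integral_has_vector_derivative cf cu that)+
  show thesis
  proof (rule that[of "d 1 * I1 1" "d 1 * I2 1"])
    fix a b1 b2
    \<comment> \<open>\<open>g1\<close> and \<open>g2\<close> are the initial values of
      \<open>z\<close>. Since \<open>S\<close> takes the same values at 1, the solution is read in
      the same coordinates at both ends.\<close>
    define g1 where "g1 = b1 - S1 0 * a"
    define g2 where "g2 = b2 - S2 0 * a"
    define e where "e x = exp (\<i> * \<zeta> * complex_of_real x)" for x
    define z1 where "z1 x = e x * (g1 * u11 x + g2 * u12 x)" for x
    define z2 where "z2 x = e x * (g1 * u21 x + g2 * u22 x)" for x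
    define y1 where "y1 x = d x * (a + (g1 * I1 x + g2 * I2 x))" for x
    define y2 where "y2 x = S1 x * y1 x + z1 x" for x
    define y3 where "y3 x = S2 x * y1 x + z2 x" for x
    have e: "(e has_vector_derivative \<i> * \<zeta> * e x) (at x within {0..1})" for x
      unfolding e_def by (rule has_vector_derivative_cexp_linear)
    have sys: "solves_system v1 v2 \<zeta> y1 y2 y3"
      unfolding solves_system_def
    proof (intro ballI conjI)
      fix x :: real assume x: "x \<in> {0..1}"
      have z1: "(z1 has_vector_derivative e x * (g1 * (- \<i> * S1 x * (cnj (v1 x) * u11 x + cnj (v2 x) * u21 x)) +
          g2 * (- \<i> * S1 x * (cnj (v1 x) * u12 x + cnj (v2 x) * u22 x))) + \<i> * \<zeta> * e x * (g1 * u11 x + g2 * u12 x))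
          (at x within {0..1})"
        unfolding z1_def
        by (intro has_vector_derivative_mult has_vector_derivative_add has_vector_derivative_mult_right e u11 u12 x)
      have z2: "(z2 has_vector_derivative e x * (g1 * (- \<i> * S2 x * (cnj (v1 x) * u11 x + cnj (v2 x) * u21 x)) +
          g2 * (- \<i> * S2 x * (cnj (v1 x) * u12 x + cnj (v2 x) * u22 x))) + \<i> * \<zeta> * e x * (g1 * u21 x + g2 * u22 x))
          (at x within {0..1})"
        unfolding z2_def
        by (intro has_vector_derivative_mult has_vector_derivative_add has_vector_derivative_mult_right e u21 u22 x)
      define y1' where "y1' = - \<i> * \<zeta> * y1 x + \<i> * (cnj (v1 x) * y2 x + cnj (v2 x) * y3 x)"
      have y1: "(y1 has_vector_derivative d x * (0 + (g1 * f u11 u21 x + g2 * f u12 u22 x)) +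
          (- \<i> * \<zeta> + \<i> * p x) * d x * (a + (g1 * I1 x + g2 * I2 x))) (at x within {0..1})"
        unfolding y1_def
        by (intro has_vector_derivative_mult has_vector_derivative_add has_vector_derivative_mult_right
            has_vector_derivative_const d I x)
      also have "d x * (0 + (g1 * f u11 u21 x + g2 * f u12 u22 x)) = \<i> * (cnj (v1 x) * z1 x + cnj (v2 x) * z2 x)"
        using dnz[of x] by (simp add: f_def z1_def z2_def e_def field_simps)
      also have "(- \<i> * \<zeta> + \<i> * p x) * d x * (a + (g1 * I1 x + g2 * I2 x)) = (- \<i> * \<zeta> + \<i> * p x) * y1 x"
        by (simp add: y1_def)
      also have "\<i> * (cnj (v1 x) * z1 x + cnj (v2 x) * z2 x) + (- \<i> * \<zeta> + \<i> * p x) * y1 x = y1'"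
        by (simp add: y1'_def y2_def y3_def p_def algebra_simps)
      finally have y1: "(y1 has_vector_derivative y1') (at x within {0..1})" .
      then show "(y1 has_vector_derivative - \<i> * \<zeta> * y1 x + \<i> * (cnj (v1 x) * y2 x + cnj (v2 x) * y3 x)) (at x within {0..1})"
        by (simp add: y1'_def)
      note der = has_vector_derivative_add[OF has_vector_derivative_mult[OF S1[OF x] y1] z1]
        has_vector_derivative_add[OF has_vector_derivative_mult[OF S2[OF x] y1] z2]
      have "S1 x * y1' + (2 * \<i> * \<zeta> * S1 x - \<i> * v1 x - \<i> * S1 x * (cnj (v1 x) * S1 x + cnj (v2 x) * S2 x)) * y1 x +
         (e x * (g1 * (- \<i> * S1 x * (cnj (v1 x) * u11 x + cnj (v2 x) * u21 x)) +
          g2 * (- \<i> * S1 x * (cnj (v1 x) * u12 x + cnj (v2 x) * u22 x))) + \<i> * \<zeta> * e x * (g1 * u11 x + g2 * u12 x)) =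
         \<i> * \<zeta> * y2 x - \<i> * v1 x * y1 x"
        unfolding y1'_def y2_def y3_def z1_def z2_def by algebra
      then show "(y2 has_vector_derivative \<i> * \<zeta> * y2 x - \<i> * v1 x * y1 x) (at x within {0..1})"
        using der(1) unfolding y2_def[abs_def] by (simp only:)
      have "S2 x * y1' + (2 * \<i> * \<zeta> * S2 x - \<i> * v2 x - \<i> * S2 x * (cnj (v1 x) * S1 x + cnj (v2 x) * S2 x)) * y1 x +
         (e x * (g1 * (- \<i> * S2 x * (cnj (v1 x) * u11 x + cnj (v2 x) * u21 x)) +
          g2 * (- \<i> * S2 x * (cnj (v1 x) * u12 x + cnj (v2 x) * u22 x))) + \<i> * \<zeta> * e x * (g1 * u21 x + g2 * u22 x)) =
         \<i> * \<zeta> * y3 x - \<i> * v2 x * y1 x"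
        unfolding y1'_def y2_def y3_def z1_def z2_def by algebra
      then show "(y3 has_vector_derivative \<i> * \<zeta> * y3 x - \<i> * v2 x * y1 x) (at x within {0..1})"
        using der(2) unfolding y3_def[abs_def] by (simp only:)
    qed
    have "d 0 = 1" "d 1 = \<tau>" "I1 0 = 0" "I2 0 = 0" "e 0 = 1" "e 1 = exp (\<i> * \<zeta>)"
      by (simp_all add: d_def \<tau>_def p_def[abs_def] I1_def I2_def e_def)
    then have "y1 0 = a \<and> y2 0 = b1 \<and> y3 0 = b2 \<and>
       y1 1 = \<tau> * a + d 1 * I1 1 * g1 + d 1 * I2 1 * g2 \<and>
       y2 1 = S1 0 * y1 1 + exp (\<i> * \<zeta>) * (g1 * u11 1 + g2 * u12 1) \<and>
       y3 1 = S2 0 * y1 1 + exp (\<i> * \<zeta>) * (g1 * u21 1 + g2 * u22 1)"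
      by (simp add: y1_def y2_def y3_def z1_def z2_def init per g1_def g2_def algebra_simps)
    with sys show "\<exists>y1 y2 y3. solves_system v1 v2 \<zeta> y1 y2 y3 \<and> y1 0 = a \<and> y2 0 = b1 \<and> y3 0 = b2 \<and>
       y1 1 = \<tau> * a + d 1 * I1 1 * (b1 - S1 0 * a) + d 1 * I2 1 * (b2 - S2 0 * a) \<and>
       y2 1 = S1 0 * y1 1 + exp (\<i> * \<zeta>) * ((b1 - S1 0 * a) * u11 1 + (b2 - S2 0 * a) * u12 1) \<and>
       y3 1 = S2 0 * y1 1 + exp (\<i> * \<zeta>) * ((b1 - S1 0 * a) * u21 1 + (b2 - S2 0 * a) * u22 1)"
      unfolding g1_def g2_def by blast
  qed
qed

text \<open>\<open>M\<close> is conjugate, by the unipotent matrix whose first column is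
  \<open>(1, s1, s2)\<close>, to the block triangular matrix with diagonal blocks
  \<open>\<tau>\<close> and \<open>w\<close>. The coupling \<open>\<kappa>1\<close>,
  \<open>\<kappa>2\<close> therefore drops out of the characteristic polynomial, whatever its
  size.\<close>

lemma det_block_triangular_conjugate:
  fixes M :: "complex ^ 3 ^ 3" and s1 s2 \<kappa>1 \<kappa>2 \<tau> :: complex
  assumes "M $ 1 $ 1 = \<tau> - \<kappa>1 * s1 - \<kappa>2 * s2" "M $ 1 $ 2 = \<kappa>1" "M $ 1 $ 3 = \<kappa>2"
    "M $ 2 $ 1 = s1 * M $ 1 $ 1 - (w11 * s1 + w12 * s2)" "M $ 2 $ 2 = s1 * \<kappa>1 + w11" "M $ 2 $ 3 = s1 * \<kappa>2 + w12"
    "M $ 3 $ 1 = s2 * M $ 1 $ 1 - (w21 * s1 + w22 * s2)" "M $ 3 $ 2 = s2 * \<kappa>1 + w21" "M $ 3 $ 3 = s2 * \<kappa>2 + w22"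
  shows "det (mat z - M) = (z - \<tau>) * ((z - w11) * (z - w22) - w12 * w21)"
  unfolding det_3 by (simp add: mat_def assms) algebra

section \<open>Uniqueness and the monodromy matrix\<close>

text \<open>The primitive \<open>f\<close> of \<open>n\<close> satisfies
  \<open>f' \<le> K * f\<close> and \<open>f 0 = 0\<close>, so \<open>f\<close> times
  \<open>exp (- K * x)\<close> is nonincreasing from 0, while \<open>f\<close> is
  nonnegative.\<close>

lemma gronwall_zero:
  fixes n :: "real \<Rightarrow> real"
  assumes c: "continuous_on {0..1} n" and pos: "\<And>x. x \<in> {0..1} \<Longrightarrow> 0 \<le> n x"
    and le: "\<And>x. x \<in> {0..1} \<Longrightarrow> n x \<le> K * integral {0..x} n" and x: "x \<in> {0..1}"
  shows "n x = 0"
proof -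
  define f where "f x = integral {0..x} n" for x
  have f: "(f has_real_derivative n t) (at t within {0..1})" if "t \<in> {0..1}" for t
    unfolding f_def has_real_derivative_iff_has_vector_derivative
    by (rule integral_has_vector_derivative[OF c that])
  have cf: "continuous_on {0..1} f"
    using f by (rule DERIV_continuous_on)
  have "f x * exp (- K * x) \<le> f 0 * exp (- K * 0)"
  proof (rule DERIV_nonpos_imp_decreasing_open[of 0 x "\<lambda>x. f x * exp (- K * x)"])
    fix t assume t: "0 < t" "t < x"
    then have "(f has_real_derivative n t) (at t)"
      using f[of t] x at_within_Icc_at[of 0 t 1] by auto
    then have "((\<lambda>x. f x * exp (- K * x)) has_real_derivative (n t - K * f t) * exp (- K * t)) (at t)"
      by (auto intro!: derivative_eq_intros simp: algebra_simps)
    moreover have "(n t - K * f t) * exp (- K * t) \<le> 0"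
      using le[of t] t x by (auto simp: f_def mult_nonpos_nonneg)
    ultimately show "\<exists>y. ((\<lambda>x. f x * exp (- K * x)) has_real_derivative y) (at t) \<and> y \<le> 0" by blast
  qed (use x in \<open>auto intro!: continuous_intros continuous_on_subset[OF cf]\<close>)
  then have "f x \<le> 0" by (auto simp: f_def mult_le_0_iff)
  moreover have "0 \<le> f x" unfolding f_def
    by (rule integral_nonneg) (use x pos in \<open>auto intro!: integrable_continuous_interval continuous_on_subset[OF c]\<close>)
  ultimately have "f x = 0" by simp
  then show ?thesis using le[OF x] pos[OF x] by (simp add: f_def)
qed

lemma integral_cong_AE_lborel:
  fixes f g :: "real \<Rightarrow> 'a::banach"
  assumes "AE t in lborel. t \<in> {0..1} \<longrightarrow> f t = g t" "x \<le> 1"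
  shows "integral {0..x} f = integral {0..x} g"
proof -
  obtain N where N: "N \<in> null_sets lborel" "{t. \<not> (t \<in> {0..1} \<longrightarrow> f t = g t)} \<subseteq> N"
    using assms(1) by (auto simp: eventually_ae_filter)
  then have "negligible N" by (simp add: negligible_iff_null_sets null_sets_completionI)
  then show ?thesis by (rule integral_spike) (use N assms(2) in auto)
qed

text \<open>Phrased with integral equations because a Caratheodory solution satisfies the
  differential equation only almost everywhere. The sum of the three moduli obeys a Gronwall
  inequality with constant \<open>3 * (cmod \<zeta> + m)\<close>.\<close>

lemma integral_system_zero:
  fixes v1 v2 a b c :: "real \<Rightarrow> complex"
  assumes c: "continuous_on {0..1} v1" "continuous_on {0..1} v2"
    and cont: "continuous_on {0..1} a" "continuous_on {0..1} b" "continuous_on {0..1} c"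
    and a: "\<And>x. x \<in> {0..1} \<Longrightarrow> a x = integral {0..x} (\<lambda>t. - \<i> * \<zeta> * a t + \<i> * (cnj (v1 t) * b t + cnj (v2 t) * c t))"
    and b: "\<And>x. x \<in> {0..1} \<Longrightarrow> b x = integral {0..x} (\<lambda>t. \<i> * \<zeta> * b t - \<i> * v1 t * a t)"
    and c': "\<And>x. x \<in> {0..1} \<Longrightarrow> c x = integral {0..x} (\<lambda>t. \<i> * \<zeta> * c t - \<i> * v2 t * a t)"
    and x: "x \<in> {0..1}"
  shows "a x = 0" "b x = 0" "c x = 0"
proof -
  have "bounded (v1 ` {0..1})" "bounded (v2 ` {0..1})"
    by (rule compact_imp_bounded[OF compact_continuous_image[OF c(1) compact_Icc]]
        compact_imp_bounded[OF compact_continuous_image[OF c(2) compact_Icc]])+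
  then obtain m1 m2 where m12: "\<forall>x\<in>{0..1}. cmod (v1 x) \<le> m1" "\<forall>x\<in>{0..1}. cmod (v2 x) \<le> m2"
    unfolding bounded_iff by blast
  define m where "m = max m1 m2"
  have m: "cmod (v1 x) \<le> m" "cmod (v2 x) \<le> m" if "x \<in> {0..1}" for x
    using m12 that by (auto simp: m_def le_max_iff_disj)
  have m0: "0 \<le> m" by (rule order_trans[OF norm_ge_zero m(1)[of 0]]) simp
  define n where "n x = cmod (a x) + cmod (b x) + cmod (c x)" for x
  define K where "K = cmod \<zeta> + m"
  have cn: "continuous_on {0..1} n" unfolding n_def by (intro continuous_intros cont)
  have K: "cmod (integral {0..x} F) \<le> K * integral {0..x} n"
    if "\<And>t. t \<in> {0..1} \<Longrightarrow> cmod (F t) \<le> K * n t" "continuous_on {0..1} F" "x \<in> {0..1}" for F :: "real \<Rightarrow> complex" and x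
  proof -
    have "cmod (integral {0..x} F) \<le> integral {0..x} (\<lambda>t. K * n t)"
      by (rule Henstock_Kurzweil_Integration.integral_norm_bound_integral)
        (use that in \<open>auto intro!: integrable_continuous_interval continuous_intros continuous_on_subset[OF cn]
          continuous_on_subset[OF that(2)]\<close>)
    then show ?thesis by simp
  qed
  have le: "n x \<le> 3 * K * integral {0..x} n" if x: "x \<in> {0..1}" for x
  proof -
    have pt: "cmod (\<zeta>' * p + (k1 * q + k2 * r)) \<le> K * (cmod p + cmod q + cmod r)"
      if "cmod \<zeta>' = cmod \<zeta>" "cmod k1 \<le> m" "cmod k2 \<le> m" for \<zeta>' p k1 q k2 r
    proof -
      have "cmod (\<zeta>' * p + (k1 * q + k2 * r)) \<le> cmod (\<zeta>' * p) + (cmod (k1 * q) + cmod (k2 * r))"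
        using norm_triangle_ineq[of "\<zeta>' * p" "k1 * q + k2 * r"] norm_triangle_ineq[of "k1 * q" "k2 * r"] by linarith
      also have "\<dots> \<le> K * cmod p + (K * cmod q + K * cmod r)"
        unfolding norm_mult K_def using that m0
        by (intro add_mono mult_right_mono) (auto intro: add_increasing)
      finally show ?thesis by (simp add: algebra_simps)
    qed
    have "cmod (a x) \<le> K * integral {0..x} n"
      unfolding a[OF x]
    proof (rule K[OF _ _ x])
      fix t :: real assume t: "t \<in> {0..1}"
      show "cmod (- \<i> * \<zeta> * a t + \<i> * (cnj (v1 t) * b t + cnj (v2 t) * c t)) \<le> K * n t"
        using pt[of "- \<i> * \<zeta>" "\<i> * cnj (v1 t)" "\<i> * cnj (v2 t)" "a t" "b t" "c t"] m[OF t]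
        by (simp add: n_def norm_mult algebra_simps)
    qed (intro continuous_intros cont c)
    moreover have "cmod (b x) \<le> K * integral {0..x} n"
      unfolding b[OF x]
    proof (rule K[OF _ _ x])
      fix t :: real assume t: "t \<in> {0..1}"
      show "cmod (\<i> * \<zeta> * b t - \<i> * v1 t * a t) \<le> K * n t"
        using pt[of "\<i> * \<zeta>" "- \<i> * v1 t" 0 "b t" "a t" "c t"] m[OF t] m0
        by (simp add: n_def norm_mult algebra_simps)
    qed (intro continuous_intros cont c)
    moreover have "cmod (c x) \<le> K * integral {0..x} n"
      unfolding c'[OF x]
    proof (rule K[OF _ _ x])
      fix t :: real assume t: "t \<in> {0..1}"
      show "cmod (\<i> * \<zeta> * c t - \<i> * v2 t * a t) \<le> K * n t"
        using pt[of "\<i> * \<zeta>" "- \<i> * v2 t" 0 "c t" "a t" "b t"] m[OF t] m0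
        by (simp add: n_def norm_mult algebra_simps)
    qed (intro continuous_intros cont c)
    ultimately show ?thesis by (simp add: n_def)
  qed
  have "n x = 0"
    by (rule gronwall_zero[OF cn _ le x]) (simp add: n_def)
  then show "a x = 0" "b x = 0" "c x = 0"
    by (simp_all add: n_def add_nonneg_eq_0_iff)
qed

text \<open>As \<open>J_mat\<close> is its own inverse, the equation can be solved for the
  derivative, and it decouples into columns, each of the shape of
  \<open>solves_system\<close>.\<close>

lemma system_matrix_equation_iff:
  "mat \<i> ** J_mat ** A + V_mat a ** B = mat \<zeta> ** B \<longleftrightarrow>
     (\<forall>j. A $ 1 $ j = - \<i> * \<zeta> * B $ 1 $ j + \<i> * (cnj (a $ 1) * B $ 2 $ j + cnj (a $ 2) * B $ 3 $ j) \<and>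
          A $ 2 $ j = \<i> * \<zeta> * B $ 2 $ j - \<i> * a $ 1 * B $ 1 $ j \<and>
          A $ 3 $ j = \<i> * \<zeta> * B $ 3 $ j - \<i> * a $ 2 * B $ 1 $ j)"
proof -
  have 1: "\<i> * p + q = r \<longleftrightarrow> p = - \<i> * r + \<i> * q" for p q r :: complex
  proof
    assume "\<i> * p + q = r"
    then have "- \<i> * (\<i> * p + q) = - \<i> * r" by simp
    then show "p = - \<i> * r + \<i> * q" by (simp add: algebra_simps)
  next
    assume p: "p = - \<i> * r + \<i> * q"
    show "\<i> * p + q = r" by (subst p) (simp add: algebra_simps)
  qed
  have 2: "- (\<i> * p) + q = r \<longleftrightarrow> p = \<i> * r - \<i> * q" for p q r :: complex
  proof
    assume "- (\<i> * p) + q = r"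
    then have "\<i> * (- (\<i> * p) + q) = \<i> * r" by simp
    then show "p = \<i> * r - \<i> * q" by (simp add: algebra_simps)
  next
    assume p: "p = \<i> * r - \<i> * q"
    show "- (\<i> * p) + q = r" by (subst p) (simp add: algebra_simps)
  qed
  have "mat \<i> ** J_mat ** A + V_mat a ** B = mat \<zeta> ** B \<longleftrightarrow>
     (\<forall>j. \<i> * A $ 1 $ j + (cnj (a $ 1) * B $ 2 $ j + cnj (a $ 2) * B $ 3 $ j) = \<zeta> * B $ 1 $ j \<and>
          - (\<i> * A $ 2 $ j) + a $ 1 * B $ 1 $ j = \<zeta> * B $ 2 $ j \<and>
          - (\<i> * A $ 3 $ j) + a $ 2 * B $ 1 $ j = \<zeta> * B $ 3 $ j)"
    by (auto simp: vec_eq_iff forall_3 matrix_matrix_mult_def sum_3 mat_def J_mat_def V_mat_def vector_3)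
  then show ?thesis unfolding 1 2 by (simp only: mult.assoc)
qed

lemma bounded_linear_matrix_entry: "bounded_linear (\<lambda>M :: 'a::real_normed_vector ^ 'n ^ 'm. M $ i $ j)"
  by (rule bounded_linear_compose[OF bounded_linear_vec_nth bounded_linear_vec_nth])

lemma integral_matrix_entry:
  fixes f :: "real \<Rightarrow> complex ^ 3 ^ 3"
  assumes "f integrable_on S"
  shows "integral S f $ i $ j = integral S (\<lambda>t. f t $ i $ j)" "(\<lambda>t. f t $ i $ j) integrable_on S"
  using integral_linear[OF assms bounded_linear_matrix_entry[of i j]]
    integrable_linear[OF assms bounded_linear_matrix_entry[of i j]] by (simp_all add: o_def)

lemma solves_system_integral:
  assumes s: "solves_system v1 v2 \<zeta> y1 y2 y3" and x: "x \<in> {0..1}"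
  shows "y1 x = y1 0 + integral {0..x} (\<lambda>t. - \<i> * \<zeta> * y1 t + \<i> * (cnj (v1 t) * y2 t + cnj (v2 t) * y3 t))"
    "y2 x = y2 0 + integral {0..x} (\<lambda>t. \<i> * \<zeta> * y2 t - \<i> * v1 t * y1 t)"
    "y3 x = y3 0 + integral {0..x} (\<lambda>t. \<i> * \<zeta> * y3 t - \<i> * v2 t * y1 t)"
proof -
  have int: "y x = y 0 + integral {0..x} y'"
    if "\<And>t. t \<in> {0..1} \<Longrightarrow> (y has_vector_derivative y' t) (at t within {0..1})" for y y' :: "real \<Rightarrow> complex"
  proof -
    have "(y' has_integral (y x - y 0)) {0..x}"
      by (intro fundamental_theorem_of_calculus has_vector_derivative_within_subset[OF that])
        (use x in auto)
    then show ?thesis by (simp add: integral_unique)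
  qed
  show "y1 x = y1 0 + integral {0..x} (\<lambda>t. - \<i> * \<zeta> * y1 t + \<i> * (cnj (v1 t) * y2 t + cnj (v2 t) * y3 t))"
    by (rule int) (use s in \<open>auto simp: solves_system_def\<close>)
  show "y2 x = y2 0 + integral {0..x} (\<lambda>t. \<i> * \<zeta> * y2 t - \<i> * v1 t * y1 t)"
    by (rule int) (use s in \<open>auto simp: solves_system_def\<close>)
  show "y3 x = y3 0 + integral {0..x} (\<lambda>t. \<i> * \<zeta> * y3 t - \<i> * v2 t * y1 t)"
    by (rule int) (use s in \<open>auto simp: solves_system_def\<close>)
qed

lemma solves_system_continuous:
  assumes "solves_system v1 v2 \<zeta> y1 y2 y3"
  shows "continuous_on {0..1} y1" "continuous_on {0..1} y2" "continuous_on {0..1} y3"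
proof -
  note s = assms[unfolded solves_system_def, THEN bspec]
  show "continuous_on {0..1} y1"
    by (rule continuous_on_vector_derivative[OF s[THEN conjunct1]])
  show "continuous_on {0..1} y2"
    by (rule continuous_on_vector_derivative[OF s[THEN conjunct2, THEN conjunct1]])
  show "continuous_on {0..1} y3"
    by (rule continuous_on_vector_derivative[OF s[THEN conjunct2, THEN conjunct2]])
qed

text \<open>\<open>monodromy\<close> is a definite description, so existence and uniqueness among
  Caratheodory solutions are both needed. A classical solution for the continuous representatives
  solves the equation for \<open>v\<close> almost everywhere; conversely, any competitor satisfies
  the integral equations with the continuous coefficients.\<close>

lemma monodromy_entries:
  fixes Y :: "3 \<Rightarrow> 3 \<Rightarrow> real \<Rightarrow> complex"
  assumes c: "continuous_on {0..1} v1" "continuous_on {0..1} v2"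
    and ae: "AE x in lborel. x \<in> {0..1} \<longrightarrow> v x $ 1 = v1 x \<and> v x $ 2 = v2 x"
    and sol: "\<And>j. solves_system v1 v2 \<zeta> (Y 1 j) (Y 2 j) (Y 3 j)"
    and init: "\<And>i j. Y i j 0 = (if i = j then 1 else 0)"
  shows "monodromy v \<zeta> $ i $ j = Y i j 1"
proof -
  define F1 where "F1 a b c t = - \<i> * \<zeta> * a t + \<i> * (cnj (v1 t) * b t + cnj (v2 t) * c t)" for a b c t
  define F2 where "F2 v a b t = \<i> * \<zeta> * b t - \<i> * v t * a t" for v a b :: "real \<Rightarrow> complex" and t
  have cF: "continuous_on {0..1} (F1 a b c)" "continuous_on {0..1} (F2 v1 a b)" "continuous_on {0..1} (F2 v2 a b)"
    if "continuous_on {0..1} a" "continuous_on {0..1} b" "continuous_on {0..1} c" for a b c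
    unfolding F1_def F2_def by (intro continuous_intros that assms(1,2))+
  \<comment> \<open>Entry \<open>(i, j)\<close> of the right-hand side of the equation for the
    matrix \<open>Z\<close>. It is linear in \<open>Z\<close>, which is what the comparison of two
    solutions rests on.\<close>
  define G where "G Z i j = (if i = 1 then F1 (\<lambda>t. Z t $ 1 $ j) (\<lambda>t. Z t $ 2 $ j) (\<lambda>t. Z t $ 3 $ j)
    else if i = 2 then F2 v1 (\<lambda>t. Z t $ 1 $ j) (\<lambda>t. Z t $ 2 $ j) else F2 v2 (\<lambda>t. Z t $ 1 $ j) (\<lambda>t. Z t $ 3 $ j))"
    for Z :: "real \<Rightarrow> complex ^ 3 ^ 3" and i j :: 3
  have G3: "(3::3) \<noteq> 1" "(3::3) \<noteq> 2" "(2::3) \<noteq> 1" by auto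
  define y where "y x = (\<chi> i j. Y i j x)" for x
  define y' where "y' x = (\<chi> i j. G y i j x)" for x
  have cY: "continuous_on {0..1} (Y i j)" for i j
    using solves_system_continuous[OF sol[of j]] exhaust_3[of i] by auto
  have cG: "continuous_on {0..1} (G Z i j)"
    if "\<And>i j. continuous_on {0..1} (\<lambda>t. Z t $ i $ j)" for Z i j
    unfolding G_def by (auto intro!: cF that)
  have cy': "continuous_on {0..1} y'"
    unfolding y'_def by (intro continuous_on_vec_lambda cG) (simp add: y_def cY)
  have Y_int: "Y i j x = (if i = j then 1 else 0) + integral {0..x} (G y i j)" if "x \<in> {0..1}" for i j x
    using solves_system_integral[OF sol[of j] that] exhaust_3[of i]
    by (auto simp: G_def F1_def[abs_def] F2_def[abs_def] y_def init)
  have y_int: "integral {0..x} y' = y x - mat 1" if "x \<in> {0..1}" for x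
  proof -
    have "y' integrable_on {0..x}"
      by (intro integrable_continuous_interval continuous_on_subset[OF cy']) (use that in auto)
    then show ?thesis
      using Y_int[OF that] by (auto simp: vec_eq_iff integral_matrix_entry y'_def y_def mat_def)
  qed
  have lint: "(LINT t:{0..x}|lborel. Z t) = integral {0..x} Z"
    if "set_integrable lborel {0..1} Z" "x \<in> {0..1}" for Z :: "real \<Rightarrow> complex ^ 3 ^ 3" and x
    by (rule set_borel_integral_eq_integral, rule set_integrable_subset[OF that(1)]) (use that(2) in auto)
  have si: "set_integrable lborel {0..1} y'"
    by (rule borel_integrable_atLeastAtMost'[OF cy'])
  have fund: "is_fundamental_solution v \<zeta> y"
    unfolding is_fundamental_solution_def system_matrix_equation_iff
  proof (intro exI conjI ballI)
    show "y x = mat 1 + (LINT t:{0..x}|lborel. y' t)" if "x \<in> {0..1}" for x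
      using y_int[OF that] lint[OF si that] by simp
    show "AE x\<in>{0..1} in lborel. \<forall>j.
       y' x $ 1 $ j = - \<i> * \<zeta> * y x $ 1 $ j + \<i> * (cnj (v x $ 1) * y x $ 2 $ j + cnj (v x $ 2) * y x $ 3 $ j) \<and>
       y' x $ 2 $ j = \<i> * \<zeta> * y x $ 2 $ j - \<i> * v x $ 1 * y x $ 1 $ j \<and>
       y' x $ 3 $ j = \<i> * \<zeta> * y x $ 3 $ j - \<i> * v x $ 2 * y x $ 1 $ j"
      using ae by eventually_elim (auto simp: y'_def G_def F1_def F2_def G3)
  qed (fact si)
  have unique: "Z 1 = y 1" if Z: "is_fundamental_solution v \<zeta> Z" for Z
  proof -
    obtain Z' where Z': "set_integrable lborel {0..1} Z'"
      "\<And>x. x \<in> {0..1} \<Longrightarrow> Z x = mat 1 + (LINT t:{0..x}|lborel. Z' t)"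
      and Zae: "AE x in lborel. x \<in> {0..1} \<longrightarrow> (\<forall>j.
       Z' x $ 1 $ j = - \<i> * \<zeta> * Z x $ 1 $ j + \<i> * (cnj (v x $ 1) * Z x $ 2 $ j + cnj (v x $ 2) * Z x $ 3 $ j) \<and>
       Z' x $ 2 $ j = \<i> * \<zeta> * Z x $ 2 $ j - \<i> * v x $ 1 * Z x $ 1 $ j \<and>
       Z' x $ 3 $ j = \<i> * \<zeta> * Z x $ 3 $ j - \<i> * v x $ 2 * Z x $ 1 $ j)"
      using Z unfolding is_fundamental_solution_def system_matrix_equation_iff by blast
    have Z'i: "Z' integrable_on {0..1}" using set_borel_integral_eq_integral(1)[OF Z'(1)] .
    have Zx: "Z x $ i $ j = (if i = j then 1 else 0) + integral {0..x} (\<lambda>t. Z' t $ i $ j)" if "x \<in> {0..1}" for x i j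
    proof -
      have "Z' integrable_on {0..x}" using integrable_on_subinterval[OF Z'i, of 0 x] that by auto
      then show ?thesis
        using Z'(2)[OF that] lint[OF Z'(1) that] by (simp add: integral_matrix_entry mat_def)
    qed
    have cZ: "continuous_on {0..1} (\<lambda>t. Z t $ i $ j)" for i j
    proof -
      have "continuous_on {0..1} (\<lambda>x. (if i = j then 1 else 0) + integral {0..x} (\<lambda>t. Z' t $ i $ j))"
        by (intro continuous_intros indefinite_integral_continuous_1 integral_matrix_entry(2) Z'i)
      then show ?thesis by (subst continuous_on_cong[OF refl Zx])
    qed
    \<comment> \<open>The exceptional null set, together with the one where \<open>v\<close> differs
      from its representative, is absorbed by the integral, so from here on only continuous
      coefficients occur.\<close>
    have Z_int: "Z x $ i $ j = (if i = j then 1 else 0) + integral {0..x} (G Z i j)" if x: "x \<in> {0..1}" for x i j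
    proof -
      have "AE t in lborel. t \<in> {0..1} \<longrightarrow> Z' t $ i $ j = G Z i j t"
        using Zae ae by eventually_elim (use exhaust_3[of i] in \<open>auto simp: G_def F1_def F2_def G3\<close>)
      from integral_cong_AE_lborel[OF this, of x] show ?thesis using x Zx[OF x] by simp
    qed
    define D where "D x = Z x - y x" for x
    have cD: "continuous_on {0..1} (\<lambda>t. D t $ i $ j)" for i j
      unfolding D_def y_def by (auto intro!: continuous_intros cZ cY)
    have D_int: "D x $ i $ j = integral {0..x} (G D i j)" if x: "x \<in> {0..1}" for x i j
    proof -
      have "integral {0..x} (\<lambda>t. G Z i j t - G y i j t) = integral {0..x} (G Z i j) - integral {0..x} (G y i j)"
        by (intro Henstock_Kurzweil_Integration.integral_diff integrable_continuous_interval
            continuous_on_subset[OF cG[OF cZ]] continuous_on_subset[OF cG]) (use x in \<open>auto simp: y_def cY\<close>)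
      moreover have "(\<lambda>t. G Z i j t - G y i j t) = G D i j"
        by (auto simp: G_def F1_def F2_def D_def algebra_simps)
      ultimately show ?thesis using Z_int[OF x, of i j] Y_int[OF x, of i j] by (simp add: D_def y_def)
    qed
    have "D 1 $ i $ j = 0" for i j
    proof -
      have D1: "D x $ 1 $ j = integral {0..x} (\<lambda>t. - \<i> * \<zeta> * D t $ 1 $ j + \<i> * (cnj (v1 t) * D t $ 2 $ j + cnj (v2 t) * D t $ 3 $ j))"
        if "x \<in> {0..1}" for x
        unfolding D_int[OF that] G_def F1_def[abs_def] by (simp only: if_True simp_thms)
      have D2: "D x $ 2 $ j = integral {0..x} (\<lambda>t. \<i> * \<zeta> * D t $ 2 $ j - \<i> * v1 t * D t $ 1 $ j)"
        if "x \<in> {0..1}" for x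
        unfolding D_int[OF that] G_def F2_def[abs_def] by (simp only: G3 if_True if_False simp_thms)
      have D3: "D x $ 3 $ j = integral {0..x} (\<lambda>t. \<i> * \<zeta> * D t $ 3 $ j - \<i> * v2 t * D t $ 1 $ j)"
        if "x \<in> {0..1}" for x
        unfolding D_int[OF that] G_def F2_def[abs_def] by (simp only: G3 if_True if_False simp_thms)
      have "D 1 $ 1 $ j = 0" "D 1 $ 2 $ j = 0" "D 1 $ 3 $ j = 0"
        using integral_system_zero[OF c cD cD cD D1 D2 D3, of 1] by simp_all
      then show ?thesis using exhaust_3[of i] by auto
    qed
    then show ?thesis by (simp add: D_def vec_eq_iff)
  qed
  have "monodromy v \<zeta> = y 1"
    unfolding monodromy_def
  proof (rule the_equality)
    show "\<exists>z. is_fundamental_solution v \<zeta> z \<and> y 1 = z 1" using fund by blast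
    show "M = y 1" if "\<exists>z. is_fundamental_solution v \<zeta> z \<and> M = z 1" for M
      using that unique by blast
  qed
  then show ?thesis by (simp add: y_def)
qed

section \<open>Asymptotics of the characteristic polynomial\<close>

definition gram :: "(real \<Rightarrow> complex) \<Rightarrow> (real \<Rightarrow> complex) \<Rightarrow> complex" where
  "gram a b = integral {0..1} (\<lambda>x. a x * cnj (b x))"

text \<open>Combines the flow estimate (\<open>u\<close> is \<open>- \<i> * X\<close> up to second
  order) with the mean value estimate for \<open>X\<close>. With \<open>\<rho>\<close> inserted they
  contribute \<open>1600 * C\<^sup>2 * m^4\<close> and \<open>50 * C * m\<^sup>2\<close> over
  \<open>cmod \<zeta>\<close>; as \<open>C\<close> and \<open>m\<close> are at least 1, the sum is
  below \<open>1650 * C\<^sup>2 * m^4\<close> over \<open>cmod \<zeta>\<close>.\<close>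

lemma scaled_first_order_estimate:
  assumes "cmod (u + \<i> * X) \<le> 8 * m\<^sup>2 * \<rho>\<^sup>2" "cmod (2 * \<zeta> * X - G) \<le> 5 * m * \<rho>"
    and "\<rho> = 10 * C * m / cmod \<zeta>" "1 \<le> C" "1 \<le> m" "\<zeta> \<noteq> 0"
  shows "cmod (2 * \<i> * \<zeta> * u - G) \<le> 1650 * C\<^sup>2 * m^4 / cmod \<zeta>"
proof -
  have "2 * \<i> * \<zeta> * u - G = 2 * \<i> * \<zeta> * (u + \<i> * X) + (2 * \<zeta> * X - G)"
    by (simp add: algebra_simps)
  then have "cmod (2 * \<i> * \<zeta> * u - G) \<le> cmod (2 * \<i> * \<zeta> * (u + \<i> * X)) + cmod (2 * \<zeta> * X - G)"
    by (simp only: norm_triangle_ineq)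
  also have "\<dots> \<le> 2 * cmod \<zeta> * (8 * m\<^sup>2 * \<rho>\<^sup>2) + 5 * m * \<rho>"
    using mult_left_mono[OF assms(1), of "2 * cmod \<zeta>"] assms(2) by (intro add_mono) (simp_all add: norm_mult)
  also have "\<dots> = (1600 * (C\<^sup>2 * m^4) + 50 * (C * m\<^sup>2)) / cmod \<zeta>"
    using assms(6) by (simp add: assms(3) field_simps power2_eq_square power4_eq_xxxx)
  also have "\<dots> \<le> (1600 * (C\<^sup>2 * m^4) + 50 * (C\<^sup>2 * m^4)) / cmod \<zeta>"
  proof -
    have "C * m\<^sup>2 \<le> C\<^sup>2 * m^4"
      using assms(4,5) by (intro mult_mono power_increasing) (auto simp: self_le_power)
    then show ?thesis by (intro divide_right_mono) auto
  qed
  finally show ?thesis by simp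
qed

text \<open>The factorisation is exact. All approximation sits in \<open>P\<close> and in the four
  entries \<open>n\<close>, rescaled so that they converge to the trace and to the entries of the
  Gram matrix of the potential. The exponential factors are kept outside, so the errors are the same
  in every direction of \<open>\<zeta>\<close>.\<close>

lemma monodromy_char_poly_asymptotics:
  assumes v1: "ac_bounded m v1 w1" and v2: "ac_bounded m v2 w2" and m: "1 \<le> m"
    and ae: "AE x in lborel. x \<in> {0..1} \<longrightarrow> v x $ 1 = v1 x \<and> v x $ 2 = v2 x"
    and C: "max 1 (cmod (exp (2 * \<i> * \<zeta>))) \<le> C * cmod (1 - exp (2 * \<i> * \<zeta>))" "1 \<le> C"
    and \<zeta>: "160 * C\<^sup>2 * m\<^sup>2 \<le> cmod \<zeta>"
  obtains P n11 n12 n21 n22 where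
    "\<And>z. det (mat z - monodromy v \<zeta>) = (z - exp (- \<i> * (\<zeta> - P / (2 * \<zeta>)))) *
       ((z - exp (\<i> * \<zeta>) * (1 - \<i> * n11 / (2 * \<zeta>))) * (z - exp (\<i> * \<zeta>) * (1 - \<i> * n22 / (2 * \<zeta>))) -
        exp (\<i> * \<zeta>) * (- \<i> * n12 / (2 * \<zeta>)) * (exp (\<i> * \<zeta>) * (- \<i> * n21 / (2 * \<zeta>))))"
    "cmod (P - (gram v1 v1 + gram v2 v2)) \<le> 1650 * C\<^sup>2 * m^4 / cmod \<zeta>"
    "cmod (n11 - gram v1 v1) \<le> 1650 * C\<^sup>2 * m^4 / cmod \<zeta>"
    "cmod (n12 - gram v1 v2) \<le> 1650 * C\<^sup>2 * m^4 / cmod \<zeta>"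
    "cmod (n21 - gram v2 v1) \<le> 1650 * C\<^sup>2 * m^4 / cmod \<zeta>"
    "cmod (n22 - gram v2 v2) \<le> 1650 * C\<^sup>2 * m^4 / cmod \<zeta>"
proof -
  define \<rho> where "\<rho> = 10 * C * m / cmod \<zeta>"
  define D where "D = 1650 * C\<^sup>2 * m^4 / cmod \<zeta>"
  have Cm: "0 < C\<^sup>2 * m\<^sup>2" using C m by simp
  then have \<zeta>0: "0 < cmod \<zeta>" using \<zeta> by linarith
  then have \<zeta>nz: "\<zeta> \<noteq> 0" by auto
  have \<rho>: "0 \<le> \<rho>" using C m \<zeta>0 by (auto simp: \<rho>_def)
  have "16 * C * m * \<rho> \<le> 1"
    using C m \<zeta> \<zeta>0 by (auto simp: \<rho>_def field_simps power2_eq_square)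
  moreover have "1 * (16 * m * \<rho>) \<le> C * (16 * m * \<rho>)"
    using C m \<rho> by (intro mult_right_mono) auto
  ultimately have small: "16 * m * \<rho> \<le> 1" by (simp add: mult_ac)
  moreover have "0 \<le> m * \<rho>" using m \<rho> by simp
  ultimately have small': "m * \<rho> \<le> 1" unfolding mult.assoc by linarith
  obtain S1 S2 where
    S1: "\<And>x. x \<in> {0..1} \<Longrightarrow> (S1 has_vector_derivative
      2 * \<i> * \<zeta> * S1 x - \<i> * v1 x - \<i> * S1 x * (cnj (v1 x) * S1 x + cnj (v2 x) * S2 x)) (at x within {0..1})"
    and S2: "\<And>x. x \<in> {0..1} \<Longrightarrow> (S2 has_vector_derivative
      2 * \<i> * \<zeta> * S2 x - \<i> * v2 x - \<i> * S2 x * (cnj (v1 x) * S1 x + cnj (v2 x) * S2 x)) (at x within {0..1})"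
    and per: "S1 1 = S1 0" "S2 1 = S2 0"
    and S\<rho>: "\<And>x. x \<in> {0..1} \<Longrightarrow> cmod (S1 x) \<le> \<rho>" "\<And>x. x \<in> {0..1} \<Longrightarrow> cmod (S2 x) \<le> \<rho>"
    by (rule periodic_riccati_solution[OF v1 v2 m C \<zeta>, folded \<rho>_def]) (rule that)
  note cv = ac_bounded_continuous[OF v1] ac_bounded_continuous[OF v2]
  have cS: "continuous_on {0..1} S1" "continuous_on {0..1} S2"
    by (rule continuous_on_vector_derivative[OF S1] continuous_on_vector_derivative[OF S2]; assumption)+
  have mv: "cmod (v1 x) \<le> m" "cmod (v2 x) \<le> m" if "x \<in> {0..1}" for x
    using v1 v2 that by (auto simp: ac_bounded_def)
  note sys = small_linear_system_solution[OF cv cS mv S\<rho> small]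
  obtain u11 u21 where
    u11: "\<And>x. x \<in> {0..1} \<Longrightarrow> (u11 has_vector_derivative - \<i> * S1 x * (cnj (v1 x) * u11 x + cnj (v2 x) * u21 x)) (at x within {0..1})"
    and u21: "\<And>x. x \<in> {0..1} \<Longrightarrow> (u21 has_vector_derivative - \<i> * S2 x * (cnj (v1 x) * u11 x + cnj (v2 x) * u21 x)) (at x within {0..1})"
    and u1_init: "u11 0 = 1" "u21 0 = 0"
    and u1_bd: "\<And>x. x \<in> {0..1} \<Longrightarrow> cmod (u11 x) \<le> 2" "\<And>x. x \<in> {0..1} \<Longrightarrow> cmod (u21 x) \<le> 2"
    by (rule sys[where ?c1.0 = 1 and ?c2.0 = 0]) auto
  obtain u12 u22 where
    u12: "\<And>x. x \<in> {0..1} \<Longrightarrow> (u12 has_vector_derivative - \<i> * S1 x * (cnj (v1 x) * u12 x + cnj (v2 x) * u22 x)) (at x within {0..1})"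
    and u22: "\<And>x. x \<in> {0..1} \<Longrightarrow> (u22 has_vector_derivative - \<i> * S2 x * (cnj (v1 x) * u12 x + cnj (v2 x) * u22 x)) (at x within {0..1})"
    and u2_init: "u12 0 = 0" "u22 0 = 1"
    and u2_bd: "\<And>x. x \<in> {0..1} \<Longrightarrow> cmod (u12 x) \<le> 2" "\<And>x. x \<in> {0..1} \<Longrightarrow> cmod (u22 x) \<le> 2"
    by (rule sys[where ?c1.0 = 0 and ?c2.0 = 1]) auto
  define p where "p x = cnj (v1 x) * S1 x + cnj (v2 x) * S2 x" for x
  have cp: "continuous_on {0..1} p" unfolding p_def by (intro continuous_intros cv cS)
  have pb: "cmod (p x) \<le> 2 * m * \<rho>" if "x \<in> {0..1}" for x
    unfolding p_def by (intro norm_pairing_le mv S\<rho> that)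
  note mean = riccati_mean_asymptotics[OF _ _ cp _ _ pb small', folded gram_def]
  have X11: "cmod (2 * \<zeta> * gram S1 v1 - gram v1 v1) \<le> 5 * m * \<rho>"
    by (rule mean[OF v1 v1 S1[folded p_def] S\<rho>(1)])
  have X12: "cmod (2 * \<zeta> * gram S1 v2 - gram v1 v2) \<le> 5 * m * \<rho>"
    by (rule mean[OF v1 v2 S1[folded p_def] S\<rho>(1)])
  have X21: "cmod (2 * \<zeta> * gram S2 v1 - gram v2 v1) \<le> 5 * m * \<rho>"
    by (rule mean[OF v2 v1 S2[folded p_def] S\<rho>(2)])
  have X22: "cmod (2 * \<zeta> * gram S2 v2 - gram v2 v2) \<le> 5 * m * \<rho>"
    by (rule mean[OF v2 v2 S2[folded p_def] S\<rho>(2)])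
  note fo1 = linear_system_first_order[OF cv cS mv S\<rho> u11 u21 u1_bd, unfolded u1_init mult_1_right mult_zero_right add_0_right, folded gram_def]
  note fo2 = linear_system_first_order[OF cv cS mv S\<rho> u12 u22 u2_bd, unfolded u2_init mult_1_right mult_zero_right add_0_left, folded gram_def]
  \<comment> \<open>Chosen so that the flow matrix at 1 equals
    \<open>1 - \<i> * n / (2 * \<zeta>)\<close> exactly, with rows and columns of \<open>n\<close>
    indexed as in the Gram matrix.\<close>
  define n11 where "n11 = 2 * \<i> * \<zeta> * (u11 1 - 1)"
  define n21 where "n21 = 2 * \<i> * \<zeta> * (u21 1 - 0)"
  define n12 where "n12 = 2 * \<i> * \<zeta> * (u12 1 - 0)"
  define n22 where "n22 = 2 * \<i> * \<zeta> * (u22 1 - 1)"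
  define P where "P = 2 * \<zeta> * (gram S1 v1 + gram S2 v2)"
  have n: "cmod (n11 - gram v1 v1) \<le> D" "cmod (n21 - gram v2 v1) \<le> D"
    "cmod (n12 - gram v1 v2) \<le> D" "cmod (n22 - gram v2 v2) \<le> D"
    unfolding n11_def n12_def n21_def n22_def D_def
    by (rule scaled_first_order_estimate[OF fo1(1) X11 \<rho>_def C(2) m \<zeta>nz]
        scaled_first_order_estimate[OF fo1(2) X21 \<rho>_def C(2) m \<zeta>nz]
        scaled_first_order_estimate[OF fo2(1) X12 \<rho>_def C(2) m \<zeta>nz]
        scaled_first_order_estimate[OF fo2(2) X22 \<rho>_def C(2) m \<zeta>nz]; assumption)+
  have Pb: "cmod (P - (gram v1 v1 + gram v2 v2)) \<le> D"
  proof -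
    have eq: "P - (gram v1 v1 + gram v2 v2) = (2 * \<zeta> * gram S1 v1 - gram v1 v1) + (2 * \<zeta> * gram S2 v2 - gram v2 v2)"
      by (simp add: P_def algebra_simps)
    have "cmod (P - (gram v1 v1 + gram v2 v2)) \<le> 10 * m * \<rho>"
      unfolding eq using norm_triangle_ineq[of "2 * \<zeta> * gram S1 v1 - gram v1 v1" "2 * \<zeta> * gram S2 v2 - gram v2 v2"] X11 X22 by linarith
    also have "\<dots> = 100 * (C * m\<^sup>2) / cmod \<zeta>" by (simp add: \<rho>_def power2_eq_square)
    also have "\<dots> \<le> D"
    proof -
      have "C * m\<^sup>2 \<le> C\<^sup>2 * m^4"
        using C m by (intro mult_mono power_increasing) (auto simp: self_le_power)
      moreover have "0 \<le> C\<^sup>2 * m^4" by simp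
      ultimately have "100 * (C * m\<^sup>2) \<le> 1650 * C\<^sup>2 * m^4" unfolding mult.assoc by linarith
      then show ?thesis unfolding D_def by (rule divide_right_mono) simp
    qed
    finally show ?thesis .
  qed
  have int_p: "integral {0..1} (\<lambda>x. cnj (v1 x) * S1 x + cnj (v2 x) * S2 x) = gram S1 v1 + gram S2 v2"
    unfolding gram_def mult.commute[of "cnj _"]
    by (intro Henstock_Kurzweil_Integration.integral_add integrable_continuous_interval continuous_intros cv cS)
  obtain \<kappa>1 \<kappa>2 where \<kappa>: "\<And>a b1 b2. \<exists>y1 y2 y3. solves_system v1 v2 \<zeta> y1 y2 y3 \<and> y1 0 = a \<and> y2 0 = b1 \<and> y3 0 = b2 \<and>
       y1 1 = exp (- \<i> * \<zeta> + \<i> * (gram S1 v1 + gram S2 v2)) * a + \<kappa>1 * (b1 - S1 0 * a) + \<kappa>2 * (b2 - S2 0 * a) \<and>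
       y2 1 = S1 0 * y1 1 + exp (\<i> * \<zeta>) * ((b1 - S1 0 * a) * u11 1 + (b2 - S2 0 * a) * u12 1) \<and>
       y3 1 = S2 0 * y1 1 + exp (\<i> * \<zeta>) * ((b1 - S1 0 * a) * u21 1 + (b2 - S2 0 * a) * u22 1)"
    using block_triangular_solution[OF cv S1 S2 per u11 u21 u12 u22 u1_init u2_init] unfolding int_p by blast
  define \<tau> where "\<tau> = exp (- \<i> * \<zeta> + \<i> * (gram S1 v1 + gram S2 v2))"
  obtain a1 a2 a3 where a: "solves_system v1 v2 \<zeta> a1 a2 a3" "a1 0 = 1" "a2 0 = 0" "a3 0 = 0"
    "a1 1 = \<tau> - \<kappa>1 * S1 0 - \<kappa>2 * S2 0"
    "a2 1 = S1 0 * a1 1 - (exp (\<i> * \<zeta>) * u11 1 * S1 0 + exp (\<i> * \<zeta>) * u12 1 * S2 0)"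
    "a3 1 = S2 0 * a1 1 - (exp (\<i> * \<zeta>) * u21 1 * S1 0 + exp (\<i> * \<zeta>) * u22 1 * S2 0)"
    using \<kappa>[of 1 0 0] by (auto simp: \<tau>_def algebra_simps)
  obtain b1 b2 b3 where b: "solves_system v1 v2 \<zeta> b1 b2 b3" "b1 0 = 0" "b2 0 = 1" "b3 0 = 0"
    "b1 1 = \<kappa>1" "b2 1 = S1 0 * \<kappa>1 + exp (\<i> * \<zeta>) * u11 1" "b3 1 = S2 0 * \<kappa>1 + exp (\<i> * \<zeta>) * u21 1"
    using \<kappa>[of 0 1 0] by auto
  obtain c1 c2 c3 where c: "solves_system v1 v2 \<zeta> c1 c2 c3" "c1 0 = 0" "c2 0 = 0" "c3 0 = 1"
    "c1 1 = \<kappa>2" "c2 1 = S1 0 * \<kappa>2 + exp (\<i> * \<zeta>) * u12 1" "c3 1 = S2 0 * \<kappa>2 + exp (\<i> * \<zeta>) * u22 1"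
    using \<kappa>[of 0 0 1] by auto
  define Y :: "3 \<Rightarrow> 3 \<Rightarrow> real \<Rightarrow> complex" where
    "Y i j = (if j = 1 then if i = 1 then a1 else if i = 2 then a2 else a3
      else if j = 2 then if i = 1 then b1 else if i = 2 then b2 else b3
      else if i = 1 then c1 else if i = 2 then c2 else c3)" for i j
  have Y: "Y 1 1 = a1" "Y 2 1 = a2" "Y 3 1 = a3" "Y 1 2 = b1" "Y 2 2 = b2" "Y 3 2 = b3"
    "Y 1 3 = c1" "Y 2 3 = c2" "Y 3 3 = c3"
    by (simp_all add: Y_def)
  have M: "monodromy v \<zeta> $ i $ j = Y i j 1" for i j
  proof (rule monodromy_entries[OF cv ae])
    show "solves_system v1 v2 \<zeta> (Y 1 j) (Y 2 j) (Y 3 j)" for j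
      using exhaust_3[of j] a(1) b(1) c(1) Y by auto
    show "Y i j 0 = (if i = j then 1 else 0)" for i j
      using exhaust_3[of i] exhaust_3[of j] a b c Y by auto
  qed
  have "det (mat z - monodromy v \<zeta>) = (z - \<tau>) * ((z - exp (\<i> * \<zeta>) * u11 1) * (z - exp (\<i> * \<zeta>) * u22 1) -
      exp (\<i> * \<zeta>) * u12 1 * (exp (\<i> * \<zeta>) * u21 1))" for z
    by (rule det_block_triangular_conjugate[where ?s1.0 = "S1 0" and ?s2.0 = "S2 0"])
      (simp_all only: M Y a(5-7) b(5-7) c(5-7))
  moreover have "\<tau> = exp (- \<i> * (\<zeta> - P / (2 * \<zeta>)))"
  proof -
    have "P / (2 * \<zeta>) = gram S1 v1 + gram S2 v2" using \<zeta>nz by (simp add: P_def)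
    then show ?thesis by (simp add: \<tau>_def algebra_simps)
  qed
  moreover have "u11 1 = 1 - \<i> * n11 / (2 * \<zeta>)" "u22 1 = 1 - \<i> * n22 / (2 * \<zeta>)"
    "u12 1 = - \<i> * n12 / (2 * \<zeta>)" "u21 1 = - \<i> * n21 / (2 * \<zeta>)"
    using \<zeta>nz by (simp_all add: n11_def n12_def n21_def n22_def field_simps)
  ultimately have "det (mat z - monodromy v \<zeta>) = (z - exp (- \<i> * (\<zeta> - P / (2 * \<zeta>)))) *
       ((z - exp (\<i> * \<zeta>) * (1 - \<i> * n11 / (2 * \<zeta>))) * (z - exp (\<i> * \<zeta>) * (1 - \<i> * n22 / (2 * \<zeta>))) -
        exp (\<i> * \<zeta>) * (- \<i> * n12 / (2 * \<zeta>)) * (exp (\<i> * \<zeta>) * (- \<i> * n21 / (2 * \<zeta>))))" for z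
    by (simp only:)
  from that[OF this Pb[unfolded D_def] n(1,3,2,4)[unfolded D_def]] show thesis .
qed

section \<open>Absolutely continuous representatives of square integrable potentials\<close>

lemma norm_le_one_plus_square: "norm x \<le> 1 + (norm x)\<^sup>2"
proof -
  have "0 \<le> (norm x - 1/2)\<^sup>2" by simp
  then show ?thesis by (simp add: power2_diff power_divide)
qed

lemma L2_torus_set_integrable:
  assumes v: "v \<in> L2_torus"
  shows "set_integrable lborel {0..1} v" "set_integrable lborel {0..1} (\<lambda>x. v x $ j * cnj (v x $ k))"
proof -
  have meas [measurable]: "v \<in> borel_measurable borel"
    and sq: "set_integrable lborel {0..1} (\<lambda>x. (norm (v x))\<^sup>2)"
    using v by (auto simp: L2_torus_def)
  have nth [measurable]: "(\<lambda>x. v x $ j) \<in> borel_measurable borel" for j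
    by (rule measurable_compose[OF meas])
      (intro borel_measurable_continuous_onI continuous_intros)
  have cnj [measurable]: "(\<lambda>x. cnj (v x $ j)) \<in> borel_measurable borel" for j
    by (rule measurable_compose[OF nth]) (intro borel_measurable_continuous_onI continuous_intros)
  have "set_integrable lborel {0..1} (\<lambda>x. 1 + (norm (v x))\<^sup>2)"
    by (intro set_integral_add sq borel_integrable_atLeastAtMost' continuous_on_const)
  then show "set_integrable lborel {0..1} v"
    by (rule set_integrable_bound)
      (auto simp: set_borel_measurable_def abs_of_nonneg norm_le_one_plus_square)
  show "set_integrable lborel {0..1} (\<lambda>x. v x $ j * cnj (v x $ k))"
    by (rule set_integrable_bound[OF sq])
      (auto simp: set_borel_measurable_def norm_mult power2_eq_square
        intro!: mult_mono Finite_Cartesian_Product.norm_nth_le)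
qed

lemma L2_norm_square_le:
  assumes "L2_norm v \<le> R"
  shows "(LINT x:{0..1}|lborel. (norm (v x))\<^sup>2) \<le> R\<^sup>2"
proof -
  have "0 \<le> (LINT x:{0..1}|lborel. (norm (v x))\<^sup>2)"
    unfolding set_lebesgue_integral_def by (rule Bochner_Integration.integral_nonneg) auto
  then show ?thesis using assms by (simp add: L2_norm_def real_sqrt_le_iff real_le_lsqrt sqrt_le_D)
qed

text \<open>Comparison with \<open>1 + (norm (v x))\<^sup>2\<close> replaces the Cauchy-Schwarz
  inequality; only some bound depending on \<open>R\<close> alone is wanted.\<close>

lemma L2_torus_integral_norm_le:
  assumes v: "v \<in> L2_torus" and R: "L2_norm v \<le> R"
  shows "(\<lambda>x. norm (v x)) integrable_on {0..1}" "integral {0..1} (\<lambda>x. norm (v x)) \<le> 1 + R\<^sup>2"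
proof -
  have sq: "set_integrable lborel {0..1} (\<lambda>x. (norm (v x))\<^sup>2)"
    using v by (auto simp: L2_torus_def)
  have n: "set_integrable lborel {0..1} (\<lambda>x. norm (v x))"
    using set_integrable_norm[OF L2_torus_set_integrable(1)[OF v]] .
  have 1: "set_integrable lborel {0..1} (\<lambda>x::real. 1 :: real)"
    by (rule borel_integrable_atLeastAtMost') (rule continuous_on_const)
  show "(\<lambda>x. norm (v x)) integrable_on {0..1}"
    by (rule set_borel_integral_eq_integral[OF n])
  have "(LINT x:{0..1}|lborel. norm (v x)) \<le> (LINT x:{0..1}|lborel. 1 + (norm (v x))\<^sup>2)"
    by (rule set_integral_mono[OF n set_integral_add(1)[OF 1 sq]]) (rule norm_le_one_plus_square)
  also have "\<dots> = 1 + (LINT x:{0..1}|lborel. (norm (v x))\<^sup>2)"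
    by (subst set_integral_add(2)[OF 1 sq]) (simp add: set_lebesgue_integral_def)
  finally show "integral {0..1} (\<lambda>x. norm (v x)) \<le> 1 + R\<^sup>2"
    using L2_norm_square_le[OF R] set_borel_integral_eq_integral(2)[OF n] by simp
qed

text \<open>The one-dimensional Sobolev embedding with crude constants. The representative
  oscillates by at most the integral of \<open>norm w\<close>, and its mean modulus is that of
  \<open>v\<close>; each is at most \<open>1 + R\<^sup>2\<close>, which gives
  \<open>2 + 2 * R\<^sup>2\<close>.\<close>

lemma has_L2_deriv_ac_bounded:
  assumes d: "has_L2_deriv v w" and R: "L2_norm v \<le> R" "L2_norm w \<le> R"
  obtains v1 v2 w1 w2 where "ac_bounded (2 + 2 * R\<^sup>2) v1 w1" "ac_bounded (2 + 2 * R\<^sup>2) v2 w2"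
    "AE x in lborel. x \<in> {0..1} \<longrightarrow> v x $ 1 = v1 x \<and> v x $ 2 = v2 x"
proof -
  obtain c where v: "v \<in> L2_torus" and w: "w \<in> L2_torus"
    and ae: "AE x in lborel. v x = c + (LBINT t=0..x. w t)"
    using d unfolding has_L2_deriv_def by auto
  have wi: "set_integrable lborel {0..1} w" by (rule L2_torus_set_integrable(1)[OF w])
  have wi': "w integrable_on {0..1}" by (rule set_borel_integral_eq_integral(1)[OF wi])
  define f where "f x = c + integral {0..x} w" for x
  have f_ae: "AE x in lborel. x \<in> {0..1} \<longrightarrow> v x = f x"
    using ae
  proof eventually_elim
    case (elim x)
    have "(LBINT t=0..x. w t) = integral {0..x} w" if x: "x \<in> {0..1}"
    proof -
      have "(LBINT t=0..x. w t) = (LBINT t:{0..x}. w t)"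
        using interval_integral_Icc[of 0 x] x by (simp add: zero_ereal_def)
      also have "\<dots> = integral {0..x} w"
        by (rule set_borel_integral_eq_integral, rule set_integrable_subset[OF wi]) (use x in auto)
      finally show ?thesis .
    qed
    then show ?case using elim by (auto simp: f_def)
  qed
  have f_diff: "f y - f x = integral {x..y} w" if "0 \<le> x" "x \<le> y" "y \<le> 1" for x y
    using Henstock_Kurzweil_Integration.integral_combine[OF that(1,2) integrable_on_subinterval[OF wi']] that
    by (auto simp: f_def algebra_simps)
  note wn = L2_torus_integral_norm_le[OF w R(2)]
  have f_diff_le: "norm (f y - f x) \<le> 1 + R\<^sup>2" if "0 \<le> x" "x \<le> y" "y \<le> 1" for x y
  proof -
    have i: "w integrable_on {x..y}" "(\<lambda>t. norm (w t)) integrable_on {x..y}"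
      using integrable_on_subinterval[OF wi'] integrable_on_subinterval[OF wn(1)] that by auto
    have "norm (integral {x..y} w) \<le> integral {x..y} (\<lambda>t. norm (w t))"
      by (rule Henstock_Kurzweil_Integration.integral_norm_bound_integral[OF i]) simp
    also have "\<dots> \<le> integral {0..1} (\<lambda>t. norm (w t))"
      by (rule integral_subset_le[OF _ i(2) wn(1)]) (use that in auto)
    finally show ?thesis using f_diff[OF that] wn(2) by simp
  qed
  have f_cont: "continuous_on {0..1} f"
    unfolding f_def by (intro continuous_intros indefinite_integral_continuous_1 wi')
  have f_bound: "norm (f x) \<le> 2 + 2 * R\<^sup>2" if x: "x \<in> {0..1}" for x
  proof -
    have fn: "(\<lambda>y. norm (f y)) integrable_on {0..1}"
      by (intro integrable_continuous_interval continuous_intros f_cont)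
    have le: "norm (f x) \<le> norm (f y) + (1 + R\<^sup>2)" if y: "y \<in> {0..1}" for y
    proof -
      have "norm (f x - f y) \<le> 1 + R\<^sup>2"
        using f_diff_le[of x y] f_diff_le[of y x] x y by (cases "x \<le> y") (auto simp: norm_minus_commute)
      then show ?thesis using norm_triangle_ineq[of "f x - f y" "f y"] by simp
    qed
    \<comment> \<open>The left side is the constant \<open>norm (f x)\<close>. Averaging the
      oscillation bound over \<open>y\<close> replaces the unknown value \<open>f y\<close> by an
      integral that the L2 norm controls.\<close>
    have "integral {0..1::real} (\<lambda>y. norm (f x)) \<le> integral {0..1} (\<lambda>y. norm (f y) + (1 + R\<^sup>2))"
      by (rule integral_le) (auto intro!: integrable_add fn le simp del: norm_ge_zero)
    also have "\<dots> = integral {0..1} (\<lambda>y. norm (f y)) + (1 + R\<^sup>2)"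
      by (subst Henstock_Kurzweil_Integration.integral_add[OF fn]) auto
    also have "integral {0..1} (\<lambda>y. norm (f y)) = integral {0..1} (\<lambda>y. norm (v y))"
      by (rule integral_cong_AE_lborel) (use f_ae in \<open>auto elim!: eventually_mono\<close>)
    also have "\<dots> \<le> 1 + R\<^sup>2" by (rule L2_torus_integral_norm_le[OF v R(1)])
    finally show ?thesis by simp
  qed
  have wa: "w absolutely_integrable_on {0..1}"
    using wi' wn(1) by (simp add: absolutely_integrable_on_def)
  have wj: "(\<lambda>x. w x $ j) absolutely_integrable_on {0..1}" for j
    using absolutely_integrable_linear[OF wa bounded_linear_vec_nth[of j]] by (simp add: o_def)
  have comp: "ac_bounded (2 + 2 * R\<^sup>2) (\<lambda>x. f x $ j) (\<lambda>x. w x $ j)" for j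
    unfolding ac_bounded_def
  proof (intro conjI allI impI ballI)
    show "(\<lambda>x. w x $ j) absolutely_integrable_on {0..1}" by (rule wj)
    fix x y :: real assume xy: "0 \<le> x" "x \<le> y" "y \<le> 1"
    have "w integrable_on {x..y}" using integrable_on_subinterval[OF wi'] xy by auto
    from integral_linear[OF this bounded_linear_vec_nth[of j]]
    have "integral {x..y} (\<lambda>t. w t $ j) = integral {x..y} w $ j" by (simp add: o_def)
    then show "f y $ j - f x $ j = integral {x..y} (\<lambda>t. w t $ j)"
      using f_diff[OF xy] by (simp flip: vector_minus_component)
  next
    show "cmod (f x $ j) \<le> 2 + 2 * R\<^sup>2" if "x \<in> {0..1}" for x
      by (rule order_trans[OF Finite_Cartesian_Product.norm_nth_le f_bound[OF that]])
    have "integral {0..1} (\<lambda>t. cmod (w t $ j)) \<le> integral {0..1} (\<lambda>t. norm (w t))"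
    proof (rule integral_le)
      show "(\<lambda>t. cmod (w t $ j)) integrable_on {0..1}"
        using wj by (simp add: absolutely_integrable_on_def)
    qed (auto intro: wn Finite_Cartesian_Product.norm_nth_le)
    then show "integral {0..1} (\<lambda>t. cmod (w t $ j)) \<le> 2 + 2 * R\<^sup>2"
      using wn(2) zero_le_power2[of R] by linarith
  qed
  show thesis
    by (rule that[OF comp[of 1] comp[of 2]]) (use f_ae in \<open>auto elim!: eventually_mono\<close>)
qed

lemma gram_eq:
  assumes v: "v \<in> L2_torus" and ae: "AE x in lborel. x \<in> {0..1} \<longrightarrow> v x $ j = a x \<and> v x $ k = b x"
  shows "(LINT x:{0..1}|lborel. v x $ j * cnj (v x $ k)) = gram a b"
proof -
  have "(LINT x:{0..1}|lborel. v x $ j * cnj (v x $ k)) = integral {0..1} (\<lambda>x. v x $ j * cnj (v x $ k))"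
    by (rule set_borel_integral_eq_integral[OF L2_torus_set_integrable(2)[OF v]])
  also have "\<dots> = gram a b"
    unfolding gram_def by (rule integral_cong_AE_lborel) (use ae in \<open>auto elim!: eventually_mono\<close>)
  finally show ?thesis .
qed

lemma gram_diag_eq:
  assumes v: "v \<in> L2_torus" and ae: "AE x in lborel. x \<in> {0..1} \<longrightarrow> v x $ j = a x"
  shows "of_real (LINT x:{0..1}|lborel. (cmod (v x $ j))\<^sup>2) = gram a a"
proof -
  have "of_real (LINT x:{0..1}|lborel. (cmod (v x $ j))\<^sup>2) =
    (LINT x:{0..1}|lborel. complex_of_real ((cmod (v x $ j))\<^sup>2))"
    by (rule set_integral_complex_of_real[symmetric])
  also have "\<dots> = (LINT x:{0..1}|lborel. v x $ j * cnj (v x $ j))"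
    by (simp only: complex_norm_square)
  also have "\<dots> = gram a a"
    by (rule gram_eq[OF v]) (use ae in \<open>auto elim!: eventually_mono\<close>)
  finally show ?thesis .
qed

lemma L2_norm_square_eq:
  assumes v: "v \<in> L2_torus"
  shows "(L2_norm v)\<^sup>2 = (LINT x:{0..1}|lborel. (cmod (v x $ 1))\<^sup>2) + (LINT x:{0..1}|lborel. (cmod (v x $ 2))\<^sup>2)"
proof -
  have si: "set_integrable lborel {0..1} (\<lambda>x. (cmod (v x $ j))\<^sup>2)" for j
    using set_integrable_norm[OF L2_torus_set_integrable(2)[OF v, of j j]]
    by (simp add: norm_mult power2_eq_square)
  have "(L2_norm v)\<^sup>2 = (LINT x:{0..1}|lborel. (norm (v x))\<^sup>2)"
    unfolding L2_norm_def set_lebesgue_integral_def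
    by (intro real_sqrt_pow2 Bochner_Integration.integral_nonneg) auto
  also have "(\<lambda>x. (norm (v x))\<^sup>2) = (\<lambda>x. (cmod (v x $ 1))\<^sup>2 + (cmod (v x $ 2))\<^sup>2)"
    by (simp add: norm_vec_def L2_set_def sum_2)
  finally show ?thesis by (simp add: set_integral_add(2)[OF si si])
qed

section \<open>Roots and the constants\<close>

lemma quadratic_roots:
  fixes s p :: complex
  obtains x1 x2 where "x1 + x2 = s" "x1 * x2 = p"
proof
  show "(s + csqrt (s\<^sup>2 - 4 * p)) / 2 + (s - csqrt (s\<^sup>2 - 4 * p)) / 2 = s"
    by (simp add: field_simps)
  have "(s + csqrt (s\<^sup>2 - 4 * p)) * (s - csqrt (s\<^sup>2 - 4 * p)) = 4 * p"
    by (simp add: algebra_simps flip: power2_eq_square)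
  then show "(s + csqrt (s\<^sup>2 - 4 * p)) / 2 * ((s - csqrt (s\<^sup>2 - 4 * p)) / 2) = p"
    by simp
qed

text \<open>The monic quadratic with sum \<open>s\<close> and product \<open>p\<close> takes at
  \<open>b1\<close> a value of size at most \<open>\<eta> * (1 + R)\<close>. This value is the
  product of the distances from \<open>b1\<close> to the two roots, so one root lies within the
  square root of it. The rate cannot be linear in general, since \<open>b1\<close> and
  \<open>b2\<close> may coincide.\<close>

lemma quadratic_roots_close:
  fixes s p b1 b2 :: complex
  assumes s: "cmod (s - (b1 + b2)) \<le> \<eta>" and p: "cmod (p - b1 * b2) \<le> \<eta>" and R: "cmod b1 \<le> R"
  obtains x1 x2 where "x1 + x2 = s" "x1 * x2 = p"
    "cmod (x1 - b1) \<le> \<eta> + sqrt (\<eta> * (1 + R))" "cmod (x2 - b2) \<le> \<eta> + sqrt (\<eta> * (1 + R))"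
proof -
  note roots = that
  define q where "q = sqrt (\<eta> * (1 + R))"
  have \<eta>: "0 \<le> \<eta>" by (rule order_trans[OF norm_ge_zero s])
  have R0: "0 \<le> R" by (rule order_trans[OF norm_ge_zero R])
  have q: "0 \<le> q" "q\<^sup>2 = \<eta> * (1 + R)" using \<eta> R0 by (simp_all add: q_def)
  \<comment> \<open>Whichever root is close to \<open>b1\<close> is named \<open>x1\<close>; the sum
    of the roots then forces the other one close to \<open>b2\<close>, at the extra cost
    \<open>\<eta>\<close>.\<close>
  have concl: thesis if x: "x1 + x2 = s" "x1 * x2 = p" "cmod (b1 - x1) \<le> q" for x1 x2
  proof (rule roots[OF x(1,2)])
    show "cmod (x1 - b1) \<le> \<eta> + sqrt (\<eta> * (1 + R))"
      using x(3) \<eta> by (simp add: q_def norm_minus_commute)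
    have "x2 - b2 = (s - (b1 + b2)) + (b1 - x1)" using x(1) by (auto simp: algebra_simps)
    then have "cmod (x2 - b2) \<le> cmod (s - (b1 + b2)) + cmod (b1 - x1)"
      by (simp only: norm_triangle_ineq)
    then show "cmod (x2 - b2) \<le> \<eta> + sqrt (\<eta> * (1 + R))"
      using s x(3) by (simp add: q_def)
  qed
  obtain x1 x2 where x: "x1 + x2 = s" "x1 * x2 = p" by (rule quadratic_roots)
  have "(b1 - x1) * (b1 - x2) = (p - b1 * b2) - (s - (b1 + b2)) * b1"
    using x by (auto simp: algebra_simps)
  then have "cmod (b1 - x1) * cmod (b1 - x2) \<le> cmod (p - b1 * b2) + cmod (s - (b1 + b2)) * cmod b1"
    by (metis norm_mult norm_triangle_ineq4)
  also have "\<dots> \<le> \<eta> + \<eta> * R" using s p R \<eta> by (intro add_mono mult_mono) auto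
  finally have *: "cmod (b1 - x1) * cmod (b1 - x2) \<le> q\<^sup>2" by (simp add: q algebra_simps)
  show thesis
  proof (cases "cmod (b1 - x1) \<le> q")
    case True
    then show thesis using concl x by blast
  next
    case False
    have "cmod (b1 - x2) \<le> q"
    proof (rule ccontr)
      assume "\<not> cmod (b1 - x2) \<le> q"
      then have "q * q < cmod (b1 - x1) * cmod (b1 - x2)"
        using False q by (intro mult_strict_mono') auto
      then show False using * by (simp add: power2_eq_square)
    qed
    then show thesis using concl[of x2 x1] x by (simp add: add.commute mult.commute)
  qed
qed

section \<open>Comparison of the multipliers with the predicted exponentials\<close>

lemma norm_exp_minus_one_minus_le:
  fixes z :: complex
  assumes "cmod z \<le> 1"
  shows "cmod (exp z - 1 - z) \<le> 3 * (cmod z)\<^sup>2"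
proof -
  have "cmod (exp z - (\<Sum>i\<le>1. z ^ i / fact i)) \<le> exp (cmod z) * (cmod z ^ Suc 1) / fact 1"
    by (rule Taylor_exp_field)
  then have "cmod (exp z - 1 - z) \<le> exp (cmod z) * (cmod z)\<^sup>2"
    by (simp add: power2_eq_square algebra_simps)
  also have "\<dots> \<le> 3 * (cmod z)\<^sup>2"
    using assms exp_le order_trans[of "exp (cmod z)" "exp 1" 3] by (intro mult_right_mono) auto
  finally show ?thesis .
qed

lemma norm_exp_minus_one_le:
  fixes z :: complex
  assumes "cmod z \<le> 1 / 3"
  shows "cmod (exp z - 1) \<le> 2 * cmod z"
proof -
  have "cmod (exp z - 1) \<le> cmod (exp z - 1 - z) + cmod z"
    using norm_triangle_ineq[of "exp z - 1 - z" z] by simp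
  also have "cmod (exp z - 1 - z) \<le> 3 * (cmod z)\<^sup>2"
    by (rule norm_exp_minus_one_minus_le) (use assms in simp)
  also have "3 * (cmod z)\<^sup>2 \<le> 1 * cmod z"
    unfolding power2_eq_square mult.assoc[symmetric] using assms by (intro mult_right_mono) auto
  finally show ?thesis by simp
qed

text \<open>The block eigenvalues come as linear factors in \<open>1 / \<zeta>\<close>, while the
  prediction is an exponential. In the product the first-order terms combine to
  \<open>\<nu> - b\<close>; the second-order terms add up to \<open>1/4 + 3/4 + 3/4 = 7/4\<close>
  times \<open>\<beta>\<^sup>2\<close> over the square of \<open>cmod \<zeta>\<close>, rounded up to
  2.\<close>

lemma multiplier_factor_estimate:
  fixes b \<nu> \<zeta> :: complex
  assumes b: "cmod b \<le> \<beta>" and \<nu>: "cmod \<nu> \<le> \<beta>" and \<zeta>: "\<beta> \<le> cmod \<zeta>" "\<zeta> \<noteq> 0"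
  shows "cmod \<zeta> * cmod ((1 - \<i> * \<nu> / (2 * \<zeta>)) * exp (\<i> * b / (2 * \<zeta>)) - 1) \<le> cmod (\<nu> - b) / 2 + 2 * \<beta>\<^sup>2 / cmod \<zeta>"
proof -
  define h where "h = \<i> / (2 * \<zeta>)"
  have h: "cmod h = 1 / (2 * cmod \<zeta>)" by (simp add: h_def norm_divide norm_mult)
  have \<zeta>0: "0 < cmod \<zeta>" using \<zeta> by simp
  have \<beta>: "0 \<le> \<beta>" by (rule order_trans[OF norm_ge_zero b])
  define r where "r = exp (b * h) - 1 - b * h"
  have le: "cmod (x * h) \<le> \<beta> / (2 * cmod \<zeta>)" "cmod (x * h) \<le> 1" if "cmod x \<le> \<beta>" for x
  proof -
    show "cmod (x * h) \<le> \<beta> / (2 * cmod \<zeta>)"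
      unfolding norm_mult h using that \<zeta>0 by (simp add: divide_right_mono)
    also have "\<dots> \<le> 1" using \<zeta> \<zeta>0 \<beta> by (simp add: field_simps)
    finally show "cmod (x * h) \<le> 1" .
  qed
  have r: "cmod r \<le> 3 * (\<beta> / (2 * cmod \<zeta>))\<^sup>2"
  proof -
    have "cmod r \<le> 3 * (cmod (b * h))\<^sup>2"
      unfolding r_def by (rule norm_exp_minus_one_minus_le[OF le(2)[OF b]])
    also have "\<dots> \<le> 3 * (\<beta> / (2 * cmod \<zeta>))\<^sup>2"
      by (intro mult_left_mono power_mono le[OF b]) auto
    finally show ?thesis .
  qed
  have "(1 - \<i> * \<nu> / (2 * \<zeta>)) * exp (\<i> * b / (2 * \<zeta>)) - 1 = (1 - \<nu> * h) * (1 + b * h + r) - 1"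
    by (simp add: r_def h_def mult.commute)
  also have "\<dots> = - ((\<nu> - b) * h) - (\<nu> * h) * (b * h) + (r - (\<nu> * h) * r)"
    by (simp add: algebra_simps)
  also have "cmod \<dots> \<le> cmod ((\<nu> - b) * h) + cmod (\<nu> * h) * cmod (b * h) + (cmod r + cmod (\<nu> * h) * cmod r)"
    unfolding norm_mult[symmetric]
    by (intro order_trans[OF norm_triangle_ineq] add_mono order_trans[OF norm_triangle_ineq4]) simp_all
  also have "\<dots> \<le> cmod (\<nu> - b) / (2 * cmod \<zeta>) + (\<beta> / (2 * cmod \<zeta>)) * (\<beta> / (2 * cmod \<zeta>)) +
      (3 * (\<beta> / (2 * cmod \<zeta>))\<^sup>2 + 1 * (3 * (\<beta> / (2 * cmod \<zeta>))\<^sup>2))"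
  proof (intro add_mono)
    show "cmod ((\<nu> - b) * h) \<le> cmod (\<nu> - b) / (2 * cmod \<zeta>)" by (simp add: norm_mult h)
    show "cmod (\<nu> * h) * cmod (b * h) \<le> (\<beta> / (2 * cmod \<zeta>)) * (\<beta> / (2 * cmod \<zeta>))"
      by (intro mult_mono le b \<nu>) (use \<beta> in auto)
    show "cmod (\<nu> * h) * cmod r \<le> 1 * (3 * (\<beta> / (2 * cmod \<zeta>))\<^sup>2)"
      by (intro mult_mono le r \<nu>) auto
  qed (rule r)
  also have "\<dots> = cmod (\<nu> - b) / (2 * cmod \<zeta>) + 7 / 4 * \<beta>\<^sup>2 / (cmod \<zeta> * cmod \<zeta>)"
    by (simp add: power2_eq_square power_divide)
  finally have "cmod \<zeta> * cmod ((1 - \<i> * \<nu> / (2 * \<zeta>)) * exp (\<i> * b / (2 * \<zeta>)) - 1) \<le>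
      cmod \<zeta> * (cmod (\<nu> - b) / (2 * cmod \<zeta>) + 7 / 4 * \<beta>\<^sup>2 / (cmod \<zeta> * cmod \<zeta>))"
    by (rule mult_left_mono) simp
  also have "\<dots> = cmod (\<nu> - b) / 2 + 7 / 4 * \<beta>\<^sup>2 / cmod \<zeta>"
    using \<zeta>0 by (simp add: distrib_left)
  also have "\<dots> \<le> cmod (\<nu> - b) / 2 + 2 * \<beta>\<^sup>2 / cmod \<zeta>"
    by (intro add_left_mono divide_right_mono mult_right_mono) auto
  finally show ?thesis .
qed

definition lists_multipliers :: "(real \<Rightarrow> complex ^ 2) \<Rightarrow> complex \<Rightarrow> (nat \<Rightarrow> complex) \<Rightarrow> bool" where
  "lists_multipliers v \<zeta> t \<longleftrightarrow> (\<forall>z. det (mat z - monodromy v \<zeta>) = (\<Prod>j\<in>{1,2,3}. z - t j))"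

text \<open>The quotient of \<open>z\<close> by the exponential predicted for the label
  \<open>j\<close> with the o(1) dropped, written as a product with the inverse exponential.\<close>

definition ratio :: "(real \<Rightarrow> complex ^ 2) \<Rightarrow> complex \<Rightarrow> nat \<Rightarrow> complex \<Rightarrow> complex" where
  "ratio v \<zeta> j z = (if j = 3 then z * exp (\<i> * (\<zeta> - of_real (b_const v 3) / (2 * \<zeta>)))
     else z * exp (- \<i> * (\<zeta> - of_real (b_const v j) / (2 * \<zeta>))))"

text \<open>The weight \<open>cmod \<zeta>\<close> is the scale of the claim: an o(1) inside an
  exponent divided by \<open>2 * \<zeta>\<close> corresponds to a ratio that is 1 up to
  o(\<open>1 / \<zeta>\<close>).\<close>

definition labelling_error :: "(real \<Rightarrow> complex ^ 2) \<Rightarrow> complex \<Rightarrow> (nat \<Rightarrow> complex) \<Rightarrow> real" where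
  "labelling_error v \<zeta> t = (\<Sum>j\<in>{1,2,3}. cmod \<zeta> * cmod (ratio v \<zeta> j (t j) - 1))"

lemma labelling_error_nonneg: "0 \<le> labelling_error v \<zeta> t"
  unfolding labelling_error_def by (intro sum_nonneg) simp

lemma ratio_le_labelling_error:
  assumes "j \<in> {1,2,3}"
  shows "cmod \<zeta> * cmod (ratio v \<zeta> j (t j) - 1) \<le> labelling_error v \<zeta> t"
  unfolding labelling_error_def by (rule member_le_sum) (use assms in auto)

text \<open>A labelling must list the eigenvalues at every \<open>\<zeta>\<close>, also at small
  ones and near the excluded points, where the asymptotics say nothing. There any factorisation of
  the cubic characteristic polynomial serves.\<close>

lemma lists_multipliers_exists: "\<exists>t. lists_multipliers v \<zeta> t"
proof -
  define M where "M = monodromy v \<zeta>"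
  define a where "a = - (M $ 1 $ 1 + M $ 2 $ 2 + M $ 3 $ 3)"
  define b where "b = M $ 1 $ 1 * M $ 2 $ 2 + M $ 1 $ 1 * M $ 3 $ 3 + M $ 2 $ 2 * M $ 3 $ 3
    - M $ 1 $ 2 * M $ 2 $ 1 - M $ 1 $ 3 * M $ 3 $ 1 - M $ 2 $ 3 * M $ 3 $ 2"
  define c where "c = - det M"
  have det: "det (mat z - M) = c + z * (b + z * (a + z))" for z
    unfolding a_def b_def c_def det_3 by (simp add: mat_def) algebra
  obtain r where "poly [:c, b, a, 1:] r = 0"
    using fundamental_theorem_of_algebra_alt[of "[:c, b, a, 1:]"] by auto
  then have r: "c = - r * (b + r * (a + r))" by (simp add: eq_neg_iff_add_eq_0)
  obtain x1 x2 where x: "x1 + x2 = - (a + r)" "x1 * x2 = b + r * (a + r)"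
    by (rule quadratic_roots)
  have "det (mat z - M) = (z - r) * ((z - x1) * (z - x2))" for z
  proof -
    have "(z - x1) * (z - x2) = z * z - (x1 + x2) * z + x1 * x2" by (simp add: algebra_simps)
    then show ?thesis unfolding det x r by (simp add: algebra_simps)
  qed
  then have "lists_multipliers v \<zeta> (\<lambda>j. if j = 1 then r else if j = 2 then x1 else x2)"
    unfolding lists_multipliers_def M_def by (simp add: mult.assoc)
  then show ?thesis by blast
qed

lemma norm_gram_le:
  assumes a: "ac_bounded m a w" and b: "ac_bounded m b w'"
  shows "cmod (gram a b) \<le> m\<^sup>2"
proof -
  have "0 \<le> m" using a norm_ge_zero[of "a 0"] by (auto simp: ac_bounded_def simp del: norm_ge_zero intro: order_trans)
  have "cmod (gram a b) \<le> m * m * (1 - 0)"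
    unfolding gram_def
  proof (rule integral_bound)
    show "continuous_on {0..1} (\<lambda>x. a x * cnj (b x))"
      by (intro continuous_intros ac_bounded_continuous[OF a] ac_bounded_continuous[OF b])
    show "cmod (a t * cnj (b t)) \<le> m * m" if "t \<in> {0..1}" for t
      using a b that \<open>0 \<le> m\<close> unfolding norm_mult complex_mod_cnj ac_bounded_def by (intro mult_mono) auto
  qed simp
  then show ?thesis by (simp add: power2_eq_square)
qed

lemma gram_commute: "gram b a = cnj (gram a b)"
  unfolding gram_def by (simp add: integral_cnj mult.commute)

text \<open>\<open>b_o\<close> equals the squared trace minus four times the determinant of the 2 by
  2 Gram matrix, so the first two constants are its eigenvalues. They are compared through sum and
  product, which are smooth in the matrix entries. The last bound comes from
  \<open>b_o v \<le> 5 * (m\<^sup>2)\<^sup>2\<close>, rounded up to a perfect square.\<close>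

lemma b_const_gram:
  assumes v: "v \<in> L2_torus" and v1: "ac_bounded m v1 w1" and v2: "ac_bounded m v2 w2"
    and ae: "AE x in lborel. x \<in> {0..1} \<longrightarrow> v x $ 1 = v1 x \<and> v x $ 2 = v2 x"
  shows "of_real (b_const v 3) = gram v1 v1 + gram v2 v2"
    "of_real (b_const v 1 + b_const v 2) = gram v1 v1 + gram v2 v2"
    "of_real (b_const v 1 * b_const v 2) = gram v1 v1 * gram v2 v2 - gram v1 v2 * gram v2 v1"
    "(b_const v 1 - b_const v 2)\<^sup>2 = b_o v"
    "\<And>j. \<bar>b_const v j\<bar> \<le> 3 * m\<^sup>2"
proof -
  define A where "A = (LINT x:{0..1}|lborel. (cmod (v x $ 1))\<^sup>2)"
  define B where "B = (LINT x:{0..1}|lborel. (cmod (v x $ 2))\<^sup>2)"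
  have A: "of_real A = gram v1 v1"
    unfolding A_def by (rule gram_diag_eq[OF v]) (use ae in \<open>auto elim!: eventually_mono\<close>)
  have B: "of_real B = gram v2 v2"
    unfolding B_def by (rule gram_diag_eq[OF v]) (use ae in \<open>auto elim!: eventually_mono\<close>)
  have bo: "b_o v = (A - B)\<^sup>2 + 4 * (cmod (gram v1 v2))\<^sup>2"
    unfolding b_o_def A_def B_def using gram_eq[OF v ae] by simp
  have bo0: "0 \<le> b_o v" unfolding bo by simp
  have L: "(L2_norm v)\<^sup>2 = A + B" unfolding A_def B_def by (rule L2_norm_square_eq[OF v])
  define S where "S = sqrt (b_o v)"
  have S: "S * S = b_o v" "0 \<le> S" using bo0 by (simp_all add: S_def)
  have bc: "b_const v j = (if j = 1 then (A + B - S) / 2 else if j = 2 then (A + B + S) / 2 else A + B)" for j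
    by (simp add: b_const_def L S_def)
  show "of_real (b_const v 3) = gram v1 v1 + gram v2 v2"
    by (simp add: bc flip: A B)
  have "b_const v 1 + b_const v 2 = A + B" by (simp add: bc field_simps)
  then show "of_real (b_const v 1 + b_const v 2) = gram v1 v1 + gram v2 v2"
    by (simp flip: A B)
  have "b_const v 1 * b_const v 2 = ((A + B) * (A + B) - S * S) / 4"
    by (simp add: bc algebra_simps)
  also have "\<dots> = A * B - (cmod (gram v1 v2))\<^sup>2"
    unfolding S bo by (simp add: power2_eq_square field_simps)
  finally have "b_const v 1 * b_const v 2 = A * B - (cmod (gram v1 v2))\<^sup>2" .
  then have "of_real (b_const v 1 * b_const v 2) = complex_of_real (A * B) - (of_real (cmod (gram v1 v2)))\<^sup>2"
    by (simp only: of_real_diff of_real_power)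
  then show "of_real (b_const v 1 * b_const v 2) = gram v1 v1 * gram v2 v2 - gram v1 v2 * gram v2 v1"
    unfolding gram_commute[of v2 v1] complex_norm_square[symmetric] by (simp only: of_real_mult of_real_power A B)
  have "b_const v 1 - b_const v 2 = - S" by (simp add: bc field_simps)
  then show "(b_const v 1 - b_const v 2)\<^sup>2 = b_o v" using S by (simp add: power2_eq_square)
  have AB: "0 \<le> A" "A \<le> m\<^sup>2" "0 \<le> B" "B \<le> m\<^sup>2"
  proof -
    show "0 \<le> A" "0 \<le> B" unfolding A_def B_def set_lebesgue_integral_def
      by (rule Bochner_Integration.integral_nonneg; simp)+
    show "A \<le> m\<^sup>2" using norm_gram_le[OF v1 v1] unfolding A[symmetric] norm_of_real by simp
    show "B \<le> m\<^sup>2" using norm_gram_le[OF v2 v2] unfolding B[symmetric] norm_of_real by simp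
  qed
  have "S \<le> 3 * m\<^sup>2"
    unfolding S_def
  proof (rule real_le_lsqrt)
    have "\<bar>A - B\<bar> \<le> m\<^sup>2" using AB by linarith
    then have "(A - B)\<^sup>2 \<le> (m\<^sup>2)\<^sup>2" by (metis abs_le_square_iff abs_of_nonneg zero_le_power2)
    moreover have "(cmod (gram v1 v2))\<^sup>2 \<le> (m\<^sup>2)\<^sup>2"
      by (intro power_mono norm_gram_le[OF v1 v2]) simp
    ultimately have "b_o v \<le> 5 * (m\<^sup>2)\<^sup>2" unfolding bo by linarith
    also have "\<dots> \<le> 9 * (m\<^sup>2)\<^sup>2" by simp
    finally show "b_o v \<le> (3 * m\<^sup>2)\<^sup>2" by (simp add: power_mult_distrib)
  qed (use bo0 in auto)
  note AB = AB S(2) this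
  have "\<bar>(A + B - S) / 2\<bar> \<le> 3 * m\<^sup>2" using AB by (simp add: abs_le_iff field_simps)
  moreover have "\<bar>(A + B + S) / 2\<bar> \<le> 3 * m\<^sup>2" using AB by (simp add: abs_le_iff field_simps)
  moreover have "\<bar>A + B\<bar> \<le> 3 * m\<^sup>2" using AB by (simp add: abs_le_iff field_simps)
  ultimately show "\<bar>b_const v j\<bar> \<le> 3 * m\<^sup>2" for j
    unfolding bc by (simp only: simp_thms split: if_splits)
qed

section \<open>Labelling of the multipliers\<close>

text \<open>The order of quantifiers matters: \<open>K\<close> depends on \<open>\<delta>\<close>,
  \<open>R\<close> and \<open>\<epsilon>\<close> only. The list found here may depend on all of
  them; it will serve only as a competitor for the final choice.\<close>

lemma labelling_exists:
  assumes \<delta>: "0 < \<delta>" "\<delta> < 1 / 2" and \<epsilon>: "0 < \<epsilon>"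
  obtains K where "\<And>v w \<zeta>. has_L2_deriv v w \<Longrightarrow> L2_norm v \<le> R \<Longrightarrow> L2_norm w \<le> R \<Longrightarrow> K \<le> cmod \<zeta> \<Longrightarrow>
    \<forall>n::int. \<delta> \<le> cmod (\<zeta> - of_real (pi * of_int n)) \<Longrightarrow>
    \<exists>t. lists_multipliers v \<zeta> t \<and> labelling_error v \<zeta> t \<le> \<epsilon>"
proof -
  define m where "m = 2 + 2 * R\<^sup>2"
  define C where "C = 1 / \<delta>"
  define D where "D = 1650 * C\<^sup>2 * m^4"
  \<comment> \<open>Bounds both the constants \<open>b_j\<close> and the eigenvalues
    \<open>\<nu>\<close> that approximate them to within \<open>q x < 1\<close>.\<close>
  define \<beta> where "\<beta> = 3 * m\<^sup>2 + 1"
  \<comment> \<open>The determinant of \<open>n\<close> is a difference of two products, each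
    perturbed by at most \<open>2 * (m\<^sup>2 + 1) * (D / x)\<close>; the same number also covers
    the trace.\<close>
  define k where "k = 4 * (m\<^sup>2 + 1) * D"
  define q where "q x = k / x + sqrt (k / x * (1 + 3 * m\<^sup>2))" for x
  have m: "1 \<le> m" by (simp add: m_def)
  have C: "1 \<le> C" using \<delta> by (simp add: C_def)
  have inv: "((\<lambda>x. c / x) \<longlongrightarrow> 0) at_top" for c :: real
    by (intro tendsto_divide_0[OF tendsto_const] filterlim_at_top_imp_at_infinity filterlim_ident)
  have q: "(q \<longlongrightarrow> 0) at_top"
    unfolding q_def
    using tendsto_add[OF inv[of k] tendsto_real_sqrt[OF tendsto_mult[OF inv[of k] tendsto_const[of "1 + 3 * m\<^sup>2"]]]] by simp
  have "((\<lambda>x. D / x + q x + 4 * \<beta>\<^sup>2 / x) \<longlongrightarrow> 0 + 0 + 0) at_top"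
    by (intro tendsto_add inv q)
  then have 1: "\<forall>\<^sub>F x in at_top. D / x + q x + 4 * \<beta>\<^sup>2 / x < \<epsilon>"
    using \<epsilon> by (simp add: order_tendstoD)
  have 2: "\<forall>\<^sub>F x in at_top. q x < 1" using q by (simp add: order_tendstoD)
  have "\<forall>\<^sub>F x in at_top. D / x + q x + 4 * \<beta>\<^sup>2 / x < \<epsilon> \<and> q x < 1 \<and> 160 * C\<^sup>2 * m\<^sup>2 \<le> x \<and> D \<le> x \<and> \<beta> \<le> x \<and> 2 \<le> x"
    by (intro eventually_conj 1 2 eventually_ge_at_top)
  then obtain K where K: "\<And>x. K \<le> x \<Longrightarrow> D / x + q x + 4 * \<beta>\<^sup>2 / x < \<epsilon> \<and> q x < 1 \<and> 160 * C\<^sup>2 * m\<^sup>2 \<le> x \<and> D \<le> x \<and> \<beta> \<le> x \<and> 2 \<le> x"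
    unfolding eventually_at_top_linorder by blast
  show thesis
  proof (rule that)
    fix v w \<zeta>
    assume d: "has_L2_deriv v w" and R: "L2_norm v \<le> R" "L2_norm w \<le> R" and "K \<le> cmod \<zeta>"
      and away: "\<forall>n::int. \<delta> \<le> cmod (\<zeta> - of_real (pi * of_int n))"
    define x where "x = cmod \<zeta>"
    have x: "D / x + q x + 4 * \<beta>\<^sup>2 / x < \<epsilon>" "q x < 1" "160 * C\<^sup>2 * m\<^sup>2 \<le> cmod \<zeta>" "D \<le> x" "\<beta> \<le> cmod \<zeta>" "2 \<le> x"
      using K[OF \<open>K \<le> cmod \<zeta>\<close>] by (auto simp: x_def)
    then have \<zeta>nz: "\<zeta> \<noteq> 0" and x0: "0 < x" by (auto simp: x_def)
    obtain v1 v2 w1 w2 where v1: "ac_bounded m v1 w1" and v2: "ac_bounded m v2 w2"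
      and ae: "AE x in lborel. x \<in> {0..1} \<longrightarrow> v x $ 1 = v1 x \<and> v x $ 2 = v2 x"
      by (rule has_L2_deriv_ac_bounded[OF d R, folded m_def])
    have v: "v \<in> L2_torus" using d by (simp add: has_L2_deriv_def)
    have kernel: "max 1 (cmod (exp (2 * \<i> * \<zeta>))) \<le> C * cmod (1 - exp (2 * \<i> * \<zeta>))"
      unfolding C_def by (rule one_minus_exp_lower_bound[OF \<delta>]) (use away in auto)
    obtain P n11 n12 n21 n22 where
      det: "\<And>z. det (mat z - monodromy v \<zeta>) = (z - exp (- \<i> * (\<zeta> - P / (2 * \<zeta>)))) *
       ((z - exp (\<i> * \<zeta>) * (1 - \<i> * n11 / (2 * \<zeta>))) * (z - exp (\<i> * \<zeta>) * (1 - \<i> * n22 / (2 * \<zeta>))) -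
        exp (\<i> * \<zeta>) * (- \<i> * n12 / (2 * \<zeta>)) * (exp (\<i> * \<zeta>) * (- \<i> * n21 / (2 * \<zeta>))))"
      and P: "cmod (P - (gram v1 v1 + gram v2 v2)) \<le> D / x"
      and n: "cmod (n11 - gram v1 v1) \<le> D / x" "cmod (n12 - gram v1 v2) \<le> D / x"
        "cmod (n21 - gram v2 v1) \<le> D / x" "cmod (n22 - gram v2 v2) \<le> D / x"
      by (rule monodromy_char_poly_asymptotics[OF v1 v2 m ae kernel C x(3), folded D_def x_def]) (rule that)
    note b = b_const_gram[OF v v1 v2 ae]
    have D: "0 \<le> D" "0 \<le> D / x" "D / x \<le> 1" using x x0 C m by (auto simp: D_def)
    have kx: "k / x = 4 * (m\<^sup>2 + 1) * (D / x)" by (simp add: k_def)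
    have prod: "cmod (a' * c' - a * c) \<le> 2 * (m\<^sup>2 + 1) * (D / x)"
      if "cmod (a' - a) \<le> D / x" "cmod (c' - c) \<le> D / x" "cmod a \<le> m\<^sup>2" "cmod c \<le> m\<^sup>2" for a' a c' c
    proof -
      have "cmod c' \<le> cmod (c' - c) + cmod c" using norm_triangle_ineq[of "c' - c" c] by simp
      then have c': "cmod c' \<le> m\<^sup>2 + 1" using that D by linarith
      have "a' * c' - a * c = (a' - a) * c' + a * (c' - c)" by (simp add: algebra_simps)
      then have "cmod (a' * c' - a * c) \<le> cmod (a' - a) * cmod c' + cmod a * cmod (c' - c)"
        by (metis norm_mult norm_triangle_ineq)
      also have "\<dots> \<le> (D / x) * (m\<^sup>2 + 1) + (m\<^sup>2 + 1) * (D / x)"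
        using that c' D by (intro add_mono mult_mono) auto
      finally show ?thesis by (simp add: algebra_simps)
    qed
    have s: "cmod ((n11 + n22) - (of_real (b_const v 1) + of_real (b_const v 2))) \<le> k / x"
    proof -
      have eq: "(n11 + n22) - (of_real (b_const v 1) + of_real (b_const v 2)) = (n11 - gram v1 v1) + (n22 - gram v2 v2)"
        using b(2) by (simp add: algebra_simps)
      have "cmod ((n11 + n22) - (of_real (b_const v 1) + of_real (b_const v 2))) \<le> 2 * (D / x)"
        unfolding eq using norm_triangle_ineq[of "n11 - gram v1 v1" "n22 - gram v2 v2"] n by linarith
      also have "\<dots> \<le> k / x" unfolding kx using D by (intro mult_right_mono) auto
      finally show ?thesis .
    qed
    have p: "cmod ((n11 * n22 - n12 * n21) - of_real (b_const v 1) * of_real (b_const v 2)) \<le> k / x"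
    proof -
      have "(n11 * n22 - n12 * n21) - of_real (b_const v 1) * of_real (b_const v 2) =
        (n11 * n22 - gram v1 v1 * gram v2 v2) - (n12 * n21 - gram v1 v2 * gram v2 v1)"
        using b(3) by (simp add: algebra_simps)
      then have "cmod ((n11 * n22 - n12 * n21) - of_real (b_const v 1) * of_real (b_const v 2)) \<le>
          cmod (n11 * n22 - gram v1 v1 * gram v2 v2) + cmod (n12 * n21 - gram v1 v2 * gram v2 v1)"
        by (simp only: norm_triangle_ineq4)
      also have "\<dots> \<le> 2 * (m\<^sup>2 + 1) * (D / x) + 2 * (m\<^sup>2 + 1) * (D / x)"
        by (intro add_mono prod n norm_gram_le[OF v1 v1] norm_gram_le[OF v2 v2]
            norm_gram_le[OF v1 v2] norm_gram_le[OF v2 v1])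
      finally show ?thesis unfolding kx by (simp add: algebra_simps)
    qed
    have bb: "cmod (complex_of_real (b_const v j)) \<le> 3 * m\<^sup>2" for j
      using b(5)[of j] by simp
    obtain \<nu>1 \<nu>2 where \<nu>: "\<nu>1 + \<nu>2 = n11 + n22" "\<nu>1 * \<nu>2 = n11 * n22 - n12 * n21"
      and \<nu>1: "cmod (\<nu>1 - of_real (b_const v 1)) \<le> q x"
      and \<nu>2: "cmod (\<nu>2 - of_real (b_const v 2)) \<le> q x"
      unfolding q_def by (rule quadratic_roots_close[OF s p bb])
    define E where "E = exp (\<i> * \<zeta>)"
    define t where "t j = (if j = 1 then E * (1 - \<i> * \<nu>1 / (2 * \<zeta>)) else if j = 2 then E * (1 - \<i> * \<nu>2 / (2 * \<zeta>))
      else exp (- \<i> * (\<zeta> - P / (2 * \<zeta>))))" for j :: nat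
    have lists: "lists_multipliers v \<zeta> t"
      unfolding lists_multipliers_def
    proof
      fix z
      define h where "h = \<i> / (2 * \<zeta>)"
      \<comment> \<open>The quadratic factor depends on \<open>n\<close> only through its trace and
        determinant, so \<open>n\<close> may be replaced by the diagonal matrix of its eigenvalues
        \<open>\<nu>1\<close>, \<open>\<nu>2\<close>.\<close>
      have "(z - E * (1 - n11 * h)) * (z - E * (1 - n22 * h)) - E * (- n12 * h) * (E * (- n21 * h)) =
        (z - E) * (z - E) + (z - E) * E * h * (n11 + n22) + E * E * h * h * (n11 * n22 - n12 * n21)"
        by algebra
      also have "\<dots> = (z - E * (1 - \<nu>1 * h)) * (z - E * (1 - \<nu>2 * h))"
        unfolding \<nu>[symmetric] by algebra
      finally have "(z - E * (1 - \<i> * n11 / (2 * \<zeta>))) * (z - E * (1 - \<i> * n22 / (2 * \<zeta>))) -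
        E * (- \<i> * n12 / (2 * \<zeta>)) * (E * (- \<i> * n21 / (2 * \<zeta>))) =
        (z - E * (1 - \<i> * \<nu>1 / (2 * \<zeta>))) * (z - E * (1 - \<i> * \<nu>2 / (2 * \<zeta>)))"
        by (simp add: h_def mult.commute)
      then show "det (mat z - monodromy v \<zeta>) = (\<Prod>j\<in>{1,2,3}. z - t j)"
        unfolding det E_def[symmetric] by (simp add: t_def mult_ac)
    qed
    have err: "cmod \<zeta> * cmod (ratio v \<zeta> j (E * (1 - \<i> * \<nu> / (2 * \<zeta>))) - 1) \<le> q x / 2 + 2 * \<beta>\<^sup>2 / x"
      if \<nu>: "cmod (\<nu> - of_real (b_const v j)) \<le> q x" and j: "j \<noteq> 3" for \<nu> j
    proof -
      have "ratio v \<zeta> j (E * (1 - \<i> * \<nu> / (2 * \<zeta>))) =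
          (1 - \<i> * \<nu> / (2 * \<zeta>)) * (E * exp (- \<i> * (\<zeta> - of_real (b_const v j) / (2 * \<zeta>))))"
        using j by (simp add: ratio_def mult_ac)
      also have "E * exp (- \<i> * (\<zeta> - of_real (b_const v j) / (2 * \<zeta>))) = exp (\<i> * of_real (b_const v j) / (2 * \<zeta>))"
        unfolding E_def exp_add[symmetric] by (simp add: algebra_simps)
      finally have eq: "ratio v \<zeta> j (E * (1 - \<i> * \<nu> / (2 * \<zeta>))) = (1 - \<i> * \<nu> / (2 * \<zeta>)) * exp (\<i> * of_real (b_const v j) / (2 * \<zeta>))" .
      have "cmod \<nu> \<le> cmod (\<nu> - of_real (b_const v j)) + cmod (complex_of_real (b_const v j))"
        using norm_triangle_ineq[of "\<nu> - of_real (b_const v j)" "of_real (b_const v j)"] by simp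
      then have "cmod \<nu> \<le> \<beta>" using \<nu> x(2) bb[of j] unfolding \<beta>_def by linarith
      moreover have "cmod (complex_of_real (b_const v j)) \<le> \<beta>" using bb[of j] unfolding \<beta>_def by linarith
      ultimately have "cmod \<zeta> * cmod (ratio v \<zeta> j (E * (1 - \<i> * \<nu> / (2 * \<zeta>))) - 1) \<le>
          cmod (\<nu> - of_real (b_const v j)) / 2 + 2 * \<beta>\<^sup>2 / cmod \<zeta>"
        unfolding eq by (intro multiplier_factor_estimate x(5) \<zeta>nz)
      also have "\<dots> \<le> q x / 2 + 2 * \<beta>\<^sup>2 / x" using \<nu> by (simp add: x_def)
      finally show ?thesis .
    qed
    have err3: "cmod \<zeta> * cmod (ratio v \<zeta> 3 (exp (- \<i> * (\<zeta> - P / (2 * \<zeta>)))) - 1) \<le> D / x"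
    proof -
      define y where "y = \<i> * (P - of_real (b_const v 3)) / (2 * \<zeta>)"
      have Pb: "cmod (P - of_real (b_const v 3)) \<le> D / x" using P b(1) by simp
      have y: "cmod y = cmod (P - of_real (b_const v 3)) / (2 * x)"
        by (simp add: y_def norm_divide norm_mult x_def)
      have "ratio v \<zeta> 3 (exp (- \<i> * (\<zeta> - P / (2 * \<zeta>)))) = exp y"
        unfolding ratio_def y_def by (simp add: algebra_simps diff_divide_distrib flip: exp_add)
      moreover have "cmod y \<le> 1 / 3"
      proof -
        have "cmod (P - of_real (b_const v 3)) \<le> 1" using Pb D(3) by linarith
        then have "cmod y \<le> 1 / (2 * 2)"
          unfolding y by (intro frac_le) (use x(6) in auto)
        then show ?thesis by simp
      qed
      then have "cmod (exp y - 1) \<le> 2 * cmod y" by (rule norm_exp_minus_one_le)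
      ultimately have "cmod \<zeta> * cmod (ratio v \<zeta> 3 (exp (- \<i> * (\<zeta> - P / (2 * \<zeta>)))) - 1) \<le> cmod \<zeta> * (2 * cmod y)"
        by (simp add: mult_left_mono)
      also have "\<dots> = cmod (P - of_real (b_const v 3))" unfolding y using x0 by (simp add: x_def)
      finally show ?thesis using Pb by simp
    qed
    have "labelling_error v \<zeta> t \<le> (q x / 2 + 2 * \<beta>\<^sup>2 / x) + ((q x / 2 + 2 * \<beta>\<^sup>2 / x) + D / x)"
      unfolding labelling_error_def using err[OF \<nu>1] err[OF \<nu>2] err3 by (simp add: t_def)
    also have "\<dots> = D / x + q x + 4 * \<beta>\<^sup>2 / x" by (simp add: field_simps)
    finally show "\<exists>t. lists_multipliers v \<zeta> t \<and> labelling_error v \<zeta> t \<le> \<epsilon>"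
      using lists x(1) by (intro exI[of _ t]) auto
  qed
qed

text \<open>The first two multipliers have the same leading term, so at each \<open>\<zeta>\<close> the labelling is
  chosen to minimise the second-order error up to a vanishing amount. The choice refers neither to
  \<open>\<delta>\<close> nor to a bounded set of potentials.\<close>

definition multiplier_choice :: "(real \<Rightarrow> complex ^ 2) \<Rightarrow> nat \<Rightarrow> complex \<Rightarrow> complex" where
  "multiplier_choice v j \<zeta> = (SOME t. lists_multipliers v \<zeta> t \<and>
     (\<forall>t'. lists_multipliers v \<zeta> t' \<longrightarrow> labelling_error v \<zeta> t \<le> labelling_error v \<zeta> t' + 1 / (1 + cmod \<zeta>))) j"

text \<open>Asking for a near-minimiser makes existence a matter of the infimum of a nonempty set
  bounded below. The slack is positive at every \<open>\<zeta>\<close>, including 0, and vanishes at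
  infinity.\<close>

lemma multiplier_choice:
  "lists_multipliers v \<zeta> (\<lambda>j. multiplier_choice v j \<zeta>)"
  "lists_multipliers v \<zeta> t \<Longrightarrow>
     labelling_error v \<zeta> (\<lambda>j. multiplier_choice v j \<zeta>) \<le> labelling_error v \<zeta> t + 1 / (1 + cmod \<zeta>)"
proof -
  define X where "X = labelling_error v \<zeta> ` {t. lists_multipliers v \<zeta> t}"
  have "X \<noteq> {}" using lists_multipliers_exists by (auto simp: X_def)
  moreover have "Inf X < Inf X + 1 / (1 + cmod \<zeta>)"
    by (simp add: add_pos_nonneg)
  ultimately obtain e where "e \<in> X" "e < Inf X + 1 / (1 + cmod \<zeta>)" using cInf_lessD by blast
  then obtain t where t: "lists_multipliers v \<zeta> t" "labelling_error v \<zeta> t < Inf X + 1 / (1 + cmod \<zeta>)"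
    by (auto simp: X_def)
  have "bdd_below X" unfolding X_def by (rule bdd_belowI2[of _ 0]) (rule labelling_error_nonneg)
  then have "Inf X \<le> labelling_error v \<zeta> t'" if "lists_multipliers v \<zeta> t'" for t'
    using that by (intro cInf_lower) (auto simp: X_def)
  then have "\<exists>t. lists_multipliers v \<zeta> t \<and>
     (\<forall>t'. lists_multipliers v \<zeta> t' \<longrightarrow> labelling_error v \<zeta> t \<le> labelling_error v \<zeta> t' + 1 / (1 + cmod \<zeta>))"
    using t by (intro exI[of _ t]) fastforce
  from someI_ex[OF this, folded multiplier_choice_def]
  show "lists_multipliers v \<zeta> (\<lambda>j. multiplier_choice v j \<zeta>)"
    "lists_multipliers v \<zeta> t \<Longrightarrow>
     labelling_error v \<zeta> (\<lambda>j. multiplier_choice v j \<zeta>) \<le> labelling_error v \<zeta> t + 1 / (1 + cmod \<zeta>)" for t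
    unfolding multiplier_choice_def by blast+
qed

lemma eventually_away_at_infinity:
  "eventually P (away_at_infinity \<delta>) \<longleftrightarrow>
     (\<exists>K. \<forall>\<zeta>. K \<le> cmod \<zeta> \<longrightarrow> (\<forall>n::int. \<delta> \<le> cmod (\<zeta> - of_real (pi * of_int n))) \<longrightarrow> P \<zeta>)"
  unfolding away_at_infinity_def eventually_inf_principal eventually_at_infinity by auto

lemma eventually_ge_away_at_infinity: "\<forall>\<^sub>F \<zeta> in away_at_infinity \<delta>. K \<le> cmod \<zeta>"
  unfolding eventually_away_at_infinity by auto

text \<open>The list from \<open>labelling_exists\<close>, which depends on \<open>\<delta>\<close>
  and on the bounded set, is compared with the choice, which does not; near-minimality transfers the
  bound. One half of \<open>\<epsilon>\<close> pays for the list, the other for the slack.\<close>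

lemma eventually_labelling_error_small:
  assumes \<delta>: "0 < \<delta>" "\<delta> < 1 / 2" and \<epsilon>: "0 < \<epsilon>" and B: "H1_bounded B"
  shows "\<forall>\<^sub>F \<zeta> in away_at_infinity \<delta>. \<forall>v\<in>B. labelling_error v \<zeta> (\<lambda>j. multiplier_choice v j \<zeta>) \<le> \<epsilon>"
proof -
  obtain R where R: "\<And>v. v \<in> B \<Longrightarrow> \<exists>w. has_L2_deriv v w \<and> L2_norm v \<le> R \<and> L2_norm w \<le> R"
    using B unfolding H1_bounded_def by blast
  have \<epsilon>2: "0 < \<epsilon> / 2" using \<epsilon> by simp
  obtain K where K: "\<And>v w \<zeta>. has_L2_deriv v w \<Longrightarrow> L2_norm v \<le> R \<Longrightarrow> L2_norm w \<le> R \<Longrightarrow> K \<le> cmod \<zeta> \<Longrightarrow>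
    \<forall>n::int. \<delta> \<le> cmod (\<zeta> - of_real (pi * of_int n)) \<Longrightarrow>
    \<exists>t. lists_multipliers v \<zeta> t \<and> labelling_error v \<zeta> t \<le> \<epsilon> / 2"
    using labelling_exists[OF \<delta> \<epsilon>2, of R] by blast
  show ?thesis
    unfolding eventually_away_at_infinity
  proof (intro exI allI impI ballI)
    fix \<zeta> v
    assume \<zeta>: "max K (2 / \<epsilon>) \<le> cmod \<zeta>" "\<forall>n::int. \<delta> \<le> cmod (\<zeta> - of_real (pi * of_int n))" and v: "v \<in> B"
    obtain w where "has_L2_deriv v w" "L2_norm v \<le> R" "L2_norm w \<le> R" using R[OF v] by blast
    then obtain t where t: "lists_multipliers v \<zeta> t" "labelling_error v \<zeta> t \<le> \<epsilon> / 2"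
      using K \<zeta> by fastforce
    have "1 / (1 + cmod \<zeta>) \<le> 1 / (2 / \<epsilon>)"
      using \<zeta>(1) \<epsilon> by (intro divide_left_mono) (auto simp: add_pos_nonneg intro!: mult_pos_pos divide_pos_pos)
    then show "labelling_error v \<zeta> (\<lambda>j. multiplier_choice v j \<zeta>) \<le> \<epsilon>"
      using multiplier_choice(2)[OF t(1)] t(2) by simp
  qed
qed

lemma b_const_bounded:
  assumes "H1_bounded B"
  obtains \<beta> where "1 \<le> \<beta>" "\<And>v j. v \<in> B \<Longrightarrow> \<bar>b_const v j\<bar> \<le> \<beta>" "\<And>v. v \<in> B \<Longrightarrow> (b_const v 1 - b_const v 2)\<^sup>2 = b_o v"
proof -
  obtain R where R: "\<And>v. v \<in> B \<Longrightarrow> \<exists>w. has_L2_deriv v w \<and> L2_norm v \<le> R \<and> L2_norm w \<le> R"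
    using assms unfolding H1_bounded_def by blast
  have "(\<forall>j. \<bar>b_const v j\<bar> \<le> 3 * (2 + 2 * R\<^sup>2)\<^sup>2) \<and> (b_const v 1 - b_const v 2)\<^sup>2 = b_o v" if "v \<in> B" for v
  proof -
    obtain w where d: "has_L2_deriv v w" and n: "L2_norm v \<le> R" "L2_norm w \<le> R" using R \<open>v \<in> B\<close> by blast
    obtain v1 v2 w1 w2 where v1: "ac_bounded (2 + 2 * R\<^sup>2) v1 w1" and v2: "ac_bounded (2 + 2 * R\<^sup>2) v2 w2"
      and ae: "AE x in lborel. x \<in> {0..1} \<longrightarrow> v x $ 1 = v1 x \<and> v x $ 2 = v2 x"
      by (rule has_L2_deriv_ac_bounded[OF d n])
    show ?thesis
      using b_const_gram(4,5)[OF _ v1 v2 ae] d by (simp add: has_L2_deriv_def)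
  qed
  note * = this
  show thesis
  proof (rule that)
    show "1 \<le> 1 + 3 * (2 + 2 * R\<^sup>2)\<^sup>2" by simp
    show "\<bar>b_const v j\<bar> \<le> 1 + 3 * (2 + 2 * R\<^sup>2)\<^sup>2" if "v \<in> B" for v j
      by (rule order_trans[OF *[OF that, THEN conjunct1, THEN spec]]) simp
    show "(b_const v 1 - b_const v 2)\<^sup>2 = b_o v" if "v \<in> B" for v
      by (rule *[OF that, THEN conjunct2])
  qed
qed

text \<open>The refined estimate contains the labelling convention: a single potential is a bounded
  set, so its ratios tend to 1.\<close>

lemma is_multiplier_labelling_choice:
  assumes d: "has_L2_deriv v w"
  shows "is_multiplier_labelling v (multiplier_choice v)"
  unfolding is_multiplier_labelling_def
proof (intro conjI allI ballI)
  show "det (mat z - monodromy v \<zeta>) = (\<Prod>j\<in>{1,2,3}. z - multiplier_choice v j \<zeta>)" for \<zeta> z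
    using multiplier_choice(1)[of v \<zeta>] by (simp add: lists_multipliers_def)
  fix \<delta> :: real and j :: nat assume \<delta>: "\<delta> \<in> {0<..<1/2}" and j: "j \<in> {1,2,3}"
  have B: "H1_bounded {v}"
    unfolding H1_bounded_def using d by (intro exI[of _ "max (L2_norm v) (L2_norm w)"]) auto
  define F where "F = away_at_infinity \<delta>"
  define \<sigma> where "\<sigma> = (if j = 3 then \<i> else - \<i>) * of_real (b_const v j)"
  \<comment> \<open>Normalising by the free exponential instead of the refined one costs only a
    factor whose exponent is O(\<open>1 / \<zeta>\<close>).\<close>
  have rat: "multiplier_choice v j \<zeta> / free_multiplier j \<zeta> =
      ratio v \<zeta> j (multiplier_choice v j \<zeta>) * exp (\<sigma> / (2 * \<zeta>))" for \<zeta>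
  proof -
    define c where "c = of_real (b_const v j) / (2 * \<zeta>)"
    define s where "s = (if j = 3 then \<i> else - \<i>)"
    have "free_multiplier j \<zeta> = exp (- (s * \<zeta>))"
      by (simp add: free_multiplier_def s_def)
    then have "z / free_multiplier j \<zeta> = z * exp (s * \<zeta>)" for z
      by (simp only: exp_minus divide_inverse inverse_inverse_eq)
    moreover have "exp (s * (\<zeta> - c)) * exp (s * c) = exp (s * \<zeta>)"
      by (simp add: right_diff_distrib flip: exp_add)
    moreover have "ratio v \<zeta> j z = z * exp (s * (\<zeta> - c))" for z
      by (simp add: ratio_def s_def c_def)
    moreover have "\<sigma> / (2 * \<zeta>) = s * c" by (simp add: \<sigma>_def s_def c_def)
    ultimately show ?thesis by (simp only: mult.assoc)
  qed
  have inf: "filterlim (\<lambda>\<zeta>. \<zeta>) at_infinity F"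
    unfolding F_def away_at_infinity_def by (rule filterlim_mono[OF filterlim_ident]) auto
  have "((\<lambda>\<zeta>. exp (\<sigma> / (2 * \<zeta>))) \<longlongrightarrow> exp 0) F"
    by (intro tendsto_exp tendsto_divide_0[OF tendsto_const] tendsto_mult_filterlim_at_infinity[OF tendsto_const] inf) simp
  moreover have "((\<lambda>\<zeta>. ratio v \<zeta> j (multiplier_choice v j \<zeta>)) \<longlongrightarrow> 1) F"
  proof (rule tendstoI)
    fix e :: real assume e: "0 < e"
    have "\<forall>\<^sub>F \<zeta> in F. \<forall>u\<in>{v}. labelling_error u \<zeta> (\<lambda>j. multiplier_choice u j \<zeta>) \<le> e / 2"
      unfolding F_def by (rule eventually_labelling_error_small[OF _ _ _ B]) (use \<delta> e in auto)
    moreover have "\<forall>\<^sub>F \<zeta> in F. 1 \<le> cmod \<zeta>"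
      unfolding F_def by (rule eventually_ge_away_at_infinity)
    ultimately show "\<forall>\<^sub>F \<zeta> in F. dist (ratio v \<zeta> j (multiplier_choice v j \<zeta>)) 1 < e"
    proof eventually_elim
      case (elim \<zeta>)
      have "1 * cmod (ratio v \<zeta> j (multiplier_choice v j \<zeta>) - 1) \<le>
          cmod \<zeta> * cmod (ratio v \<zeta> j (multiplier_choice v j \<zeta>) - 1)"
        using elim by (intro mult_right_mono) auto
      also have "\<dots> \<le> e / 2"
        using ratio_le_labelling_error[OF j, of \<zeta> v "\<lambda>j. multiplier_choice v j \<zeta>"] elim by auto
      finally show ?case using e by (simp add: dist_norm)
    qed
  qed
  ultimately have "((\<lambda>\<zeta>. ratio v \<zeta> j (multiplier_choice v j \<zeta>) * exp (\<sigma> / (2 * \<zeta>))) \<longlongrightarrow> 1 * exp 0) F"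
    by (intro tendsto_mult)
  then show "((\<lambda>\<zeta>. multiplier_choice v j \<zeta> / free_multiplier j \<zeta>) \<longlongrightarrow> 1) (away_at_infinity \<delta>)"
    by (simp add: rat F_def)
qed

section \<open>The squared gap of the first two multipliers and the discriminant\<close>

text \<open>Taking out \<open>exp (\<i> * (a - b) / 2)\<close> leaves \<open>2 * \<i>\<close> times
  a sine. This is the source of the sines in the discriminant, evaluated at the average of the two
  exponents.\<close>

lemma exp_difference_square:
  fixes a b :: complex
  shows "(exp (\<i> * a) - exp (- \<i> * b))\<^sup>2 = - 4 * exp (\<i> * (a - b)) * (sin ((a + b) / 2))\<^sup>2"
proof -
  define p where "p = exp (\<i> * a / 2)"
  define q where "q = exp (\<i> * b / 2)"
  have p: "exp (\<i> * a) = p * p" and q: "exp (\<i> * b) = q * q"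
    by (simp_all add: p_def q_def flip: exp_add)
  have nz: "p \<noteq> 0" "q \<noteq> 0" by (simp_all add: p_def q_def)
  have "exp (\<i> * ((a + b) / 2)) = p * q"
    by (simp add: p_def q_def algebra_simps add_divide_distrib flip: exp_add)
  then have s: "sin ((a + b) / 2) = (p * q - inverse (p * q)) / (2 * \<i>)"
    by (simp add: sin_exp_eq exp_minus)
  have d: "exp (\<i> * (a - b)) = p * p * inverse (q * q)"
    by (simp add: right_diff_distrib exp_diff p q divide_inverse)
  have q': "exp (- \<i> * b) = inverse (q * q)" by (simp add: exp_minus q)
  show ?thesis
    unfolding s d p q' using nz by (simp add: field_simps power2_eq_square)
qed

text \<open>The expression on the left is what the discriminant leaves as the factor in front of the
  sines. It tends to the squared gap \<open>(b1 - b2)\<^sup>2\<close>, with a bound that does not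
  deteriorate when \<open>b1\<close> and \<open>b2\<close> approach each other.\<close>

lemma gap_estimate:
  fixes b1 b2 b3 :: real and r1 r2 r3 \<zeta> :: complex
  assumes \<beta>: "1 \<le> \<beta>" and b: "\<bar>b1\<bar> \<le> \<beta>" "\<bar>b2\<bar> \<le> \<beta>" "\<bar>b3\<bar> \<le> \<beta>"
    and r: "cmod r1 \<le> \<epsilon>" "cmod r2 \<le> \<epsilon>" "cmod r3 \<le> \<epsilon>" "\<epsilon> \<le> 1" and \<zeta>: "16 * (\<beta> + 1) \<le> cmod \<zeta>"
  defines "\<gamma> \<equiv> 2 * (\<beta> + 1)"
  shows "cmod (- (2 * \<zeta>)\<^sup>2 * (exp (- \<i> * (of_real b1 + r1) / (2 * \<zeta>)) - exp (- \<i> * (of_real b2 + r2) / (2 * \<zeta>)))\<^sup>2 *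
      exp (\<i> * ((of_real b3 + r3) - (of_real b1 + r1)) / (2 * \<zeta>) + \<i> * ((of_real b3 + r3) - (of_real b2 + r2)) / (2 * \<zeta>))
      - of_real ((b1 - b2)\<^sup>2)) \<le> 6 * \<gamma> * \<epsilon> + 17 * \<gamma>^3 / cmod \<zeta>"
proof -
  define x where "x = cmod \<zeta>"
  define B1 where "B1 = of_real b1 + r1"
  define B2 where "B2 = of_real b2 + r2"
  define B3 where "B3 = of_real b3 + r3"
  have \<epsilon>0: "0 \<le> \<epsilon>" by (rule order_trans[OF norm_ge_zero r(1)])
  have B: "cmod B1 \<le> \<beta> + 1" "cmod B2 \<le> \<beta> + 1" "cmod B3 \<le> \<beta> + 1"
    unfolding B1_def B2_def B3_def using b r
    by (auto intro!: order_trans[OF norm_triangle_ineq] add_mono)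
  have \<gamma>: "4 \<le> \<gamma>" "8 * \<gamma> \<le> x" "0 < x" using \<beta> \<zeta> by (auto simp: \<gamma>_def x_def)
  have \<zeta>nz: "\<zeta> \<noteq> 0" using \<gamma> by (auto simp: x_def)
  have diff: "cmod (B1 - B2) \<le> \<gamma>"
    using norm_triangle_ineq4[of B1 B2] B by (simp add: \<gamma>_def)
  define w where "w = - \<i> * (B1 - B2) / (2 * \<zeta>)"
  \<comment> \<open>The rescaled gap: \<open>B1 - B2\<close> to first order. Its factor
    \<open>2 * \<i> * \<zeta>\<close> absorbs both the factor \<open>(2 * \<zeta>)\<^sup>2\<close>
    and the minus sign of the expression once squared.\<close>
  define g where "g = 2 * \<i> * \<zeta> * (exp w - 1)"
  \<comment> \<open>Collects every remaining exponential: the common factor taken out of the gap,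
    squared, and the two factors left over from the sines. The coefficients
    \<open>2 * B3 - B1 - 3 * B2\<close> give the bound \<open>3 * \<gamma>\<close>.\<close>
  define y where "y = - 2 * \<i> * B2 / (2 * \<zeta>) + (\<i> * (B3 - B1) / (2 * \<zeta>) + \<i> * (B3 - B2) / (2 * \<zeta>))"
  have w: "cmod w \<le> \<gamma> / (2 * x)"
    unfolding w_def norm_divide norm_mult x_def using diff by (simp add: divide_right_mono)
  also have "\<dots> \<le> 1" using \<gamma> by (simp add: field_simps)
  finally have w1: "cmod w \<le> 1" .
  have g: "cmod (g - (B1 - B2)) \<le> 3 * \<gamma>\<^sup>2 / (2 * x)"
  proof -
    have "B1 - B2 = 2 * \<i> * \<zeta> * w" using \<zeta>nz by (simp add: w_def)
    then have "g - (B1 - B2) = 2 * \<i> * \<zeta> * (exp w - 1 - w)"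
      by (simp only: g_def) (simp add: algebra_simps)
    then have "cmod (g - (B1 - B2)) = 2 * x * cmod (exp w - 1 - w)" by (simp add: norm_mult x_def)
    also have "\<dots> \<le> 2 * x * (3 * (\<gamma> / (2 * x))\<^sup>2)"
      using norm_exp_minus_one_minus_le[OF w1] power_mono[OF w norm_ge_zero, of 2] \<gamma>(3)
      by (intro mult_left_mono) auto
    also have "\<dots> = 3 * \<gamma>\<^sup>2 / (2 * x)" using \<gamma>(3) by (simp add: power2_eq_square)
    finally show ?thesis .
  qed
  have small: "3 * \<gamma>\<^sup>2 / (2 * x) \<le> \<gamma>"
  proof -
    have "3 * \<gamma>\<^sup>2 / (2 * x) \<le> 3 * \<gamma>\<^sup>2 / (2 * (8 * \<gamma>))" using \<gamma> by (intro divide_left_mono) auto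
    also have "\<dots> \<le> \<gamma>" using \<gamma> by (simp add: power2_eq_square)
    finally show ?thesis .
  qed
  have g2: "cmod g \<le> 2 * \<gamma>"
    using norm_triangle_ineq[of "g - (B1 - B2)" "B1 - B2"] g small diff by simp
  define c where "c = complex_of_real (b1 - b2)"
  have c: "cmod c \<le> \<gamma>"
    unfolding c_def norm_of_real \<gamma>_def using b \<beta> by (auto simp: abs_le_iff)
  have gc: "cmod (g - c) \<le> 2 * \<epsilon> + 3 * \<gamma>\<^sup>2 / (2 * x)"
  proof -
    have "g - c = (g - (B1 - B2)) + (r1 - r2)" by (simp add: c_def B1_def B2_def)
    then have "cmod (g - c) \<le> cmod (g - (B1 - B2)) + cmod (r1 - r2)" by (simp only: norm_triangle_ineq)
    then show ?thesis using g norm_triangle_ineq4[of r1 r2] r by linarith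
  qed
  have y: "cmod y \<le> 3 / 2 * \<gamma> / x"
  proof -
    have "y = \<i> * (2 * B3 - B1 - 3 * B2) / (2 * \<zeta>)"
      by (simp add: y_def algebra_simps add_divide_distrib diff_divide_distrib)
    then have "cmod y = cmod (2 * B3 - B1 - 3 * B2) / (2 * x)"
      by (simp add: norm_divide norm_mult x_def)
    also have "\<dots> \<le> (3 * \<gamma>) / (2 * x)"
    proof (rule divide_right_mono)
      have "cmod (2 * B3 - B1 - 3 * B2) \<le> cmod (2 * B3) + cmod B1 + cmod (3 * B2)"
        using norm_triangle_ineq4[of "2 * B3 - B1" "3 * B2"] norm_triangle_ineq4[of "2 * B3" B1] by linarith
      then show "cmod (2 * B3 - B1 - 3 * B2) \<le> 3 * \<gamma>"
        using B by (simp add: norm_mult \<gamma>_def)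
    qed (use \<gamma> in auto)
    finally show ?thesis by simp
  qed
  have ey: "cmod (exp y - 1) \<le> 3 * \<gamma> / x"
  proof -
    have "3 / 2 * \<gamma> / x \<le> 3 / 2 * \<gamma> / (8 * \<gamma>)" using \<gamma> by (intro divide_left_mono) auto
    then have "cmod y \<le> 1 / 3" using y \<gamma> by simp
    then have "cmod (exp y - 1) \<le> 2 * cmod y" by (rule norm_exp_minus_one_le)
    then show ?thesis using y by simp
  qed
  have e12: "exp (- \<i> * B1 / (2 * \<zeta>)) - exp (- \<i> * B2 / (2 * \<zeta>)) = exp (- \<i> * B2 / (2 * \<zeta>)) * (exp w - 1)"
    by (simp add: w_def algebra_simps diff_divide_distrib add_divide_distrib flip: exp_add)
  have X: "- (2 * \<zeta>)\<^sup>2 * (exp (- \<i> * B1 / (2 * \<zeta>)) - exp (- \<i> * B2 / (2 * \<zeta>)))\<^sup>2 *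
      exp (\<i> * (B3 - B1) / (2 * \<zeta>) + \<i> * (B3 - B2) / (2 * \<zeta>)) = g\<^sup>2 * exp y"
  proof -
    have "exp y = (exp (- \<i> * B2 / (2 * \<zeta>)))\<^sup>2 * exp (\<i> * (B3 - B1) / (2 * \<zeta>) + \<i> * (B3 - B2) / (2 * \<zeta>))"
      unfolding y_def power2_eq_square exp_add[symmetric] by (simp add: algebra_simps)
    moreover have "- (2 * \<zeta>)\<^sup>2 * (Q * W)\<^sup>2 * E = (2 * \<i> * \<zeta> * W)\<^sup>2 * (Q\<^sup>2 * E)" for Q W E
      by (simp add: power_mult_distrib)
    ultimately show ?thesis by (simp only: e12 g_def)
  qed
  have "g\<^sup>2 * exp y - c\<^sup>2 = (g - c) * (g + c) + g\<^sup>2 * (exp y - 1)"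
    by (simp add: power2_eq_square algebra_simps)
  then have "cmod (g\<^sup>2 * exp y - c\<^sup>2) \<le> cmod (g - c) * cmod (g + c) + (cmod g)\<^sup>2 * cmod (exp y - 1)"
    by (metis norm_triangle_ineq norm_mult norm_power)
  \<comment> \<open>The terms of order \<open>1 / x\<close> sum to
    \<open>(9/2 + 12) * \<gamma>^3\<close>, whence the constant 17.\<close>
  also have "\<dots> \<le> (2 * \<epsilon> + 3 * \<gamma>\<^sup>2 / (2 * x)) * (3 * \<gamma>) + (2 * \<gamma>)\<^sup>2 * (3 * \<gamma> / x)"
  proof (intro add_mono mult_mono gc ey power_mono g2)
    show "cmod (g + c) \<le> 3 * \<gamma>" using norm_triangle_ineq[of g c] g2 c by linarith
  qed (use \<epsilon>0 \<gamma> in auto)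
  also have "\<dots> \<le> 6 * \<gamma> * \<epsilon> + 17 * \<gamma>^3 / x"
    using \<gamma> by (simp add: field_simps power2_eq_square power3_eq_cube)
  finally show ?thesis
    unfolding B1_def[symmetric] B2_def[symmetric] B3_def[symmetric] X
    by (simp add: c_def x_def)
qed

lemma lyapunov_exp [simp]: "lyapunov (exp (\<i> * z)) = cos z" "lyapunov (exp (- \<i> * z)) = cos z"
  by (simp_all add: lyapunov_def cos_exp_eq add.commute flip: exp_minus)

text \<open>Solving the claimed formula for its remainder: writing the ratio as the exponential of
  its principal logarithm moves the whole error into the exponent with no approximation. The signs
  differ because the third multiplier carries \<open>- \<i> * \<zeta>\<close>.\<close>

lemma multiplier_eq_exp_Ln_ratio:
  assumes "ratio v \<zeta> j z \<noteq> 0" "\<zeta> \<noteq> 0"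
  shows "j = 3 \<Longrightarrow> z = exp (- \<i> * (\<zeta> - (of_real (b_const v j) + (- 2 * \<i> * \<zeta> * Ln (ratio v \<zeta> j z))) / (2 * \<zeta>)))"
    and "j \<noteq> 3 \<Longrightarrow> z = exp (\<i> * (\<zeta> - (of_real (b_const v j) + 2 * \<i> * \<zeta> * Ln (ratio v \<zeta> j z)) / (2 * \<zeta>)))"
proof -
  define c where "c = \<zeta> - of_real (b_const v j) / (2 * \<zeta>)"
  define L where "L = Ln (ratio v \<zeta> j z)"
  have L: "exp L = ratio v \<zeta> j z" using assms by (simp add: L_def)
  have arg: "\<zeta> - (of_real (b_const v j) + s * (2 * \<i> * \<zeta> * L)) / (2 * \<zeta>) = c - s * (\<i> * L)" for s
  proof -
    have "s * (2 * \<i> * \<zeta> * L) / (2 * \<zeta>) = s * (\<i> * L)" using assms(2) by simp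
    then show ?thesis by (simp add: c_def add_divide_distrib)
  qed
  show "z = exp (- \<i> * (\<zeta> - (of_real (b_const v j) + (- 2 * \<i> * \<zeta> * Ln (ratio v \<zeta> j z))) / (2 * \<zeta>)))" if "j = 3"
  proof -
    have "exp L = z * exp (\<i> * c)" unfolding L using that by (simp add: ratio_def c_def)
    then have "z = exp L * exp (- \<i> * c)" by (simp add: exp_minus)
    also have "\<dots> = exp (- \<i> * (c - (- 1) * (\<i> * L)))"
      by (simp add: algebra_simps flip: exp_add)
    finally show ?thesis unfolding arg[of "- 1", symmetric] by (simp add: L_def)
  qed
  show "z = exp (\<i> * (\<zeta> - (of_real (b_const v j) + 2 * \<i> * \<zeta> * Ln (ratio v \<zeta> j z)) / (2 * \<zeta>)))" if "j \<noteq> 3"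
  proof -
    have "exp L = z * exp (- \<i> * c)" unfolding L using that by (simp add: ratio_def c_def)
    then have "z = exp L * exp (\<i> * c)" by (simp add: exp_minus)
    also have "\<dots> = exp (\<i> * (c - 1 * (\<i> * L)))"
      by (simp add: algebra_simps flip: exp_add)
    finally show ?thesis unfolding arg[of 1, symmetric] by (simp add: L_def)
  qed
qed

text \<open>An exact identity. The factor \<open>exp (2 * \<i> * \<zeta>)\<close> in the squared gap
  of the first two multipliers cancels the normalising exponential, and each difference with the
  third multiplier produces a sine; the two factors -4 against 64 leave the 1/4 that
  \<open>(2 * \<zeta>)\<^sup>2 / (4 * \<zeta>)\<^sup>2\<close> represents.\<close>

lemma discriminant_formula:
  fixes \<zeta> B1 B2 B3 :: complex
  assumes t: "t 1 \<zeta> = exp (\<i> * (\<zeta> - B1 / (2 * \<zeta>)))" "t 2 \<zeta> = exp (\<i> * (\<zeta> - B2 / (2 * \<zeta>)))"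
      "t 3 \<zeta> = exp (- \<i> * (\<zeta> - B3 / (2 * \<zeta>)))"
    and \<zeta>: "\<zeta> \<noteq> 0"
  shows "discriminant t \<zeta> = 1 / (4 * \<zeta>)\<^sup>2 *
      (- (2 * \<zeta>)\<^sup>2 * (exp (- \<i> * B1 / (2 * \<zeta>)) - exp (- \<i> * B2 / (2 * \<zeta>)))\<^sup>2 *
        exp (\<i> * (B3 - B1) / (2 * \<zeta>) + \<i> * (B3 - B2) / (2 * \<zeta>))) *
      (sin (\<zeta> - (B3 + B2) / (4 * \<zeta>)))\<^sup>2 * (sin (\<zeta> - (B3 + B1) / (4 * \<zeta>)))\<^sup>2"
proof -
  define E where "E = exp (\<i> * \<zeta>)"
  define F where "F B = exp (- \<i> * B / (2 * \<zeta>))" for B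
  define G where "G B = exp (\<i> * (B3 - B) / (2 * \<zeta>))" for B
  have EF: "exp (\<i> * (\<zeta> - B / (2 * \<zeta>))) = E * F B" for B
    by (simp add: E_def F_def right_diff_distrib flip: exp_add)
  have sq: "(E * F B - t 3 \<zeta>)\<^sup>2 = - 4 * G B * (sin (\<zeta> - (B3 + B) / (4 * \<zeta>)))\<^sup>2" for B
  proof -
    have 1: "(\<zeta> - B / (2 * \<zeta>)) - (\<zeta> - B3 / (2 * \<zeta>)) = (B3 - B) / (2 * \<zeta>)"
      by (simp add: diff_divide_distrib)
    have 2: "((\<zeta> - B / (2 * \<zeta>)) + (\<zeta> - B3 / (2 * \<zeta>))) / 2 = \<zeta> - (B3 + B) / (4 * \<zeta>)"
      using \<zeta> by (simp add: field_simps)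
    show ?thesis
      unfolding t(3) EF[symmetric] exp_difference_square 1 2 G_def by simp
  qed
  have E2: "exp (- 2 * \<i> * \<zeta>) * (E * E) = 1"
    by (simp add: E_def flip: exp_add)
  have "(t 1 \<zeta> - t 2 \<zeta>)\<^sup>2 = (E * E) * (F B1 - F B2)\<^sup>2"
    unfolding t EF by (simp add: power2_eq_square algebra_simps)
  then have "exp (- 2 * \<i> * \<zeta>) * (t 1 \<zeta> - t 2 \<zeta>)\<^sup>2 = (F B1 - F B2)\<^sup>2"
    using E2 by (simp add: mult.assoc[symmetric])
  moreover have "discriminant t \<zeta> = - (exp (- 2 * \<i> * \<zeta>) * (t 1 \<zeta> - t 2 \<zeta>)\<^sup>2) / 64 *
      (t 1 \<zeta> - t 3 \<zeta>)\<^sup>2 * (t 2 \<zeta> - t 3 \<zeta>)\<^sup>2"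
    by (simp add: discriminant_def)
  ultimately have "discriminant t \<zeta> = - (F B1 - F B2)\<^sup>2 / 64 *
      (E * F B1 - t 3 \<zeta>)\<^sup>2 * (E * F B2 - t 3 \<zeta>)\<^sup>2"
    unfolding t(1,2) EF by simp
  also have "\<dots> = 1 / (4 * \<zeta>)\<^sup>2 * (- (2 * \<zeta>)\<^sup>2 * (F B1 - F B2)\<^sup>2 * (G B1 * G B2)) *
      (sin (\<zeta> - (B3 + B2) / (4 * \<zeta>)))\<^sup>2 * (sin (\<zeta> - (B3 + B1) / (4 * \<zeta>)))\<^sup>2"
    unfolding sq using \<zeta> by (simp add: power2_eq_square)
  finally show ?thesis unfolding F_def G_def exp_add .
qed

text \<open>The labelling is asserted to exist because the convention allows exchanging the labels 1
  and 2, and an exchanged labelling would pair \<open>b_1\<close> with the wrong multiplier whenever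
  \<open>b_o\<close> is nonzero. It is quantified before \<open>\<delta>\<close> and
  \<open>B\<close>, so that one labelling serves all of them. Each o(1) is a function of
  \<open>\<zeta>\<close> and \<open>v\<close> with a limit uniform over \<open>B\<close>.\<close>

theorem theorem1p2:
  "\<exists>\<tau> :: (real \<Rightarrow> complex ^ 2) \<Rightarrow> nat \<Rightarrow> complex \<Rightarrow> complex.
     (\<forall>v\<in>admissible. is_multiplier_labelling v (\<tau> v)) \<and>
     (\<forall>\<delta>::real. 0 < \<delta> \<longrightarrow> \<delta> < 1/2 \<longrightarrow>
       (\<forall>B. B \<subseteq> admissible \<longrightarrow> H1_bounded B \<longrightarrow>
         (\<exists>(r :: nat \<Rightarrow> complex \<Rightarrow> (real \<Rightarrow> complex ^ 2) \<Rightarrow> complex)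
           (s :: nat \<Rightarrow> complex \<Rightarrow> (real \<Rightarrow> complex ^ 2) \<Rightarrow> complex)
           (d :: complex \<Rightarrow> (real \<Rightarrow> complex ^ 2) \<Rightarrow> complex)
           (q :: nat \<Rightarrow> complex \<Rightarrow> (real \<Rightarrow> complex ^ 2) \<Rightarrow> complex).
            (\<forall>j\<in>{1,2,3}. uniform_limit B (r j) (\<lambda>_. 0) (away_at_infinity \<delta>)) \<and>
            (\<forall>j\<in>{1,2,3}. uniform_limit B (s j) (\<lambda>_. 0) (away_at_infinity \<delta>)) \<and>
            uniform_limit B d (\<lambda>_. 0) (away_at_infinity \<delta>) \<and>
            (\<forall>m\<in>{1,2}. uniform_limit B (q m) (\<lambda>_. 0) (away_at_infinity \<delta>)) \<and>
            (\<forall>\<^sub>F \<zeta> in away_at_infinity \<delta>. \<forall>v\<in>B.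
               \<tau> v 3 \<zeta> = exp (- \<i> * (\<zeta> - (of_real (b_const v 3) + r 3 \<zeta> v) / (2 * \<zeta>))) \<and>
               (\<forall>m\<in>{1,2}.
                  \<tau> v m \<zeta> = exp (\<i> * (\<zeta> - (of_real (b_const v m) + r m \<zeta> v) / (2 * \<zeta>)))) \<and>
               (\<forall>j\<in>{1,2,3}.
                  lyapunov (\<tau> v j \<zeta>) = cos (\<zeta> - (of_real (b_const v j) + s j \<zeta> v) / (2 * \<zeta>))) \<and>
               (let k = (\<lambda>m. (of_real (b_const v 3 + b_const v m) + q m \<zeta> v) / (4 * \<zeta>))
                in discriminant (\<tau> v) \<zeta> =
                     1 / (4 * \<zeta>)\<^sup>2 * (of_real (b_o v) + d \<zeta> v) *
                     (sin (\<zeta> - k 2))\<^sup>2 * (sin (\<zeta> - k 1))\<^sup>2)))))"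
proof (rule exI[of _ multiplier_choice], intro conjI ballI allI impI)
  fix v assume "v \<in> admissible"
  then show "is_multiplier_labelling v (multiplier_choice v)"
    unfolding admissible_def using is_multiplier_labelling_choice by blast
next
  fix \<delta> :: real and B :: "(real \<Rightarrow> complex ^ 2) set"
  assume \<delta>: "0 < \<delta>" "\<delta> < 1 / 2" and B: "H1_bounded B"
  define F where "F = away_at_infinity \<delta>"
  define x where "x j \<zeta> v = ratio v \<zeta> j (multiplier_choice v j \<zeta>)" for j \<zeta> v
  \<comment> \<open>The remainder for which the exponential formulas hold identically as soon as the
    ratio is nonzero; only its smallness has to be proved.\<close>
  define r where "r j \<zeta> v = (if j = 3 then - 2 * \<i> * \<zeta> * Ln (x j \<zeta> v) else 2 * \<i> * \<zeta> * Ln (x j \<zeta> v))"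
    for j :: nat and \<zeta> v
  define err where "err \<zeta> v = labelling_error v \<zeta> (\<lambda>j. multiplier_choice v j \<zeta>)" for \<zeta> v
  define b where "b j v = complex_of_real (b_const v j)" for j v
  \<comment> \<open>The exact factor in front of the sines in the discriminant; the remainder
    \<open>d\<close> is then its distance from \<open>b_o\<close>.\<close>
  define X where "X \<zeta> v = - (2 * \<zeta>)\<^sup>2 *
      (exp (- \<i> * (b 1 v + r 1 \<zeta> v) / (2 * \<zeta>)) - exp (- \<i> * (b 2 v + r 2 \<zeta> v) / (2 * \<zeta>)))\<^sup>2 *
      exp (\<i> * ((b 3 v + r 3 \<zeta> v) - (b 1 v + r 1 \<zeta> v)) / (2 * \<zeta>) +
        \<i> * ((b 3 v + r 3 \<zeta> v) - (b 2 v + r 2 \<zeta> v)) / (2 * \<zeta>))" for \<zeta> v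
  define d where "d \<zeta> v = X \<zeta> v - of_real (b_o v)" for \<zeta> v
  define q where "q m \<zeta> v = r 3 \<zeta> v + r m \<zeta> v" for m \<zeta> v
  have small: "\<forall>\<^sub>F \<zeta> in F. \<forall>v\<in>B. err \<zeta> v \<le> \<epsilon>" if "0 < \<epsilon>" for \<epsilon>
    unfolding F_def err_def by (rule eventually_labelling_error_small[OF \<delta> that B])
  have large: "\<forall>\<^sub>F \<zeta> in F. K \<le> cmod \<zeta>" for K
    unfolding F_def by (rule eventually_ge_away_at_infinity)
  obtain \<beta> where \<beta>: "1 \<le> \<beta>" "\<And>v j. v \<in> B \<Longrightarrow> \<bar>b_const v j\<bar> \<le> \<beta>"
    "\<And>v. v \<in> B \<Longrightarrow> (b_const v 1 - b_const v 2)\<^sup>2 = b_o v"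
    by (rule b_const_bounded[OF B]) (rule that)
  have x: "cmod \<zeta> * cmod (x j \<zeta> v - 1) \<le> err \<zeta> v" if "j \<in> {1,2,3}" for j \<zeta> v
    unfolding x_def err_def by (rule ratio_le_labelling_error[OF that])
  \<comment> \<open>Within distance 1/2 of 1 the ratio is nonzero and its principal logarithm is at
    most twice the distance, so that \<open>r\<close> is at most four times the labelling
    error.\<close>
  have x_near: "cmod (x j \<zeta> v - 1) < 1 / 2" if "j \<in> {1,2,3}" "err \<zeta> v \<le> 1 / 4" "1 \<le> cmod \<zeta>" for j \<zeta> v
  proof -
    have "1 * cmod (x j \<zeta> v - 1) \<le> cmod \<zeta> * cmod (x j \<zeta> v - 1)"
      using that by (intro mult_right_mono) auto
    then show ?thesis using x[OF that(1), of \<zeta> v] that(2) by linarith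
  qed
  have r_le: "cmod (r j \<zeta> v) \<le> 4 * err \<zeta> v" if "j \<in> {1,2,3}" "err \<zeta> v \<le> 1 / 4" "1 \<le> cmod \<zeta>" for j \<zeta> v
  proof -
    have "cmod (r j \<zeta> v) = 2 * cmod \<zeta> * cmod (Ln (x j \<zeta> v))"
      by (simp add: r_def norm_mult)
    also have "\<dots> \<le> 2 * cmod \<zeta> * (2 * cmod (x j \<zeta> v - 1))"
      using norm_Ln_le[OF x_near[OF that]] by (intro mult_left_mono) auto
    finally show ?thesis using x[OF that(1), of \<zeta> v] by simp
  qed
  have r_lim: "uniform_limit B (r j) (\<lambda>_. 0) F" if j: "j \<in> {1,2,3}" for j
  proof (rule uniform_limitI)
    fix e :: real assume e: "0 < e"
    have "\<forall>\<^sub>F \<zeta> in F. \<forall>v\<in>B. err \<zeta> v \<le> min (1 / 4) (e / 8)" by (rule small) (use e in simp)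
    then show "\<forall>\<^sub>F \<zeta> in F. \<forall>v\<in>B. dist (r j \<zeta> v) 0 < e"
      using large[of 1]
    proof eventually_elim
      case (elim \<zeta>)
      show ?case
      proof
        fix v assume "v \<in> B"
        then have "err \<zeta> v \<le> 1 / 4" "err \<zeta> v \<le> e / 8" using elim(1) by auto
        then have "cmod (r j \<zeta> v) \<le> 4 * (e / 8)" using r_le[OF j _ elim(2), of v] by linarith
        then show "dist (r j \<zeta> v) 0 < e" using e by simp
      qed
    qed
  qed
  have d_lim: "uniform_limit B d (\<lambda>_. 0) F"
  proof (rule uniform_limitI)
    fix e :: real assume e: "0 < e"
    define \<gamma> where "\<gamma> = 2 * (\<beta> + 1)"
    have \<gamma>: "0 < \<gamma>" using \<beta>(1) by (simp add: \<gamma>_def)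
    \<comment> \<open>Makes \<open>6 * \<gamma> * \<epsilon> \<le> e / 4\<close>, while the minimum
      with 1 meets the hypothesis of \<open>gap_estimate\<close>. The part proportional to
      \<open>1 / cmod \<zeta>\<close> gets \<open>e / 2\<close>.\<close>
    define \<epsilon> where "\<epsilon> = min 1 (e / (24 * \<gamma>))"
    have \<epsilon>: "0 < \<epsilon>" "\<epsilon> \<le> 1" using e \<gamma> by (simp_all add: \<epsilon>_def)
    have "6 * \<gamma> * \<epsilon> \<le> 6 * \<gamma> * (e / (24 * \<gamma>))" unfolding \<epsilon>_def using \<gamma> by (intro mult_left_mono) auto
    also have "\<dots> = e / 4" using \<gamma> by simp
    finally have 1: "6 * \<gamma> * \<epsilon> \<le> e / 4" .
    have "\<forall>\<^sub>F \<zeta> in F. \<forall>v\<in>B. err \<zeta> v \<le> \<epsilon> / 4" by (rule small) (use \<epsilon> in simp)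
    then show "\<forall>\<^sub>F \<zeta> in F. \<forall>v\<in>B. dist (d \<zeta> v) 0 < e"
      using large[of "max (16 * (\<beta> + 1)) (17 * \<gamma>^3 * 2 / e)"]
    proof eventually_elim
      case (elim \<zeta>)
      have \<zeta>: "16 * (\<beta> + 1) \<le> cmod \<zeta>" "17 * \<gamma>^3 * 2 / e \<le> cmod \<zeta>" "1 \<le> cmod \<zeta>" using elim(2) \<beta>(1) by auto
      have "0 < cmod \<zeta>" using \<zeta>(3) by linarith
      then have 2: "17 * \<gamma>^3 / cmod \<zeta> \<le> e / 2"
        using \<zeta>(2) e unfolding pos_divide_le_eq[OF e] pos_divide_le_eq[OF \<open>0 < cmod \<zeta>\<close>]
        by (simp add: algebra_simps)
      show ?case
      proof
        fix v assume v: "v \<in> B"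
        then have "err \<zeta> v \<le> \<epsilon> / 4" using elim(1) by auto
        then have r: "cmod (r j \<zeta> v) \<le> \<epsilon>" if "j \<in> {1,2,3}" for j
          using r_le[OF that _ \<zeta>(3), of v] \<epsilon>(2) by linarith
        have "cmod (d \<zeta> v) \<le> 6 * \<gamma> * \<epsilon> + 17 * \<gamma>^3 / cmod \<zeta>"
          unfolding d_def X_def b_def \<beta>(3)[OF v, symmetric] \<gamma>_def
          by (rule gap_estimate[OF \<beta>(1) \<beta>(2)[OF v] \<beta>(2)[OF v] \<beta>(2)[OF v] r r r \<epsilon>(2) \<zeta>(1)]) auto
        then show "dist (d \<zeta> v) 0 < e" using 1 2 e by simp
      qed
    qed
  qed
  have q_lim: "uniform_limit B (q m) (\<lambda>_. 0) F" if "m \<in> {1,2}" for m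
    unfolding q_def using uniform_limit_add[OF r_lim[of 3] r_lim[of m]] that by auto
  have formulas: "\<forall>\<^sub>F \<zeta> in F. \<forall>v\<in>B.
      multiplier_choice v 3 \<zeta> = exp (- \<i> * (\<zeta> - (b 3 v + r 3 \<zeta> v) / (2 * \<zeta>))) \<and>
      (\<forall>m\<in>{1,2}. multiplier_choice v m \<zeta> = exp (\<i> * (\<zeta> - (b m v + r m \<zeta> v) / (2 * \<zeta>)))) \<and>
      (\<forall>j\<in>{1,2,3}. lyapunov (multiplier_choice v j \<zeta>) = cos (\<zeta> - (b j v + r j \<zeta> v) / (2 * \<zeta>))) \<and>
      discriminant (multiplier_choice v) \<zeta> = 1 / (4 * \<zeta>)\<^sup>2 * X \<zeta> v *
        (sin (\<zeta> - ((b 3 v + r 3 \<zeta> v) + (b 2 v + r 2 \<zeta> v)) / (4 * \<zeta>)))\<^sup>2 *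
        (sin (\<zeta> - ((b 3 v + r 3 \<zeta> v) + (b 1 v + r 1 \<zeta> v)) / (4 * \<zeta>)))\<^sup>2"
    using small[of "1 / 4", simplified] large[of 1]
  proof eventually_elim
    case (elim \<zeta>)
    show ?case
    proof (rule ballI)
      fix v assume v: "v \<in> B"
      have \<zeta>: "\<zeta> \<noteq> 0" using elim(2) by auto
      have nz: "x j \<zeta> v \<noteq> 0" if "j \<in> {1,2,3}" for j
        using x_near[OF that _ elim(2), of v] elim(1) v by auto
      have t3: "multiplier_choice v 3 \<zeta> = exp (- \<i> * (\<zeta> - (b 3 v + r 3 \<zeta> v) / (2 * \<zeta>)))"
        using multiplier_eq_exp_Ln_ratio(1)[OF nz[unfolded x_def] \<zeta>, of 3] by (simp add: b_def r_def x_def)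
      have tm: "multiplier_choice v m \<zeta> = exp (\<i> * (\<zeta> - (b m v + r m \<zeta> v) / (2 * \<zeta>)))" if "m \<in> {1,2}" for m
      proof -
        have m: "m \<in> {1,2,3}" "m \<noteq> 3" using that by auto
        from multiplier_eq_exp_Ln_ratio(2)[OF nz[OF m(1), unfolded x_def] \<zeta> m(2)] show ?thesis
          using m(2) by (simp add: b_def r_def x_def)
      qed
      have lyap: "lyapunov (multiplier_choice v j \<zeta>) = cos (\<zeta> - (b j v + r j \<zeta> v) / (2 * \<zeta>))" if "j \<in> {1,2,3}" for j
      proof (cases "j = 3")
        case True
        then show ?thesis by (simp only: t3 lyapunov_exp)
      next
        case False
        then have "j \<in> {1,2}" using that by auto
        then show ?thesis by (simp only: tm lyapunov_exp)
      qed
      have "discriminant (multiplier_choice v) \<zeta> = 1 / (4 * \<zeta>)\<^sup>2 * X \<zeta> v *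
        (sin (\<zeta> - ((b 3 v + r 3 \<zeta> v) + (b 2 v + r 2 \<zeta> v)) / (4 * \<zeta>)))\<^sup>2 *
        (sin (\<zeta> - ((b 3 v + r 3 \<zeta> v) + (b 1 v + r 1 \<zeta> v)) / (4 * \<zeta>)))\<^sup>2"
        unfolding X_def by (rule discriminant_formula[where t = "multiplier_choice v", OF tm tm t3 \<zeta>]) auto
      with t3 tm lyap show "multiplier_choice v 3 \<zeta> = exp (- \<i> * (\<zeta> - (b 3 v + r 3 \<zeta> v) / (2 * \<zeta>))) \<and>
          (\<forall>m\<in>{1,2}. multiplier_choice v m \<zeta> = exp (\<i> * (\<zeta> - (b m v + r m \<zeta> v) / (2 * \<zeta>)))) \<and>
          (\<forall>j\<in>{1,2,3}. lyapunov (multiplier_choice v j \<zeta>) = cos (\<zeta> - (b j v + r j \<zeta> v) / (2 * \<zeta>))) \<and>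
          discriminant (multiplier_choice v) \<zeta> = 1 / (4 * \<zeta>)\<^sup>2 * X \<zeta> v *
            (sin (\<zeta> - ((b 3 v + r 3 \<zeta> v) + (b 2 v + r 2 \<zeta> v)) / (4 * \<zeta>)))\<^sup>2 *
            (sin (\<zeta> - ((b 3 v + r 3 \<zeta> v) + (b 1 v + r 1 \<zeta> v)) / (4 * \<zeta>)))\<^sup>2"
        by blast
    qed
  qed
  have shift: "of_real (b_const v 3 + b_const v m) + q m \<zeta> v = (b 3 v + r 3 \<zeta> v) + (b m v + r m \<zeta> v)" for m \<zeta> v
    by (simp add: b_def q_def)
  have X: "of_real (b_o v) + d \<zeta> v = X \<zeta> v" for \<zeta> v by (simp add: d_def)
  show "\<exists>(r :: nat \<Rightarrow> complex \<Rightarrow> (real \<Rightarrow> complex ^ 2) \<Rightarrow> complex)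
           (s :: nat \<Rightarrow> complex \<Rightarrow> (real \<Rightarrow> complex ^ 2) \<Rightarrow> complex)
           (d :: complex \<Rightarrow> (real \<Rightarrow> complex ^ 2) \<Rightarrow> complex)
           (q :: nat \<Rightarrow> complex \<Rightarrow> (real \<Rightarrow> complex ^ 2) \<Rightarrow> complex).
            (\<forall>j\<in>{1,2,3}. uniform_limit B (r j) (\<lambda>_. 0) (away_at_infinity \<delta>)) \<and>
            (\<forall>j\<in>{1,2,3}. uniform_limit B (s j) (\<lambda>_. 0) (away_at_infinity \<delta>)) \<and>
            uniform_limit B d (\<lambda>_. 0) (away_at_infinity \<delta>) \<and>
            (\<forall>m\<in>{1,2}. uniform_limit B (q m) (\<lambda>_. 0) (away_at_infinity \<delta>)) \<and>
            (\<forall>\<^sub>F \<zeta> in away_at_infinity \<delta>. \<forall>v\<in>B.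
               multiplier_choice v 3 \<zeta> = exp (- \<i> * (\<zeta> - (of_real (b_const v 3) + r 3 \<zeta> v) / (2 * \<zeta>))) \<and>
               (\<forall>m\<in>{1,2}.
                  multiplier_choice v m \<zeta> = exp (\<i> * (\<zeta> - (of_real (b_const v m) + r m \<zeta> v) / (2 * \<zeta>)))) \<and>
               (\<forall>j\<in>{1,2,3}.
                  lyapunov (multiplier_choice v j \<zeta>) = cos (\<zeta> - (of_real (b_const v j) + s j \<zeta> v) / (2 * \<zeta>))) \<and>
               (let k = (\<lambda>m. (of_real (b_const v 3 + b_const v m) + q m \<zeta> v) / (4 * \<zeta>))
                in discriminant (multiplier_choice v) \<zeta> =
                     1 / (4 * \<zeta>)\<^sup>2 * (of_real (b_o v) + d \<zeta> v) *
                     (sin (\<zeta> - k 2))\<^sup>2 * (sin (\<zeta> - k 1))\<^sup>2))"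
    unfolding F_def[symmetric]
    \<comment> \<open>The Lyapunov branches take the same remainder \<open>r\<close> as the
      multipliers: the average of an exponential and its inverse is the cosine of the same argument,
      for either sign of the exponent.\<close>
    apply (rule exI[of _ r], rule exI[of _ r], rule exI[of _ d], rule exI[of _ q])
    unfolding Let_def shift X b_def[symmetric]
    by (intro conjI ballI r_lim d_lim q_lim formulas)
qed

end
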